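(* Let $\mu\subset\lambda$ be partitions, $r\ge1$ an integer with $r\ge\ell(\lambda)$ (pad $\lambda,\mu$ with zeros to $r$ parts), and $m$ a nonnegative integer with $m\le r-\ell(\mu)$. Then $$G_{\lambda/\mu}(x_1,\dots,x_m)=\det\left(\sum_{k=0}^{\mu_j-j+r}\binom{-j}{k}\beta^k\,H^{(i-1)}_{\lambda_i-\mu_j-i+j+k}(x_1,\dots,x_m)\right)_{1\le i,j\le r},$$ where $H^{(i)}_p(x_1,\dots,x_m)=\sum_{n\ge0}\binom{i}{n}\beta^n h_{p+n}(x_1,\dots,x_m)$ for $i\ge0$, $p\in\mathbb Z$.
   Context: $k=\mathbb{C}(\beta)$; $\Lambda$ is the $k$-algebra of symmetric functions in $x=(x_1,x_2,\dots)$, with Schur functions $s_\lambda$, complete symmetric functions $h_m$ ($h_0=1$, $h_m=0$ for $m<0$), and Hall inner product $\langle s_\lambda,s_\mu\rangle=\delta_{\lambda,\mu}$. $I_n=\mathrm{span}_k\{s_\lambda:\ell(\lambda)>n\}$ and $\widehat\Lambda=\varprojlim\Lambda/I_n$; elements of $\widehat\Lambda$ are formal sums $\sum c_\lambda s_\lambda$ such that for every $n$ only finitely many $\lambda$ with $\ell(\lambda)\le n$ have $c_\lambda\neq0$. The Hall product extends to $\widehat\Lambda\times\Lambda\to k$. For $f\in\Lambda$, $f^\perp:\widehat\Lambda\to\widehat\Lambda$ is defined by $\langle f^\perp g,h\rangle=\langle g,fh\rangle$ for all $h\in\Lambda$. The stable Grothendieck polynomial $G_\lambda(x)\in\widehat\Lambda$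 is the unique element such that for all $n\ge\ell(\lambda)$, $G_\lambda(x_1,\dots,x_n,0,0,\dots)=\det\bigl(x_i^{\lambda_j+n-j}(1+\beta x_i)^{j-1}\bigr)_{1\le i,j\le n}/\prod_{1\le i<j\le n}(x_i-x_j)$. The dual stable Grothendieck polynomials $g_\mu\in\Lambda$ are determined by $\langle G_\lambda,g_\mu\rangle=\delta_{\lambda,\mu}$. Put $G_{\lambda/\!\!/\mu}=g_\mu^\perp G_\lambda$. A rook strip is a skew diagram with at most one box in any row or column. The skew stable Grothendieck polynomials $G_{\lambda/\mu}(x)\in\widehat\Lambda$ ($\mu\subset\lambda$) are the unique elements satisfying $G_{\lambda/\!\!/\mu}(x)=\sum_{\sigma:\ \mu/\sigma\text{ rook strip}}\beta^{|\mu/\sigma|}G_{\lambda/\sigma}(x)$ for all $\mu\subset\lambda$ (the sum includes $\sigma=\mu$). $G_{\lambda/\mu}(x_1,\dots,x_m)=G_{\lambda/\mu}(x_1,\dots,x_m,0,0,\dots)$. Binomials: $\binom{a}{n}=a(a-1)\cdots(a-n+1)/n!$ for $a\in\mathbb Z$, $n\ge0$. *)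

theory Defs
  imports
    "HOL-Computational_Algebra.Polynomial"
    "HOL-Computational_Algebra.Fraction_Field"
    "HOL-Library.Poly_Mapping"
    "Jordan_Normal_Form.Determinant"
begin

section \<open>Ground field, monomials, polynomials\<close>

type_synonym K = "complex poly fract"

instance fract :: ("{idom, ring_char_0}") field_char_0
proof
  have of_nat_Fract: "(of_nat n :: 'a fract) = Fract (of_nat n) 1" for n
    by (induction n) (simp_all add: Zero_fract_def One_fract_def)
  show "inj (of_nat :: nat \<Rightarrow> 'a fract)"
    by (rule injI) (simp add: of_nat_Fract eq_fract)
qed

definition \<beta> :: K where
  "\<beta> = Fract [:0, 1:] 1"

text \<open>
  The variables are numbered from 0: the variable with index \<open>i\<close> below is $x_{i+1}$.
  A monomial is its finitely supported exponent vector.  An element of \<open>kpoly\<close> is a polynomial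
  (only finitely many monomials), an element of \<open>kseries\<close> an arbitrary formal power series
  in $x_1, x_2, \dots$.
\<close>

type_synonym monom = "nat \<Rightarrow>\<^sub>0 nat"
type_synonym kpoly = "monom \<Rightarrow>\<^sub>0 K"
type_synonym kseries = "monom \<Rightarrow> K"

definition mdeg :: "monom \<Rightarrow> nat" where
  "mdeg a = (\<Sum>i\<in>Poly_Mapping.keys a. Poly_Mapping.lookup a i)"

definition xvar :: "nat \<Rightarrow> kpoly" where
  "xvar i = Poly_Mapping.single (Poly_Mapping.single i 1) 1"

definition cst :: "K \<Rightarrow> kpoly" where
  "cst c = Poly_Mapping.single 0 c"

definition vandermonde :: "nat \<Rightarrow> kpoly" where
  "vandermonde n = (\<Prod>i<n. \<Prod>j\<in>{i<..<n}. xvar i - xvar j)"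

section \<open>Partitions\<close>

text \<open>Partitions are padded with infinitely many zeros; \<open>part la i\<close> is $\lambda_{i+1}$.\<close>

typedef ptn = "{p :: nat \<Rightarrow> nat. antimono p \<and> finite {i. p i \<noteq> 0}}"
  morphisms part Ptn
  by (rule exI[of _ "\<lambda>_. 0"]) (auto simp: antimono_def)

definition len :: "ptn \<Rightarrow> nat" where
  "len la = card {i. part la i \<noteq> 0}"

definition contained :: "ptn \<Rightarrow> ptn \<Rightarrow> bool" where
  "contained mu la \<longleftrightarrow> (\<forall>i. part mu i \<le> part la i)"

definition skew_diagram :: "ptn \<Rightarrow> ptn \<Rightarrow> (nat \<times> nat) set" where
  "skew_diagram la mu = {(i, j). part mu i \<le> j \<and> j < part la i}"

definition rook_strip :: "ptn \<Rightarrow> ptn \<Rightarrow> bool" where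
  "rook_strip mu sg \<longleftrightarrow> contained sg mu \<and>
     (\<forall>b\<in>skew_diagram mu sg. \<forall>c\<in>skew_diagram mu sg.
        b \<noteq> c \<longrightarrow> fst b \<noteq> fst c \<and> snd b \<noteq> snd c)"

section \<open>Symmetric functions\<close>

definition symmetric :: "kseries \<Rightarrow> bool" where
  "symmetric f \<longleftrightarrow> (\<forall>\<pi> a. bij \<pi> \<longrightarrow> f (Poly_Mapping.map_key \<pi> a) = f a)"

definition Lam :: "kseries set" where
  "Lam = {f. symmetric f \<and> (\<exists>d. \<forall>a. f a \<noteq> 0 \<longrightarrow> mdeg a \<le> d)}"

definition series_mult :: "kseries \<Rightarrow> kseries \<Rightarrow> kseries" where
  "series_mult f g = (\<lambda>c. \<Sum>(a, b)\<in>{(a, b). a + b = c}. f a * g b)"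

text \<open>
  \<open>restrict_vars n f\<close> is $f(x_1, \dots, x_n, 0, 0, \dots)$; it is meant for series \<open>f\<close> of bounded
  degree, for which this is a polynomial.
\<close>

definition restrict_vars :: "nat \<Rightarrow> kseries \<Rightarrow> kpoly" where
  "restrict_vars n f = Abs_poly_mapping (\<lambda>a. if Poly_Mapping.keys a \<subseteq> {..<n} then f a else 0)"

definition hsym :: "int \<Rightarrow> kseries" where
  "hsym p = (\<lambda>a. if int (mdeg a) = p then 1 else 0)"

text \<open>
  The Schur function is the element of $\Lambda$ given by the ratios of alternants
  $\det(x_i^{\lambda_j+n-j}) / \prod_{i<j}(x_i-x_j)$ for all $n \ge \ell(\lambda)$.
  Here and below a quotient by the (nonzero) Vandermonde product is written by
  multiplying through.
\<close>

definition schur :: "ptn \<Rightarrow> kseries" where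
  "schur la = (THE f. f \<in> Lam \<and> (\<forall>n\<ge>len la.
     restrict_vars n f * vandermonde n =
       det (mat n n (\<lambda>(i, j). xvar i ^ (part la j + n - Suc j)))))"

text \<open>Coordinates of an element of $\Lambda$ in the Schur basis.\<close>

definition schur_coeffs :: "kseries \<Rightarrow> ptn \<Rightarrow> K" where
  "schur_coeffs f = (THE c. finite {la. c la \<noteq> 0} \<and>
     f = (\<lambda>a. \<Sum>la | c la \<noteq> 0. c la * schur la a))"

section \<open>The completion\<close>

text \<open>
  An element of $\widehat\Lambda = \varprojlim \Lambda / I_n$ is a formal sum
  $\sum_\lambda c_\lambda s_\lambda$ and is represented by its coefficient family \<open>c\<close>.
\<close>

type_synonym formal = "ptn \<Rightarrow> K"

definition Lam_hat :: "formal set" where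
  "Lam_hat = {c. \<forall>n. finite {la. len la \<le> n \<and> c la \<noteq> 0}}"

text \<open>
  \<open>hat_restrict n c\<close> is the value of the formal sum at $(x_1, \dots, x_n, 0, 0, \dots)$.  The terms
  with $\ell(\lambda) > n$, which span $I_n$, vanish there.
\<close>

definition hat_restrict :: "nat \<Rightarrow> formal \<Rightarrow> kpoly" where
  "hat_restrict n c =
     (\<Sum>la | len la \<le> n \<and> c la \<noteq> 0. cst (c la) * restrict_vars n (schur la))"

definition hall :: "formal \<Rightarrow> kseries \<Rightarrow> K" where
  "hall c f = (\<Sum>la | schur_coeffs f la \<noteq> 0. c la * schur_coeffs f la)"

definition perp :: "kseries \<Rightarrow> formal \<Rightarrow> formal" where
  "perp f c = (THE u. u \<in> Lam_hat \<and> (\<forall>w\<in>Lam. hall u w = hall c (series_mult f w)))"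

section \<open>Grothendieck polynomials\<close>

definition Groth :: "ptn \<Rightarrow> formal" where
  "Groth la = (THE c. c \<in> Lam_hat \<and> (\<forall>n\<ge>len la.
     hat_restrict n c * vandermonde n =
       det (mat n n (\<lambda>(i, j). xvar i ^ (part la j + n - Suc j) * (1 + cst \<beta> * xvar i) ^ j))))"

definition dual_g :: "ptn \<Rightarrow> kseries" where
  "dual_g mu = (THE f. f \<in> Lam \<and> (\<forall>la. hall (Groth la) f = (if la = mu then 1 else 0)))"

definition G_dslash :: "ptn \<Rightarrow> ptn \<Rightarrow> formal" where
  "G_dslash la mu = perp (dual_g mu) (Groth la)"

text \<open>
  \<open>G_skew la\<close> is the whole family $(G_{\lambda/\mu})_{\mu\subset\lambda}$, set to 0 at the
  irrelevant indices $\mu\not\subset\lambda$ so that it is unique as a function.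
\<close>

definition G_skew :: "ptn \<Rightarrow> ptn \<Rightarrow> formal" where
  "G_skew la = (THE F.
     (\<forall>mu. \<not> contained mu la \<longrightarrow> F mu = (\<lambda>_. 0)) \<and>
     (\<forall>mu. contained mu la \<longrightarrow> F mu \<in> Lam_hat \<and>
        G_dslash la mu =
          (\<lambda>nu. \<Sum>sg | rook_strip mu sg. \<beta> ^ card (skew_diagram mu sg) * F sg nu)))"

text \<open>
  \<open>H_fun m i p\<close> is $H^{(i)}_p(x_1, \dots, x_m)$; the sum over all $n \ge 0$ stops at \<open>i\<close> because
  $\binom{i}{n} = 0$ for $n > i$.
\<close>

definition H_fun :: "nat \<Rightarrow> nat \<Rightarrow> int \<Rightarrow> kpoly" where
  "H_fun m i p = (\<Sum>n\<le>i. cst (of_nat (i choose n) * \<beta> ^ n) * restrict_vars m (hsym (p + int n)))"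

end

theory Submission
  imports Defs "HOL-Computational_Algebra.Formal_Power_Series"
begin

text \<open>
  Write $F_i(t) = (1 + \beta t)^{i-1}$ and $E_j(t) = (1 + \beta t)^{-j}$.  Expanding the bialternant by
  Cauchy--Binet gives $G_\lambda = \sum_\rho a_{\lambda\rho} s_\rho$ with $a_{\lambda\rho}$ the determinant of the
  coefficients of $F_i$ at $\rho_j - j - \lambda_i + i$.  Let $c_{\kappa\sigma}$ be the determinant of the
  coefficients of $E_j$ at $\sigma_j - j - \kappa_i + i$.  By Cauchy--Binet again, $a c$ is the determinant
  belonging to the products $F_i E_j$, which is upper triangular and equals $(-\beta)^{|\sigma/\lambda|}$ for
  $\lambda \subset \sigma$ and 0 otherwise.  This is inverted by the matrix
  $\beta^{|\mu/\sigma|}$ over rook strips $\mu/\sigma$, so $g_\mu = \sum_\sigma \beta^{|\mu/\sigma|} \sum_\kappa c_{\kappa\sigma} s_\kappa$.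

  Multiplication by $s_\kappa$ is adjoint to $s_\rho \mapsto s_{\rho/\kappa} = \det(h_{\rho_i-i-\kappa_j+j})$, and in $m$ variables
  only $\rho$ with $\ell(\rho) \le \ell(\kappa) + m$ contribute.  Hence $g_\mu^\perp G_\lambda$ in $m$ variables is
  $\sum_\sigma \beta^{|\mu/\sigma|} \sum_{\kappa,\rho} a_{\lambda\rho} s_{\rho/\kappa} c_{\kappa\sigma}$, and two more applications of Cauchy--Binet turn
  the inner sum into the determinant of the theorem with $\sigma$ in place of $\mu$.  The
  rook strip relation determines the skew polynomials, so each of them equals its determinant.
\<close>

section \<open>Determinants and the Cauchy--Binet formula\<close>

text \<open>The obstacle is that G_la has Schur terms of unbounded length, while a determinant of
  size r sees only partitions with at most r rows. The number of variables closes this gap: at \<nu>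
  with at most m rows, the coefficient of g_mu^perp G_la involves \<rho> only if the skew Schur
  function of \<rho>/\<kappa> survives in m variables, and then \<rho> has at most len mu + m rows
  because \<kappa> lies in mu. This is the origin of the hypothesis m <= r - len mu. The other
  truncation, k <= mu_j - j + r, records that the exponents summed over in Cauchy-Binet are
  nonnegative.

  Schur functions, G, g, perp and the skew family are all given by unique existence, so each needs a
  witness and a uniqueness argument. The common tool is that the coefficient of s_\<nu> in f is the
  coefficient of x^(\<nu>+\<delta>), with \<delta> = (n-1, ..., 0), in f times the Vandermonde
  product, for every number of variables n >= len \<nu>. Schur functions exist because a
  Jacobi-Trudi determinant of fixed size makes sense in any number of variables.\<close>

definition fdet :: "nat \<Rightarrow> (nat \<Rightarrow> nat \<Rightarrow> 'a::comm_ring_1) \<Rightarrow> 'a" where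
  "fdet n f = det (mat n n (\<lambda>(i, j). f i j))"

lemma permutes_lt: "p permutes {..<n} \<Longrightarrow> i < n \<Longrightarrow> p i < (n::nat)"
  using permutes_in_image[of p "{..<n}" i] by simp

lemma fdet_rows: "fdet n f = (\<Sum>p | p permutes {..<n}. signof p * (\<Prod>i<n. f i (p i)))"
proof -
  have "fdet n f = (\<Sum>p | p permutes {..<n}. signof p * (\<Prod>i<n. mat n n (\<lambda>(i, j). f i j) $$ (i, p i)))"
    unfolding fdet_def by (subst det_def'[of _ n]) (simp_all add: atLeast0LessThan)
  also have "\<dots> = (\<Sum>p | p permutes {..<n}. signof p * (\<Prod>i<n. f i (p i)))"
    by (intro sum.cong refl arg_cong2[where f = "(*)"] prod.cong) (auto simp: permutes_lt)
  finally show ?thesis .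
qed

lemma fdet_cong: "(\<And>i j. i < n \<Longrightarrow> j < n \<Longrightarrow> f i j = g i j) \<Longrightarrow> fdet n f = fdet n g"
  unfolding fdet_def by (rule arg_cong[of _ _ det]) auto

lemma fdet_transpose: "fdet n (\<lambda>i j. f j i) = fdet n f"
proof -
  have "mat n n (\<lambda>(i, j). f j i) = transpose_mat (mat n n (\<lambda>(i, j). f i j))" by auto
  then show ?thesis unfolding fdet_def by (simp add: det_transpose[of _ n])
qed

lemma fdet_cols: "fdet n f = (\<Sum>p | p permutes {..<n}. signof p * (\<Prod>i<n. f (p i) i))"
  by (rule trans[OF fdet_transpose[symmetric] fdet_rows])

lemma fdet_permute_rows:
  assumes "p permutes {..<n}"
  shows "fdet n (\<lambda>i j. f (p i) j) = signof p * fdet n f"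
proof -
  have "fdet n (\<lambda>i j. f (p i) j) = det (mat n n (\<lambda>(i, j). mat n n (\<lambda>(i, j). f i j) $$ (p i, j)))"
    unfolding fdet_def using assms by (intro arg_cong[of _ _ det] eq_matI) (auto simp: permutes_lt)
  also have "\<dots> = signof p * fdet n f"
    unfolding fdet_def using assms by (intro det_permute_rows) (auto simp: atLeast0LessThan)
  finally show ?thesis .
qed

lemma fdet_identical_rows:
  assumes "i \<noteq> j" "i < n" "j < n" "\<And>k. k < n \<Longrightarrow> f i k = f j k"
  shows "fdet n f = 0"
  unfolding fdet_def using assms by (intro det_identical_rows[of _ n i j]) (auto intro: eq_vecI)

lemma fdet_mult: "fdet n (\<lambda>i j. \<Sum>k<n. f i k * g k j) = fdet n f * fdet n g"
proof -
  have "mat n n (\<lambda>(i, j). \<Sum>k<n. f i k * g k j) = mat n n (\<lambda>(i, j). f i j) * mat n n (\<lambda>(i, j). g i j)"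
    by (rule eq_matI) (auto simp: scalar_prod_def atLeast0LessThan)
  then show ?thesis unfolding fdet_def by (simp add: det_mult[of _ n])
qed

lemma fdet_upper_triangular:
  assumes "\<And>i j. j < i \<Longrightarrow> i < n \<Longrightarrow> f i j = 0"
  shows "fdet n f = (\<Prod>i<n. f i i)"
proof -
  have "fdet n f = prod_list (diag_mat (mat n n (\<lambda>(i, j). f i j)))"
    unfolding fdet_def by (rule det_upper_triangular[of _ n]) (auto simp: upper_triangular_def assms)
  then show ?thesis
    by (simp add: prod_list_diag_prod atLeast0LessThan)
qed

lemma fdet_lower_triangular:
  assumes "\<And>i j. i < j \<Longrightarrow> j < n \<Longrightarrow> f i j = 0"
  shows "fdet n f = (\<Prod>i<n. f i i)"
  by (rule trans[OF fdet_transpose[symmetric] fdet_upper_triangular]) (rule assms)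

lemma fdet_last_row:
  assumes "\<And>j. j < n \<Longrightarrow> f n j = 0"
  shows "fdet (Suc n) f = f n n * fdet n f"
proof -
  let ?A = "mat (Suc n) (Suc n) (\<lambda>(i, j). f i j)"
  have "det ?A = (\<Sum>j<Suc n. ?A $$ (n, j) * cofactor ?A n j)"
    by (rule laplace_expansion_row) auto
  also have "\<dots> = f n n * cofactor ?A n n"
    using assms by simp
  also have "cofactor ?A n n = det (mat_delete ?A n n)"
    unfolding cofactor_def by simp
  also have "mat_delete ?A n n = mat n n (\<lambda>(i, j). f i j)"
    unfolding mat_delete_def by (rule eq_matI) auto
  finally show ?thesis unfolding fdet_def .
qed

lemma fdet_scale_rows: "fdet n (\<lambda>i j. c i * f i j) = (\<Prod>i<n. c i) * fdet n f"
  unfolding fdet_rows by (simp add: sum_distrib_left prod.distrib mult_ac)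

lemma fdet_eq_0_kernel:
  fixes f :: "nat \<Rightarrow> nat \<Rightarrow> 'a::idom"
  assumes "\<And>i. i < n \<Longrightarrow> (\<Sum>j<n. f i j * v j) = 0" "k < n" "v k \<noteq> 0"
  shows "fdet n f = 0"
proof -
  have "vec n v \<in> carrier_vec n \<and> vec n v \<noteq> 0\<^sub>v n \<and> mat n n (\<lambda>(i, j). f i j) *\<^sub>v vec n v = 0\<^sub>v n"
  proof (intro conjI)
    show "vec n v \<noteq> 0\<^sub>v n"
    proof
      assume "vec n v = 0\<^sub>v n"
      then have "vec n v $ k = 0\<^sub>v n $ k" by simp
      then show False using assms by simp
    qed
    show "mat n n (\<lambda>(i, j). f i j) *\<^sub>v vec n v = 0\<^sub>v n"
      by (rule eq_vecI) (auto simp: scalar_prod_def atLeast0LessThan assms(1))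
  qed simp
  then show ?thesis unfolding fdet_def by (subst det_0_iff_vec_prod_zero[of _ n]) (simp, blast)
qed

text \<open>Pigeonhole: the first k + 1 rows are supported in the first k columns, so every
  permutation meets a zero entry.\<close>

lemma fdet_zero_block:
  assumes "k < n" "\<And>i j. i \<le> k \<Longrightarrow> k \<le> j \<Longrightarrow> j < n \<Longrightarrow> f i j = 0"
  shows "fdet n f = 0"
  unfolding fdet_rows
proof (rule sum.neutral, safe)
  fix p assume p: "p permutes {..<n}"
  have "\<exists>i\<le>k. k \<le> p i"
  proof (rule ccontr)
    assume "\<not> ?thesis"
    then have "p ` {..k} \<subseteq> {..<k}" by force
    then have "card (p ` {..k}) \<le> k" using card_mono[of "{..<k}" "p ` {..k}"] by simp
    moreover have "card (p ` {..k}) = Suc k"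
      using p by (subst card_image) (auto intro: inj_on_subset[OF permutes_inj_on])
    ultimately show False by simp
  qed
  then obtain i where "i \<le> k" "k \<le> p i" by blast
  moreover have "p i < n" using p \<open>i \<le> k\<close> assms(1) permutes_in_image[OF p, of i] by simp
  ultimately have "\<exists>i\<in>{..<n}. f i (p i) = 0" using assms by (intro bexI[of _ i]) auto
  then have "(\<Prod>i<n. f i (p i)) = 0" by (intro prod_zero) auto
  then show "signof p * (\<Prod>i<n. f i (p i)) = 0" by simp
qed

lemma fdet_vandermonde:
  fixes x :: "nat \<Rightarrow> 'a::idom"
  shows "fdet n (\<lambda>i j. x i ^ (n - Suc j)) = (\<Prod>i<n. \<Prod>j\<in>{i<..<n}. x i - x j)"
proof (induction n)
  case 0
  show ?case by (simp add: fdet_def)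
next
  case (Suc n)
  \<comment> \<open>Multiplying by \<open>U\<close> subtracts x_n times column j + 1 from column j.
    The last row becomes (0, ..., 0, 1), and x_i - x_n can be taken out of each remaining
    row.\<close>
  define U :: "nat \<Rightarrow> nat \<Rightarrow> 'a" where
    "U = (\<lambda>k j. if k = j then 1 else if k = Suc j then - x n else 0)"
  define C where "C = (\<lambda>i j. \<Sum>k<Suc n. x i ^ (n - k) * U k j)"
  have C: "C i j = (if j = n then 1 else (x i - x n) * x i ^ (n - Suc j))" if "j < Suc n" for i j
  proof (cases "j = n")
    case True
    have "C i j = (\<Sum>k<Suc n. if k = n then x i ^ (n - k) else 0)"
      unfolding C_def by (intro sum.cong refl) (auto simp: U_def True)
    then show ?thesis using True by simp
  next
    case False
    with that have j: "j < n" by simp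
    have "C i j = (\<Sum>k<Suc n. (if k = j then x i ^ (n - k) else 0) + (if k = Suc j then - x n * x i ^ (n - k) else 0))"
      unfolding C_def by (intro sum.cong refl) (auto simp: U_def)
    also have "\<dots> = x i ^ (n - j) - x n * x i ^ (n - Suc j)"
      using j by (simp add: sum.distrib)
    also have "n - j = Suc (n - Suc j)" using j by simp
    finally show ?thesis using False by (simp add: algebra_simps)
  qed
  have "fdet (Suc n) C = fdet (Suc n) (\<lambda>i j. x i ^ (n - j)) * fdet (Suc n) U"
    unfolding C_def by (rule fdet_mult)
  moreover have "fdet (Suc n) U = 1"
    by (subst fdet_lower_triangular) (auto simp: U_def)
  moreover have "fdet (Suc n) C = C n n * fdet n C"
    by (rule fdet_last_row) (simp add: C)
  moreover have "fdet n C = fdet n (\<lambda>i j. (x i - x n) * x i ^ (n - Suc j))"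
    by (rule fdet_cong) (simp add: C)
  ultimately have "fdet (Suc n) (\<lambda>i j. x i ^ (n - j)) =
      (\<Prod>i<n. x i - x n) * (\<Prod>i<n. \<Prod>j\<in>{i<..<n}. x i - x j)"
    by (simp add: C fdet_scale_rows Suc)
  also have "\<dots> = (\<Prod>i<n. \<Prod>j\<in>{i<..<Suc n}. x i - x j)"
    unfolding prod.distrib[symmetric]
  proof (intro prod.cong refl)
    fix i assume "i \<in> {..<n}"
    then have "{i<..<Suc n} = insert n {i<..<n}" by auto
    then show "(x i - x n) * (\<Prod>j\<in>{i<..<n}. x i - x j) = (\<Prod>j\<in>{i<..<Suc n}. x i - x j)" by simp
  qed
  also have "{n<..<Suc n} = {}" by auto
  then have "(\<Prod>i<n. \<Prod>j\<in>{i<..<Suc n}. x i - x j) = (\<Prod>i<Suc n. \<Prod>j\<in>{i<..<Suc n}. x i - x j)"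
    by simp
  finally show ?case by simp
qed

text \<open>The strictly decreasing exponents $\lambda_j + n - j$; differences of two of them give the
  indices of all Toeplitz-type determinants below.\<close>

definition shifted :: "nat \<Rightarrow> ptn \<Rightarrow> nat \<Rightarrow> nat" where
  "shifted n p k = part p k + n - Suc k"

section \<open>Partitions with at most n parts as strictly decreasing exponent vectors\<close>

lemma part_antimono: "i \<le> j \<Longrightarrow> part p j \<le> part p i"
  using part[of p] by (auto simp: antimono_def)

lemma finite_part_support: "finite {i. part p i \<noteq> 0}"
  using part[of p] by auto

lemma ptn_eqI: "(\<And>i. part p i = part q i) \<Longrightarrow> p = q"
  by (simp add: part_inject[symmetric] fun_eq_iff)

text \<open>Monotonicity makes the support an initial segment, so the cardinality
  \<open>len p\<close> is also the first index of a zero part. Row bounds are used in that form from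
  here on.\<close>

lemma support_part: "{i. part p i \<noteq> 0} = {..<len p}"
proof -
  have down: "i \<in> {i. part p i \<noteq> 0}" if "j \<in> {i. part p i \<noteq> 0}" "i \<le> j" for i j
    using part_antimono[OF that(2), of p] that(1) by auto
  obtain k where k: "{i. part p i \<noteq> 0} = {..<k}"
  proof -
    define k where "k = (LEAST k. part p k = 0)"
    have ex: "\<exists>k. part p k = 0"
      using ex_new_if_finite[OF infinite_UNIV_nat finite_part_support[of p]] by auto
    have "part p k = 0" unfolding k_def using LeastI_ex[OF ex] .
    have "part p i \<noteq> 0" if "i < k" for i using not_less_Least[OF that[unfolded k_def]] .
    have "i < k" if "part p i \<noteq> 0" for i
    proof (rule ccontr)
      assume "\<not> i < k"
      then show False using down[of i k] that \<open>part p k = 0\<close> by simp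
    qed
    with \<open>\<And>i. i < k \<Longrightarrow> part p i \<noteq> 0\<close> have "{i. part p i \<noteq> 0} = {..<k}" by blast
    then show ?thesis using that by blast
  qed
  then show ?thesis unfolding len_def by simp
qed

lemma part_eq_0_iff: "part p i = 0 \<longleftrightarrow> len p \<le> i"
proof -
  have "i \<in> {i. part p i \<noteq> 0} \<longleftrightarrow> i < len p" unfolding support_part by simp
  then show ?thesis by auto
qed

lemma len_le_iff: "len p \<le> n \<longleftrightarrow> part p n = 0"
  by (simp add: part_eq_0_iff)

lemma part_Ptn: "antimono p \<Longrightarrow> finite {i. p i \<noteq> 0} \<Longrightarrow> part (Ptn p) = p"
  by (simp add: Ptn_inverse)

lemma shifted_strict: "i < j \<Longrightarrow> j < n \<Longrightarrow> shifted n p j < shifted n p i"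
  using part_antimono[of i j p] unfolding shifted_def by linarith

lemma shifted_less_iff: "i < n \<Longrightarrow> j < n \<Longrightarrow> shifted n p i < shifted n p j \<longleftrightarrow> j < i"
  using shifted_strict[of i j n p] shifted_strict[of j i n p] by (cases i j rule: linorder_cases) auto

lemma shifted_inj: "i < n \<Longrightarrow> j < n \<Longrightarrow> shifted n p i = shifted n p j \<longleftrightarrow> i = j"
  using shifted_strict[of i j n p] shifted_strict[of j i n p] by (cases i j rule: linorder_cases) auto

lemma shifted_Suc: "k < n \<Longrightarrow> shifted (Suc n) p k = Suc (shifted n p k)"
  unfolding shifted_def by simp

lemma ptn_eq_shiftedI:
  assumes "len p \<le> n" "len q \<le> n" "\<And>i. i < n \<Longrightarrow> shifted n p i = shifted n q i"
  shows "p = q"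
proof (rule ptn_eqI)
  fix i
  show "part p i = part q i"
  proof (cases "i < n")
    case True
    then show ?thesis using assms(3)[OF True] by (simp add: shifted_def)
  next
    case False
    then show ?thesis using assms by (simp add: part_eq_0_iff[THEN iffD2])
  qed
qed

lemma ptn_of_decreasing:
  assumes "\<And>i j. i < j \<Longrightarrow> j < n \<Longrightarrow> d j < d i"
  obtains p where "len p \<le> n" "\<And>i. i < n \<Longrightarrow> shifted n p i = d i"
proof -
  \<comment> \<open>A strictly decreasing sequence of naturals dominates the staircase n - 1, ...,
    0, so the truncated subtraction in \<open>p\<close> below is exact.\<close>
  have ge: "n - Suc i \<le> d i" if "i < n" for i
    using that
  proof (induction "n - Suc i" arbitrary: i)
    case (Suc m)
    then have "m = n - Suc (Suc i)" "Suc i < n" by auto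
    with Suc.hyps(1)[of "Suc i"] assms[of i "Suc i"] Suc.hyps(2) show ?case by linarith
  qed simp
  define p where "p i = (if i < n then d i - (n - Suc i) else 0)" for i
  have step: "p (Suc i) \<le> p i" for i
    using assms[of i "Suc i"] ge[of "Suc i"] ge[of i] unfolding p_def by (auto split: if_splits)
  have "antimono p" unfolding antimono_iff_le_Suc using step by simp
  moreover have "finite {i. p i \<noteq> 0}" by (rule finite_subset[of _ "{..<n}"]) (auto simp: p_def)
  ultimately have P: "part (Ptn p) = p" by (rule part_Ptn)
  show ?thesis
  proof
    show "len (Ptn p) \<le> n" by (simp add: len_le_iff P p_def)
    show "shifted n (Ptn p) i = d i" if "i < n" for i
      using ge[OF that] that by (simp add: shifted_def P p_def)
  qed
qed

lemma sort_exponents: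
  fixes e :: "nat \<Rightarrow> nat"
  assumes "inj_on e {..<n}"
  obtains p q where "len p \<le> n" "q permutes {..<n}" "\<And>i. i < n \<Longrightarrow> e i = shifted n p (q i)"
proof -
  \<comment> \<open>The rank of \<open>e i\<close>, counted from the largest entry and starting at
    0; beyond n it is the identity, as \<open>permutes\<close> demands.\<close>
  define q where "q i = (if i < n then card {j. j < n \<and> e i < e j} else i)" for i
  have mono: "q j < q i" if "e i < e j" "i < n" "j < n" for i j
  proof -
    have "{k. k < n \<and> e j < e k} \<subset> {k. k < n \<and> e i < e k}" using that by auto
    then show ?thesis unfolding q_def using that by (auto intro!: psubset_card_mono)
  qed
  have lt: "q i < n" if "i < n" for i
  proof -
    have "{k. k < n \<and> e i < e k} \<subset> {..<n}" using that by auto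
    then have "card {k. k < n \<and> e i < e k} < card {..<n}" by (intro psubset_card_mono) auto
    then show ?thesis using that by (simp add: q_def)
  qed
  have inj: "inj_on q {..<n}"
  proof (rule inj_onI)
    fix i j assume ij: "i \<in> {..<n}" "j \<in> {..<n}" "q i = q j"
    have "e i = e j"
    proof (rule ccontr)
      assume "e i \<noteq> e j"
      then show False using mono[of i j] mono[of j i] ij by (cases "e i < e j") auto
    qed
    then show "i = j" using assms ij by (auto dest: inj_onD)
  qed
  have "q ` {..<n} = {..<n}"
    using lt by (intro endo_inj_surj inj) auto
  then have perm: "q permutes {..<n}"
    using inj by (intro bij_imp_permutes) (auto simp: bij_betw_def q_def)
  let ?iq = "Hilbert_Choice.inv q"
  have iq: "?iq i < n" "q (?iq i) = i" if "i < n" for i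
    using that permutes_in_image[OF permutes_inv[OF perm], of i] permutes_inverses[OF perm] by auto
  have "e (?iq j) < e (?iq i)" if "i < j" "j < n" for i j
  proof (rule ccontr)
    assume "\<not> ?thesis"
    then have "e (?iq i) < e (?iq j) \<or> e (?iq i) = e (?iq j)" by auto
    then show False
    proof
      assume "e (?iq i) < e (?iq j)"
      then have "q (?iq j) < q (?iq i)" using that iq by (intro mono) auto
      then show False using that iq by simp
    next
      assume "e (?iq i) = e (?iq j)"
      then have "?iq i = ?iq j" using assms that iq by (auto dest: inj_onD)
      then have "q (?iq i) = q (?iq j)" by simp
      then show False using that iq by simp
    qed
  qed
  then obtain p where p: "len p \<le> n" "\<And>i. i < n \<Longrightarrow> shifted n p i = e (?iq i)"
    using ptn_of_decreasing[of n "\<lambda>i. e (?iq i)"] by blast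
  show ?thesis
    by (rule that[OF p(1) perm]) (use p(2) lt permutes_inverses[OF perm] in auto)
qed

text \<open>Each permutation can be read off the common exponent vector as the rank of its entries.
  Undoing it leaves equal decreasing vectors, hence equal partitions.\<close>

lemma shifted_perm_unique:
  assumes "len p \<le> n" "len p' \<le> n" "q permutes {..<n}" "q' permutes {..<n}"
    and eq: "\<And>i. i < n \<Longrightarrow> shifted n p (q i) = shifted n p' (q' i)"
  shows "p = p' \<and> q = q'"
proof -
  have rank: "q i = card {j. j < n \<and> shifted n p (q i) < shifted n p (q j)}" if "q permutes {..<n}" "i < n" for q p i
  proof -
    note lt = permutes_lt[OF that(1)]
    have img: "q ` {j. j < n \<and> q j < q i} = {..<q i}"
    proof (intro equalityI subsetI)
      fix k assume k: "k \<in> {..<q i}"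
      then have "k < n" using lt[OF that(2)] by simp
      then have "Hilbert_Choice.inv q k < n" "q (Hilbert_Choice.inv q k) = k"
        using permutes_lt[OF permutes_inv[OF that(1)]] permutes_inverses(1)[OF that(1)] by blast+
      then show "k \<in> q ` {j. j < n \<and> q j < q i}" using k by (intro image_eqI[of _ _ "Hilbert_Choice.inv q k"]) auto
    qed auto
    have 1: "{j. j < n \<and> shifted n p (q i) < shifted n p (q j)} = {j. j < n \<and> q j < q i}"
      by (rule Collect_cong, rule conj_cong[OF refl], rule shifted_less_iff[OF lt[OF that(2)] lt])
    have 2: "card (q ` {j. j < n \<and> q j < q i}) = card {j. j < n \<and> q j < q i}"
      by (rule card_image) (rule inj_on_subset[OF permutes_inj[OF that(1)] subset_UNIV])
    show ?thesis unfolding 1 2[symmetric] img by (rule card_lessThan[symmetric])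
  qed
  have q: "q = q'"
  proof
    fix i
    show "q i = q' i"
    proof (cases "i < n")
      case True
      have "{j. j < n \<and> shifted n p (q i) < shifted n p (q j)} = {j. j < n \<and> shifted n p' (q' i) < shifted n p' (q' j)}"
        by (rule Collect_cong, rule conj_cong[OF refl]) (simp only: eq[OF True] eq)
      then have "card {j. j < n \<and> shifted n p (q i) < shifted n p (q j)} = card {j. j < n \<and> shifted n p' (q' i) < shifted n p' (q' j)}"
        by (rule arg_cong)
      then show ?thesis unfolding rank[OF assms(3) True, of p, symmetric] rank[OF assms(4) True, of p', symmetric] .
    next
      case False
      then show ?thesis using assms by (simp add: permutes_not_in)
    qed
  qed
  have "shifted n p i = shifted n p' i" if "i < n" for i
  proof -
    have "Hilbert_Choice.inv q i < n" by (rule permutes_lt[OF permutes_inv[OF assms(3)] that])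
    from eq[OF this] show ?thesis unfolding q[symmetric] permutes_inverses(1)[OF assms(3)] .
  qed
  then show ?thesis using ptn_eq_shiftedI[OF assms(1,2)] q by simp
qed

definition ptn_box :: "nat \<Rightarrow> nat \<Rightarrow> ptn set" where
  "ptn_box n M = {p. len p \<le> n \<and> part p 0 \<le> M}"

lemma shifted_bound: "p \<in> ptn_box n M \<Longrightarrow> k < n \<Longrightarrow> shifted n p k < M + n"
  using part_antimono[of 0 k p] by (auto simp: ptn_box_def shifted_def)

lemma ptn_box_I_shifted: "len p \<le> n \<Longrightarrow> (\<And>k. k < n \<Longrightarrow> shifted n p k < M + n) \<Longrightarrow> p \<in> ptn_box n M"
proof (cases "n = 0")
  case False
  assume "len p \<le> n" "\<And>k. k < n \<Longrightarrow> shifted n p k < M + n"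
  from this(1) this(2)[of 0] False show ?thesis by (auto simp: ptn_box_def shifted_def)
next
  case True
  assume "len p \<le> n"
  then have "len p \<le> 0" using True by simp
  moreover then have "part p 0 = 0" using len_le_iff by blast
  ultimately show ?thesis using True by (simp add: ptn_box_def)
qed

lemma finite_ptn_box: "finite (ptn_box n M)"
proof -
  have "inj_on (\<lambda>p. restrict (shifted n p) {..<n}) (ptn_box n M)"
  proof (rule inj_onI)
    fix p q assume pq: "p \<in> ptn_box n M" "q \<in> ptn_box n M" and eq: "restrict (shifted n p) {..<n} = restrict (shifted n q) {..<n}"
    have "shifted n p i = shifted n q i" if "i < n" for i using fun_cong[OF eq, of i] that by simp
    with pq show "p = q" by (intro ptn_eq_shiftedI[of p n q]) (auto simp: ptn_box_def)
  qed
  moreover have "(\<lambda>p. restrict (shifted n p) {..<n}) ` ptn_box n M \<subseteq> PiE {..<n} (\<lambda>_. {..<M + n})"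
    using shifted_bound by (intro image_subsetI restrict_PiE_iff[THEN iffD2]) auto
  moreover have "finite (PiE {..<n} (\<lambda>_. {..<M + n}))"
    by (rule finite_PiE) auto
  ultimately show ?thesis by (meson finite_imageD finite_subset)
qed

section \<open>Cauchy-Binet, with minors indexed by partitions in a box\<close>

text \<open>Multilinearity in the rows; \<open>g\<close> records the summand chosen in each
  row.\<close>

lemma fdet_sum_rows:
  assumes "finite L"
  shows "fdet n (\<lambda>i j. \<Sum>l\<in>L. A i l * B l j) =
    (\<Sum>g\<in>PiE {..<n} (\<lambda>_. L). (\<Prod>i<n. A i (g i)) * fdet n (\<lambda>i j. B (g i) j))"
proof -
  have "fdet n (\<lambda>i j. \<Sum>l\<in>L. A i l * B l j) =
      (\<Sum>p | p permutes {..<n}. signof p * (\<Sum>g\<in>PiE {..<n} (\<lambda>_. L). \<Prod>i<n. A i (g i) * B (g i) (p i)))"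
    unfolding fdet_rows
    by (intro sum.cong refl arg_cong2[where f = "(*)"] prod_sum_PiE) (use assms in auto)
  also have "\<dots> = (\<Sum>g\<in>PiE {..<n} (\<lambda>_. L). \<Sum>p | p permutes {..<n}.
      signof p * (\<Prod>i<n. A i (g i) * B (g i) (p i)))"
    unfolding sum_distrib_left by (rule sum.swap)
  also have "\<dots> = (\<Sum>g\<in>PiE {..<n} (\<lambda>_. L). (\<Prod>i<n. A i (g i)) * fdet n (\<lambda>i j. B (g i) j))"
    unfolding fdet_rows by (intro sum.cong refl) (simp add: prod.distrib sum_distrib_left mult_ac)
  finally show ?thesis .
qed

text \<open>Sorting splits an injective choice of exponents into a decreasing vector and a
  permutation. The decreasing vectors with entries below M + n are the shifted exponents of the
  partitions with at most n rows and M columns.\<close>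

lemma bij_betw_shifted_perm:
  "bij_betw (\<lambda>(p, q). restrict (\<lambda>i. shifted n p (q i)) {..<n}) (ptn_box n M \<times> {q. q permutes {..<n}})
     {g \<in> PiE {..<n} (\<lambda>_. {..<M + n}). inj_on g {..<n}}"
  (is "bij_betw ?F _ _")
  unfolding bij_betw_def
proof (intro conjI inj_onI)
  fix x y assume x: "x \<in> ptn_box n M \<times> {q. q permutes {..<n}}" and y: "y \<in> ptn_box n M \<times> {q. q permutes {..<n}}"
    and eq: "?F x = ?F y"
  obtain p q p' q' where xy: "x = (p, q)" "y = (p', q')" by (cases x; cases y)
  have "shifted n p (q i) = shifted n p' (q' i)" if "i < n" for i
    using fun_cong[OF eq, of i] that by (simp add: xy)
  then have "p = p' \<and> q = q'"
    using x y by (intro shifted_perm_unique[of p n p' q q']) (auto simp: ptn_box_def xy)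
  then show "x = y" by (simp add: xy)
next
  show "?F ` (ptn_box n M \<times> {q. q permutes {..<n}}) = {g \<in> PiE {..<n} (\<lambda>_. {..<M + n}). inj_on g {..<n}}"
  proof (intro equalityI subsetI)
    fix g assume "g \<in> ?F ` (ptn_box n M \<times> {q. q permutes {..<n}})"
    then obtain p q where g: "g = restrict (\<lambda>i. shifted n p (q i)) {..<n}" and p: "p \<in> ptn_box n M" and q: "q permutes {..<n}"
      by auto
    note lt = permutes_lt[OF q]
    have "g \<in> PiE {..<n} (\<lambda>_. {..<M + n})"
      unfolding g restrict_PiE_iff using shifted_bound[OF p lt] by blast
    moreover have "inj_on g {..<n}"
    proof (rule inj_onI)
      fix i j assume "i \<in> {..<n}" "j \<in> {..<n}" "g i = g j"
      then have "q i = q j" using shifted_inj[OF lt lt, of i j p] by (simp add: g)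
      then show "i = j" using permutes_inj[OF q] by (rule injD[rotated])
    qed
    ultimately show "g \<in> {g \<in> PiE {..<n} (\<lambda>_. {..<M + n}). inj_on g {..<n}}" by simp
  next
    fix g assume "g \<in> {g \<in> PiE {..<n} (\<lambda>_. {..<M + n}). inj_on g {..<n}}"
    then have g: "g \<in> PiE {..<n} (\<lambda>_. {..<M + n})" "inj_on g {..<n}" by auto
    obtain p q where p: "len p \<le> n" and q: "q permutes {..<n}" and pq: "\<And>i. i < n \<Longrightarrow> g i = shifted n p (q i)"
      using sort_exponents[OF g(2)] by blast
    have "p \<in> ptn_box n M"
    proof (rule ptn_box_I_shifted[OF p])
      fix k assume "k < n"
      then have k: "Hilbert_Choice.inv q k < n" by (rule permutes_lt[OF permutes_inv[OF q]])
      then have "g (Hilbert_Choice.inv q k) \<in> {..<M + n}" using g(1) by blast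
      then show "shifted n p k < M + n" using pq[OF k] by (simp add: permutes_inverses(1)[OF q])
    qed
    moreover have "g = ?F (p, q)"
    proof
      fix i show "g i = ?F (p, q) i"
        using pq[of i] PiE_arb[OF g(1), of i] by (cases "i < n") simp_all
    qed
    ultimately show "g \<in> ?F ` (ptn_box n M \<times> {q. q permutes {..<n}})" using q by (intro image_eqI[of _ _ "(p, q)"]) auto
  qed
qed

text \<open>The n-subsets of {0, ..., M + n - 1} are encoded by partitions. A choice that is not
  injective repeats a row of \<open>B\<close> and vanishes; for a fixed subset, the permutation
  signs assemble the products of entries of \<open>A\<close> into a minor.\<close>

lemma cauchy_binet:
  "fdet n (\<lambda>i j. \<Sum>l<M + n. A i l * B l j) =
    (\<Sum>p\<in>ptn_box n M. fdet n (\<lambda>i k. A i (shifted n p k)) * fdet n (\<lambda>k j. B (shifted n p k) j))"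
proof -
  let ?T = "PiE {..<n} (\<lambda>_. {..<M + n})"
  let ?F = "\<lambda>g. (\<Prod>i<n. A i (g i)) * fdet n (\<lambda>i j. B (g i) j)"
  have "fdet n (\<lambda>i j. \<Sum>l<M + n. A i l * B l j) = sum ?F ?T"
    by (rule fdet_sum_rows) simp
  also have "\<dots> = sum ?F {g \<in> ?T. inj_on g {..<n}}"
  proof (rule sum.mono_neutral_right)
    show "finite ?T" by (rule finite_PiE) auto
    show "\<forall>g\<in>?T - {g \<in> ?T. inj_on g {..<n}}. ?F g = 0"
    proof
      fix g assume "g \<in> ?T - {g \<in> ?T. inj_on g {..<n}}"
      then obtain i j where "i < n" "j < n" "i \<noteq> j" "g i = g j" by (auto simp: inj_on_def)
      then have "fdet n (\<lambda>i j. B (g i) j) = 0" by (intro fdet_identical_rows[of i j]) auto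
      then show "?F g = 0" by simp
    qed
  qed auto
  also have "\<dots> = (\<Sum>(p, q)\<in>ptn_box n M \<times> {q. q permutes {..<n}}. ?F (restrict (\<lambda>i. shifted n p (q i)) {..<n}))"
    using sum.reindex_bij_betw[OF bij_betw_shifted_perm, of ?F n M, symmetric]
    unfolding case_prod_beta .
  also have "\<dots> = (\<Sum>p\<in>ptn_box n M. \<Sum>q | q permutes {..<n}. ?F (restrict (\<lambda>i. shifted n p (q i)) {..<n}))"
    by (rule sum.cartesian_product[symmetric])
  also have "\<dots> = (\<Sum>p\<in>ptn_box n M. \<Sum>q | q permutes {..<n}.
      (signof q * (\<Prod>i<n. A i (shifted n p (q i)))) * fdet n (\<lambda>k j. B (shifted n p k) j))"
  proof (intro sum.cong refl)
    fix p q assume "q \<in> {q. q permutes {..<n}}"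
    then have q: "q permutes {..<n}" by simp
    have "fdet n (\<lambda>i j. B (restrict (\<lambda>i. shifted n p (q i)) {..<n} i) j) = fdet n (\<lambda>i j. (\<lambda>k j. B (shifted n p k) j) (q i) j)"
      by (rule fdet_cong) simp
    also have "\<dots> = signof q * fdet n (\<lambda>k j. B (shifted n p k) j)"
      by (rule fdet_permute_rows[OF q])
    finally have 1: "fdet n (\<lambda>i j. B (restrict (\<lambda>i. shifted n p (q i)) {..<n} i) j) = signof q * fdet n (\<lambda>k j. B (shifted n p k) j)" .
    have 2: "(\<Prod>i<n. A i (restrict (\<lambda>i. shifted n p (q i)) {..<n} i)) = (\<Prod>i<n. A i (shifted n p (q i)))"
      by (rule prod.cong) auto
    show "?F (restrict (\<lambda>i. shifted n p (q i)) {..<n}) =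
      (signof q * (\<Prod>i<n. A i (shifted n p (q i)))) * fdet n (\<lambda>k j. B (shifted n p k) j)"
      unfolding 1 2 by (simp only: mult_ac)
  qed
  also have "\<dots> = (\<Sum>p\<in>ptn_box n M. fdet n (\<lambda>i k. A i (shifted n p k)) * fdet n (\<lambda>k j. B (shifted n p k) j))"
  proof (intro sum.cong refl)
    fix p
    show "(\<Sum>q | q permutes {..<n}. (signof q * (\<Prod>i<n. A i (shifted n p (q i)))) * fdet n (\<lambda>k j. B (shifted n p k) j)) =
        fdet n (\<lambda>i k. A i (shifted n p k)) * fdet n (\<lambda>k j. B (shifted n p k) j)"
      unfolding fdet_rows[of n "\<lambda>i k. A i (shifted n p k)"] by (rule sum_distrib_right[symmetric])
  qed
  finally show ?thesis .
qed

section \<open>Polynomials and the Jacobi--Trudi formula\<close>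

abbreviation lookup :: "('a \<Rightarrow>\<^sub>0 'b::zero) \<Rightarrow> 'a \<Rightarrow> 'b" where "lookup \<equiv> Poly_Mapping.lookup"
abbreviation single :: "'a \<Rightarrow> 'b::zero \<Rightarrow> 'a \<Rightarrow>\<^sub>0 'b" where "single \<equiv> Poly_Mapping.single"
abbreviation keys :: "('a \<Rightarrow>\<^sub>0 'b::zero) \<Rightarrow> 'a set" where "keys \<equiv> Poly_Mapping.keys"

lemma keys_add_nat: "keys (a + b :: monom) = keys a \<union> keys b"
  by (auto simp: Poly_Mapping.in_keys_iff Poly_Mapping.lookup_add)

lemma mdeg_superset: "finite A \<Longrightarrow> keys a \<subseteq> A \<Longrightarrow> mdeg a = (\<Sum>i\<in>A. lookup a i)"
  unfolding mdeg_def by (rule sum.mono_neutral_left) (auto simp: Poly_Mapping.in_keys_iff)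

lemma mdeg_add: "mdeg (a + b) = mdeg a + mdeg b"
proof -
  let ?A = "keys a \<union> keys b"
  have "mdeg (a + b) = (\<Sum>i\<in>?A. lookup (a + b) i)"
    by (rule mdeg_superset) (auto simp: keys_add_nat)
  also have "\<dots> = (\<Sum>i\<in>?A. lookup a i) + (\<Sum>i\<in>?A. lookup b i)"
    by (simp add: Poly_Mapping.lookup_add sum.distrib)
  also have "(\<Sum>i\<in>?A. lookup a i) = mdeg a" by (rule mdeg_superset[symmetric]) auto
  also have "(\<Sum>i\<in>?A. lookup b i) = mdeg b" by (rule mdeg_superset[symmetric]) auto
  finally show ?thesis .
qed

lemma mdeg_single: "mdeg (single i k) = k"
  by (subst mdeg_superset[of "{i}"]) auto

lemma lookup_le_mdeg: "lookup a i \<le> mdeg a"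
proof (cases "i \<in> keys a")
  case True
  then show ?thesis unfolding mdeg_def by (intro member_le_sum) auto
next
  case False
  then show ?thesis by (simp add: Poly_Mapping.in_keys_iff)
qed

lemma mdeg_map_key:
  assumes "bij \<pi>"
  shows "mdeg (Poly_Mapping.map_key \<pi> a) = mdeg a"
proof -
  have inj: "inj \<pi>" using assms by (rule bij_is_inj)
  have "mdeg (Poly_Mapping.map_key \<pi> a) = (\<Sum>i\<in>\<pi> -` keys a. lookup a (\<pi> i))"
    unfolding mdeg_def keys_map_key[OF inj] by (simp add: map_key.rep_eq[OF inj])
  also have "\<dots> = (\<Sum>i\<in>\<pi> ` (\<pi> -` keys a). lookup a i)"
    by (rule sum.reindex_cong[symmetric]) (use inj in \<open>auto intro: inj_on_subset\<close>)
  also have "\<pi> ` (\<pi> -` keys a) = keys a"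
    using assms by (simp add: surj_image_vimage_eq bij_is_surj)
  finally show ?thesis unfolding mdeg_def .
qed

definition monom_of :: "nat \<Rightarrow> (nat \<Rightarrow> nat) \<Rightarrow> monom" where
  "monom_of n e = (\<Sum>i<n. single i (e i))"

lemma lookup_monom_of: "lookup (monom_of n e) i = (if i < n then e i else 0)"
  unfolding monom_of_def Poly_Mapping.lookup_sum Poly_Mapping.lookup_single
  by (simp add: when_def)

lemma keys_monom_of: "keys (monom_of n e) \<subseteq> {..<n}"
  by (auto simp: Poly_Mapping.in_keys_iff lookup_monom_of split: if_splits)

lemma monom_of_cong: "(\<And>i. i < n \<Longrightarrow> e i = e' i) \<Longrightarrow> monom_of n e = monom_of n e'"
  unfolding monom_of_def by simp

lemma monom_of_lookup: "keys a \<subseteq> {..<n} \<Longrightarrow> monom_of n (lookup a) = a"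
  by (rule poly_mapping_eqI) (auto simp: lookup_monom_of Poly_Mapping.in_keys_iff)

lemma monom_of_add: "monom_of n e + monom_of n e' = monom_of n (\<lambda>i. e i + e' i)"
  by (rule poly_mapping_eqI) (simp add: Poly_Mapping.lookup_add lookup_monom_of)

lemma mdeg_monom_of: "mdeg (monom_of n e) = (\<Sum>i<n. e i)"
  by (subst mdeg_superset[OF _ keys_monom_of]) (simp_all add: lookup_monom_of)

lemma finite_monoms: "finite {a. keys a \<subseteq> {..<n} \<and> mdeg a \<le> d}"
proof (rule finite_subset)
  show "{a. keys a \<subseteq> {..<n} \<and> mdeg a \<le> d} \<subseteq> monom_of n ` PiE {..<n} (\<lambda>_. {..d})"
  proof
    fix a assume "a \<in> {a. keys a \<subseteq> {..<n} \<and> mdeg a \<le> d}"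
    then have a: "keys a \<subseteq> {..<n}" "mdeg a \<le> d" by auto
    have "a = monom_of n (restrict (lookup a) {..<n})"
      by (subst monom_of_lookup[OF a(1), symmetric], rule monom_of_cong) simp
    moreover have "lookup a i \<le> d" for i
      using lookup_le_mdeg[of a i] a(2) by linarith
    then have "restrict (lookup a) {..<n} \<in> PiE {..<n} (\<lambda>_. {..d})"
      by (simp add: restrict_PiE_iff)
    ultimately show "a \<in> monom_of n ` PiE {..<n} (\<lambda>_. {..d})" by (rule image_eqI)
  qed
  show "finite (monom_of n ` PiE {..<n} (\<lambda>_. {..d}))"
    by (intro finite_imageI finite_PiE) auto
qed

lemma xvar_power: "xvar i ^ k = single (single i k) 1"
  by (induction k) (simp_all add: xvar_def Poly_Mapping.mult_single Poly_Mapping.single_add[symmetric])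

lemma prod_xvar: "(\<Prod>i<n. xvar i ^ e i) = single (monom_of n e) 1"
  by (induction n) (simp_all add: monom_of_def xvar_power Poly_Mapping.mult_single)

lemma lookup_single_mult:
  fixes f :: kpoly
  shows "lookup (single b c * f) (b + a) = c * lookup f a"
proof -
  have "lookup (single b c * f) (b + a) = (\<Sum>l. lookup (single b c) l * (\<Sum>q. lookup f q when b + a = l + q))"
    by (rule Poly_Mapping.lookup_mult)
  also have "\<dots> = (\<Sum>l. c * (\<Sum>q. lookup f q when b + a = l + q) when l = b)"
    by (rule Sum_any.cong) (simp add: Poly_Mapping.lookup_single when_def)
  also have "\<dots> = c * (\<Sum>q. lookup f q when b + a = b + q)"
    by (rule Sum_any_when_equal)
  also have "\<dots> = c * (\<Sum>q. lookup f q when q = a)"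
    by (intro arg_cong[of _ _ "(*) c"] Sum_any.cong) (auto simp: when_def)
  finally show ?thesis by simp
qed

lemma lookup_single_mult_0:
  fixes f :: kpoly
  assumes "\<And>a. k \<noteq> b + a"
  shows "lookup (single b c * f) k = 0"
proof -
  have "lookup (single b c * f) k = (\<Sum>l. lookup (single b c) l * (\<Sum>q. lookup f q when k = l + q))"
    by (rule Poly_Mapping.lookup_mult)
  also have "\<dots> = (\<Sum>l::monom. 0)"
  proof (rule Sum_any.cong)
    fix l show "lookup (single b c) l * (\<Sum>q. lookup f q when k = l + q) = 0"
      using assms by (cases "l = b") (simp_all add: Poly_Mapping.lookup_single when_def)
  qed
  finally show ?thesis by simp
qed

lemma lookup_cst_mult: "lookup (cst c * f) a = c * lookup f a"
  using lookup_single_mult[of 0 c f a] unfolding cst_def by simp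

lemma cst_0 [simp]: "cst 0 = 0" and cst_1 [simp]: "cst 1 = 1"
  unfolding cst_def by simp_all

lemma cst_add: "cst (a + b) = cst a + cst b"
  unfolding cst_def by (rule Poly_Mapping.single_add)

lemma cst_mult: "cst (a * b) = cst a * cst b"
  unfolding cst_def by (simp add: Poly_Mapping.mult_single)

lemma cst_sum: "cst (sum f A) = (\<Sum>x\<in>A. cst (f x))"
  by (induction A rule: infinite_finite_induct) (simp_all add: cst_add)

lemma cst_prod: "cst (prod f A) = (\<Prod>x\<in>A. cst (f x))"
  by (induction A rule: infinite_finite_induct) (simp_all add: cst_mult)

lemma cst_of_int: "cst (of_int k) = of_int k"
  unfolding cst_def by simp

lemma cst_power: "cst (a ^ k) = cst a ^ k"
  by (induction k) (simp_all add: cst_mult)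

lemma cst_fdet: "cst (fdet n f) = fdet n (\<lambda>i j. cst (f i j))"
  unfolding fdet_rows by (simp add: cst_sum cst_mult cst_prod cst_of_int)

text \<open>Integer exponents spare the truncated subtraction of exponent vectors; a negative exponent has
  coefficient 0.\<close>

definition zcoeff :: "nat \<Rightarrow> kpoly \<Rightarrow> (nat \<Rightarrow> int) \<Rightarrow> K" where
  "zcoeff n f e = (if \<forall>i<n. 0 \<le> e i then lookup f (monom_of n (\<lambda>i. nat (e i))) else 0)"

lemma zcoeff_cong: "(\<And>i. i < n \<Longrightarrow> e i = e' i) \<Longrightarrow> zcoeff n f e = zcoeff n f e'"
proof -
  assume *: "\<And>i. i < n \<Longrightarrow> e i = e' i"
  have "monom_of n (\<lambda>i. nat (e i)) = monom_of n (\<lambda>i. nat (e' i))" by (rule monom_of_cong) (simp add: *)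
  then show ?thesis unfolding zcoeff_def using * by auto
qed

lemma zcoeff_nat: "zcoeff n f (\<lambda>i. int (e i)) = lookup f (monom_of n e)"
  unfolding zcoeff_def by simp

lemma zcoeff_0 [simp]: "zcoeff n 0 e = 0"
  unfolding zcoeff_def by simp

lemma zcoeff_add: "zcoeff n (f + g) e = zcoeff n f e + zcoeff n g e"
  unfolding zcoeff_def by (auto simp: Poly_Mapping.lookup_add)

lemma zcoeff_sum: "zcoeff n (sum f A) e = (\<Sum>x\<in>A. zcoeff n (f x) e)"
  by (induction A rule: infinite_finite_induct) (simp_all add: zcoeff_add)

lemma zcoeff_cst_mult: "zcoeff n (cst c * f) e = c * zcoeff n f e"
  unfolding zcoeff_def by (auto simp: lookup_cst_mult)

lemma zcoeff_monom_of_mult: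
  "zcoeff n (single (monom_of n w) 1 * f) e = zcoeff n f (\<lambda>i. e i - int (w i))"
proof (cases "\<forall>i<n. int (w i) \<le> e i")
  case True
  have "monom_of n (\<lambda>i. nat (e i)) = monom_of n w + monom_of n (\<lambda>i. nat (e i - int (w i)))"
    unfolding monom_of_add by (rule monom_of_cong) (use True in force)
  moreover have "\<forall>i<n. 0 \<le> e i" using True by (meson of_nat_0_le_iff order_trans)
  ultimately show ?thesis unfolding zcoeff_def using True by (simp add: lookup_single_mult)
next
  case False
  then obtain i where i: "i < n" "e i < int (w i)" by (auto simp: not_le)
  have "lookup (single (monom_of n w) 1 * f) (monom_of n (\<lambda>i. nat (e i))) = 0" if nonneg: "\<forall>i<n. 0 \<le> e i"
  proof (rule lookup_single_mult_0)
    fix a show "monom_of n (\<lambda>i. nat (e i)) \<noteq> monom_of n w + a"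
    proof
      assume "monom_of n (\<lambda>i. nat (e i)) = monom_of n w + a"
      from arg_cong[OF this, of "\<lambda>m. lookup m i"] have "nat (e i) = w i + lookup a i"
        using i by (simp add: lookup_monom_of Poly_Mapping.lookup_add)
      moreover have "0 \<le> e i" using nonneg i by simp
      ultimately show False using i by linarith
    qed
  qed
  moreover have "\<not> (\<forall>i<n. 0 \<le> e i - int (w i))" using i by (intro notI) (drule spec[of _ i], simp)
  ultimately show ?thesis unfolding zcoeff_def by auto
qed

section \<open>Alternants and their leading coefficients\<close>

definition alternant :: "nat \<Rightarrow> (nat \<Rightarrow> nat) \<Rightarrow> kpoly" where
  "alternant n \<alpha> = fdet n (\<lambda>i j. xvar i ^ \<alpha> j)"

lemma alternant_expand: "alternant n \<alpha> = (\<Sum>p | p permutes {..<n}. cst (signof p) * single (monom_of n (\<lambda>i. \<alpha> (p i))) 1)"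
  unfolding alternant_def fdet_rows prod_xvar by (simp add: cst_of_int)

lemma zcoeff_mult_alternant:
  "zcoeff n (f * alternant n \<alpha>) e = (\<Sum>p | p permutes {..<n}. signof p * zcoeff n f (\<lambda>i. e i - int (\<alpha> (p i))))"
proof -
  have "f * alternant n \<alpha> = (\<Sum>p | p permutes {..<n}. cst (signof p) * (single (monom_of n (\<lambda>i. \<alpha> (p i))) 1 * f))"
    unfolding alternant_expand sum_distrib_left by (simp only: mult_ac)
  then show ?thesis by (simp only: zcoeff_sum zcoeff_cst_mult zcoeff_monom_of_mult)
qed

lemma zcoeff_1: "zcoeff n 1 e = (if \<forall>i<n. e i = 0 then 1 else 0)"
proof -
  have "monom_of n (\<lambda>i. nat (e i)) = 0 \<longleftrightarrow> (\<forall>i<n. nat (e i) = 0)"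
    by (auto simp: poly_mapping_eq_iff fun_eq_iff lookup_monom_of)
  then show ?thesis unfolding zcoeff_def
    by (auto simp: Poly_Mapping.lookup_one when_def order_antisym)
qed

text \<open>A decreasing exponent vector arises from a permuted one only through the identity. Hence
  taking the coefficients at the leading monomials is dual to the family of alternants, which is
  what makes Schur coefficients readable.\<close>

lemma zcoeff_alternant_shifted:
  assumes "len p \<le> n" "len q \<le> n"
  shows "zcoeff n (alternant n (shifted n p)) (\<lambda>i. int (shifted n q i)) = (if p = q then 1 else 0)"
proof -
  have eq: "(\<forall>i<n. int (shifted n q i) - int (shifted n p (w i)) = 0) \<longleftrightarrow> p = q \<and> w = id" if "w permutes {..<n}" for w
  proof
    assume "\<forall>i<n. int (shifted n q i) - int (shifted n p (w i)) = 0"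
    then have "q = p \<and> id = w"
      using assms that by (intro shifted_perm_unique[of _ n]) (auto simp: permutes_id)
    then show "p = q \<and> w = id" by simp
  qed simp
  have "zcoeff n (alternant n (shifted n p)) (\<lambda>i. int (shifted n q i)) = zcoeff n (1 * alternant n (shifted n p)) (\<lambda>i. int (shifted n q i))" by simp
  also have "\<dots> = (\<Sum>w | w permutes {..<n}. if w = id then (if p = q then 1 else 0) else 0)"
    unfolding zcoeff_mult_alternant zcoeff_1
    by (rule sum.cong) (use eq in \<open>auto simp: sign_id\<close>)
  also have "\<dots> = (if p = q then 1 else 0)"
    by (subst sum.delta) (auto simp: finite_permutations permutes_id)
  finally show ?thesis .
qed

text \<open>\<open>restrict_vars\<close> is built with \<open>Abs_poly_mapping\<close>, whose value
  is controlled only for finite support. Bounded degree provides this in any finite number of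
  variables.\<close>

definition bounded_degree :: "kseries \<Rightarrow> bool" where
  "bounded_degree f \<longleftrightarrow> (\<exists>d. \<forall>a. f a \<noteq> 0 \<longrightarrow> mdeg a \<le> d)"

lemma lookup_restrict_vars:
  assumes "bounded_degree f"
  shows "lookup (restrict_vars n f) a = (if keys a \<subseteq> {..<n} then f a else 0)"
proof -
  obtain d where d: "\<And>a. f a \<noteq> 0 \<Longrightarrow> mdeg a \<le> d" using assms unfolding bounded_degree_def by blast
  have "finite {a. (if keys a \<subseteq> {..<n} then f a else 0) \<noteq> 0}"
    by (rule finite_subset[OF _ finite_monoms[of n d]]) (use d in \<open>auto split: if_splits\<close>)
  then show ?thesis unfolding restrict_vars_def by simp
qed

lemma bounded_degree_hsym: "bounded_degree (hsym p)"
  unfolding bounded_degree_def hsym_def by (intro exI[of _ "nat p"]) auto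

section \<open>Complete homogeneous polynomials, their generating series and Jacobi-Trudi\<close>

abbreviation h :: "nat \<Rightarrow> int \<Rightarrow> kpoly" where
  "h n p \<equiv> restrict_vars n (hsym p)"

lemma lookup_h: "lookup (h n p) a = (if keys a \<subseteq> {..<n} \<and> int (mdeg a) = p then 1 else 0)"
  unfolding lookup_restrict_vars[OF bounded_degree_hsym] by (simp add: hsym_def)

lemma h_neg: "p < 0 \<Longrightarrow> h n p = 0"
  by (rule poly_mapping_eqI) (simp add: lookup_h)

lemma mdeg_eq_0_iff: "mdeg a = 0 \<longleftrightarrow> a = 0"
proof
  assume "mdeg a = 0"
  then show "a = 0" using lookup_le_mdeg[of a] by (intro poly_mapping_eqI) simp
qed (simp add: mdeg_def)

lemma h_0: "h n 0 = 1"
  by (rule poly_mapping_eqI) (auto simp: lookup_h mdeg_eq_0_iff Poly_Mapping.lookup_one when_def)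

text \<open>A monomial either avoids the last variable, which has index n, or is that variable times
  a monomial of degree one less.\<close>

lemma h_rec: "h (Suc n) p = h n p + xvar n * h (Suc n) (p - 1)"
proof (rule poly_mapping_eqI)
  fix a :: monom
  show "lookup (h (Suc n) p) a = lookup (h n p + xvar n * h (Suc n) (p - 1)) a"
  proof (cases "lookup a n = 0")
    case True
    then have "n \<notin> keys a" by (simp add: Poly_Mapping.in_keys_iff)
    then have "keys a \<subseteq> {..<Suc n} \<longleftrightarrow> keys a \<subseteq> {..<n}" by (auto simp: less_Suc_eq)
    moreover have "lookup (xvar n * h (Suc n) (p - 1)) a = 0"
      unfolding xvar_def
    proof (rule lookup_single_mult_0)
      fix b show "a \<noteq> single n 1 + b"
        using True by (auto simp: Poly_Mapping.lookup_add)
    qed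
    ultimately show ?thesis by (simp add: Poly_Mapping.lookup_add lookup_h)
  next
    case False
    define b where "b = a - single n 1"
    have ab: "a = single n 1 + b"
      unfolding b_def using False
      by (intro poly_mapping_eqI) (auto simp: Poly_Mapping.lookup_add Poly_Mapping.lookup_minus Poly_Mapping.lookup_single when_def)
    have "n \<in> keys a" using False by (simp add: Poly_Mapping.in_keys_iff)
    then have "\<not> keys a \<subseteq> {..<n}" by blast
    moreover have "keys a \<subseteq> {..<Suc n} \<longleftrightarrow> keys b \<subseteq> {..<Suc n}" unfolding ab keys_add_nat by simp
    moreover have "lookup (xvar n * h (Suc n) (p - 1)) a = lookup (h (Suc n) (p - 1)) b"
      unfolding ab xvar_def lookup_single_mult by simp
    moreover have "mdeg a = Suc (mdeg b)" unfolding ab mdeg_add mdeg_single by simp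
    ultimately show ?thesis by (auto simp: Poly_Mapping.lookup_add lookup_h)
  qed
qed

definition fps_znth :: "'a::comm_ring_1 fps \<Rightarrow> int \<Rightarrow> 'a" where
  "fps_znth F p = (if p < 0 then 0 else fps_nth F (nat p))"

definition geometric_fps :: "'a::comm_ring_1 \<Rightarrow> 'a fps" where
  "geometric_fps x = Abs_fps (\<lambda>k. x ^ k)"

lemma fps_znth_mult_left:
  assumes "\<And>k. n \<le> k \<Longrightarrow> fps_nth B k = 0"
  shows "fps_znth (A * B) p = (\<Sum>k<n. fps_nth B k * fps_znth A (p - int k))"
proof (cases "p < 0")
  case True
  then show ?thesis by (auto simp: fps_znth_def intro!: sum.neutral[symmetric])
next
  case False
  define q where "q = nat p"
  have p: "p = int q" using False by (simp add: q_def)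
  have "fps_znth (A * B) p = (\<Sum>k=0..q. fps_nth B k * fps_nth A (q - k))"
    by (simp add: fps_znth_def p mult.commute[of A] fps_mult_nth)
  also have "\<dots> = (\<Sum>k=0..q. fps_nth B k * fps_znth A (p - int k))"
    by (rule sum.cong) (auto simp: fps_znth_def p nat_diff_distrib)
  also have "\<dots> = (\<Sum>k\<in>{0..q} \<union> {..<n}. fps_nth B k * fps_znth A (p - int k))"
    by (rule sum.mono_neutral_left) (auto simp: fps_znth_def p)
  also have "\<dots> = (\<Sum>k<n. fps_nth B k * fps_znth A (p - int k))"
    by (rule sum.mono_neutral_right) (auto simp: assms not_less)
  finally show ?thesis .
qed

lemma geometric_fps_inverse: "geometric_fps x * (1 - fps_const x * fps_X) = 1"
proof -
  have "geometric_fps x * (1 - fps_const x * fps_X) = geometric_fps x - fps_const x * (fps_X * geometric_fps x)"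
    by (simp add: algebra_simps)
  also have "\<dots> = 1"
  proof (rule fps_ext)
    fix k show "fps_nth (geometric_fps x - fps_const x * (fps_X * geometric_fps x)) k = fps_nth 1 k"
      by (cases k) (simp_all add: geometric_fps_def)
  qed
  finally show ?thesis .
qed

text \<open>\<open>geometric_fps x\<close> is 1 / (1 - x t), so this is the generating function of
  the complete homogeneous polynomials.\<close>

definition h_series :: "nat \<Rightarrow> kpoly fps" where
  "h_series n = (\<Prod>i<n. geometric_fps (xvar i))"

lemma h_h_series: "h n p = fps_znth (h_series n) p"
proof -
  have "h n (int k) = fps_nth (h_series n) k" for k
  proof (induction n arbitrary: k)
    case 0
    show ?case
    proof (rule poly_mapping_eqI)
      fix a :: monom
      show "lookup (h 0 (int k)) a = lookup (fps_nth (h_series 0) k) a"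
        by (auto simp: lookup_h h_series_def Poly_Mapping.lookup_one when_def mdeg_def)
    qed
  next
    case (Suc n)
    have H: "h_series (Suc n) = h_series n + fps_const (xvar n) * fps_X * h_series (Suc n)"
    proof -
      have "h_series (Suc n) * (1 - fps_const (xvar n) * fps_X) = h_series n * (geometric_fps (xvar n) * (1 - fps_const (xvar n) * fps_X))"
        by (simp add: h_series_def mult.assoc)
      then have "h_series (Suc n) * (1 - fps_const (xvar n) * fps_X) = h_series n"
        unfolding geometric_fps_inverse by simp
      then show ?thesis by (simp add: algebra_simps)
    qed
    show ?case
    proof (induction k)
      case 0
      have "fps_nth (h_series (Suc n)) 0 = fps_nth (h_series n) 0"
        by (subst H) (simp add: mult.assoc)
      then show ?case using Suc[of 0] by (simp add: h_0)
    next
      case (Suc k)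
      have "fps_nth (h_series (Suc n)) (Suc k) = fps_nth (h_series n) (Suc k) + xvar n * fps_nth (h_series (Suc n)) k"
        by (subst H) (simp add: mult.assoc)
      then show ?case using Suc.IH \<open>\<And>k. h n (int k) = fps_nth (h_series n) k\<close>[of "Suc k"] h_rec[of n "int (Suc k)"] by simp
    qed
  qed
  from this[of "nat p"] show ?thesis using h_neg[of p n] by (cases "p < 0") (auto simp: fps_znth_def)
qed

text \<open>The coefficient of t^k is (-1)^k times the elementary symmetric polynomial e_k in the
  variables indexed by \<open>A\<close>.\<close>

definition e_series :: "nat set \<Rightarrow> kpoly fps" where
  "e_series A = (\<Prod>j\<in>A. 1 - fps_const (xvar j) * fps_X)"

lemma e_series_nth_0: "fps_nth (e_series A) 0 = 1"
  unfolding e_series_def by (induction A rule: infinite_finite_induct) (simp_all add: mult.assoc)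

lemma e_series_nth_eq_0: "finite A \<Longrightarrow> card A < k \<Longrightarrow> fps_nth (e_series A) k = 0"
  unfolding e_series_def
proof (induction A arbitrary: k rule: finite_induct)
  case (insert x A)
  then obtain l where k: "k = Suc l" by (cases k) auto
  show ?case using insert by (simp add: k algebra_simps mult.assoc)
qed simp

lemma h_series_e_series: "h_series n * e_series {..<n} = 1"
  unfolding h_series_def e_series_def prod.distrib[symmetric] geometric_fps_inverse by simp

lemma geometric_fps_eq_h_series_e_series:
  assumes "i < n"
  shows "geometric_fps (xvar i) = h_series n * e_series ({..<n} - {i})"
proof -
  have "h_series n = geometric_fps (xvar i) * (\<Prod>j\<in>{..<n} - {i}. geometric_fps (xvar j))"
    unfolding h_series_def using assms by (intro prod.remove) auto
  then have "h_series n * e_series ({..<n} - {i}) = geometric_fps (xvar i) * (\<Prod>j\<in>{..<n} - {i}. geometric_fps (xvar j) * (1 - fps_const (xvar j) * fps_X))"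
    unfolding e_series_def by (simp only: mult.assoc prod.distrib)
  then show ?thesis by (simp add: geometric_fps_inverse)
qed

lemma alternant_delta: "alternant n (\<lambda>j. n - Suc j) = vandermonde n"
  unfolding alternant_def vandermonde_def by (rule fdet_vandermonde)

text \<open>The coefficients of $\prod_{j \ne i} (1 - x_j t)$ express $x_i^a$ through the $h_{a-k}$ with a
  matrix that does not depend on the exponents; the exponents $n-1, \dots, 0$ show that its
  determinant is the Vandermonde product.\<close>

theorem jacobi_trudi:
  "alternant n \<alpha> = vandermonde n * fdet n (\<lambda>i j. h n (int (\<alpha> i) - int (n - Suc j)))"
proof -
  define M where "M = (\<lambda>i k. fps_nth (e_series ({..<n} - {i})) (n - Suc k))"
  have alternant: "alternant n \<alpha> = fdet n M * fdet n (\<lambda>k j. h n (int (\<alpha> j) - int (n - Suc k)))" for \<alpha>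
  proof -
    have "alternant n \<alpha> = fdet n (\<lambda>i j. \<Sum>k<n. M i k * h n (int (\<alpha> j) - int (n - Suc k)))"
      unfolding alternant_def
    proof (rule fdet_cong)
      fix i j assume i: "i < n"
      have "xvar i ^ \<alpha> j = fps_znth (geometric_fps (xvar i)) (int (\<alpha> j))"
        by (simp add: fps_znth_def geometric_fps_def)
      also have "\<dots> = (\<Sum>k<n. fps_nth (e_series ({..<n} - {i})) k * fps_znth (h_series n) (int (\<alpha> j) - int k))"
        unfolding geometric_fps_eq_h_series_e_series[OF i]
        by (rule fps_znth_mult_left) (use i in \<open>auto intro!: e_series_nth_eq_0\<close>)
      also have "\<dots> = (\<Sum>k<n. M i k * h n (int (\<alpha> j) - int (n - Suc k)))"
        unfolding M_def h_h_series by (rule sum.nat_diff_reindex[symmetric])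
      finally show "xvar i ^ \<alpha> j = (\<Sum>k<n. M i k * h n (int (\<alpha> j) - int (n - Suc k)))" .
    qed
    then show ?thesis unfolding fdet_mult .
  qed
  have "fdet n (\<lambda>k j. h n (int (n - Suc j) - int (n - Suc k))) = (\<Prod>i<n. h n (int (n - Suc i) - int (n - Suc i)))"
    by (rule fdet_lower_triangular) (auto intro!: h_neg)
  then have "fdet n M = vandermonde n"
    using alternant[of "\<lambda>j. n - Suc j"] by (simp add: alternant_delta h_0)
  then show ?thesis
    unfolding alternant[of \<alpha>] by (simp only: fdet_transpose[of n "\<lambda>i j. h n (int (\<alpha> i) - int (n - Suc j))"])
qed

lemma xvar_inj: "xvar i = xvar j \<Longrightarrow> i = j"
proof -
  assume "xvar i = xvar j"
  then have "lookup (xvar i) (single i 1) = lookup (xvar j) (single i 1)" by simp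
  then have "single j 1 = (single i 1 :: monom)"
    unfolding xvar_def by (auto simp: Poly_Mapping.lookup_single when_def split: if_splits)
  then have "lookup (single j 1 :: monom) i = lookup (single i 1) i" by simp
  then show "i = j" by (auto simp: Poly_Mapping.lookup_single when_def split: if_splits)
qed

lemma vandermonde_neq_0: "vandermonde n \<noteq> 0"
  unfolding vandermonde_def by (auto simp: prod_zero_iff dest: xvar_inj)

text \<open>The skew Schur function $s_{\rho/\kappa}(x_1, \dots, x_n)$.\<close>

definition skew_jt :: "nat \<Rightarrow> nat \<Rightarrow> ptn \<Rightarrow> ptn \<Rightarrow> kpoly" where
  "skew_jt n r \<rho> \<kappa> = fdet r (\<lambda>i j. h n (int (shifted r \<rho> i) - int (shifted r \<kappa> j)))"

text \<open>A further zero part on both sides adds a last row (0, ..., 0, h_0), because the other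
  indices in it are negative.\<close>

lemma skew_jt_Suc:
  assumes "len \<rho> \<le> r" "len \<kappa> \<le> r"
  shows "skew_jt n (Suc r) \<rho> \<kappa> = skew_jt n r \<rho> \<kappa>"
proof -
  have z: "part \<rho> r = 0" "part \<kappa> r = 0" using assms by (simp_all add: part_eq_0_iff)
  have "skew_jt n (Suc r) \<rho> \<kappa> = h n (int (shifted (Suc r) \<rho> r) - int (shifted (Suc r) \<kappa> r)) * fdet r (\<lambda>i j. h n (int (shifted (Suc r) \<rho> i) - int (shifted (Suc r) \<kappa> j)))"
    unfolding skew_jt_def by (rule fdet_last_row) (rule h_neg, simp add: shifted_def z)
  also have "fdet r (\<lambda>i j. h n (int (shifted (Suc r) \<rho> i) - int (shifted (Suc r) \<kappa> j))) = skew_jt n r \<rho> \<kappa>"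
    unfolding skew_jt_def by (rule fdet_cong) (simp add: shifted_Suc)
  finally show ?thesis by (simp add: shifted_def z h_0)
qed

lemma skew_jt_stable:
  assumes "len \<rho> \<le> r" "len \<kappa> \<le> r" "r \<le> r'"
  shows "skew_jt n r' \<rho> \<kappa> = skew_jt n r \<rho> \<kappa>"
  using assms(3)
proof (induction r' rule: dec_induct)
  case (step k)
  then show ?case using skew_jt_Suc[of \<rho> k \<kappa> n] assms by simp
qed simp

definition empty_ptn :: ptn where "empty_ptn = Ptn (\<lambda>_. 0)"

lemma part_empty_ptn: "part empty_ptn i = 0"
  unfolding empty_ptn_def by (subst part_Ptn) (auto simp: antimono_def)

lemma len_empty_ptn: "len empty_ptn = 0"
  using len_le_iff[of empty_ptn 0] by (simp add: part_empty_ptn)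

lemma shifted_empty_ptn: "shifted n empty_ptn k = n - Suc k"
  by (simp add: shifted_def part_empty_ptn)

lemma alternant_shifted: "alternant n (shifted n \<rho>) = vandermonde n * skew_jt n n \<rho> empty_ptn"
  unfolding skew_jt_def shifted_empty_ptn by (rule jacobi_trudi)

section \<open>Symmetric functions\<close>

lemma Lam_bounded_degree: "f \<in> Lam \<Longrightarrow> bounded_degree f"
  unfolding Lam_def bounded_degree_def by blast

lemma finite_sum_pairs: "finite {(a, b :: monom). a + b = c}"
proof -
  obtain n where n: "keys c \<subseteq> {..<n}"
    using finite_nat_set_iff_bounded[of "keys c"] by auto
  let ?A = "{a. keys a \<subseteq> {..<n} \<and> mdeg a \<le> mdeg c}"
  have "{(a, b :: monom). a + b = c} \<subseteq> ?A \<times> ?A"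
    using n by (auto simp: keys_add_nat mdeg_add)
  then show ?thesis using finite_monoms[of n "mdeg c"] by (meson finite_SigmaI finite_subset)
qed

lemma lookup_times:
  fixes p q :: kpoly
  shows "lookup (p * q) c = (\<Sum>(a, b)\<in>{(a, b). a + b = c}. lookup p a * lookup q b)"
proof -
  have "lookup (p * q) c = (\<Sum>(a, b). lookup p a * lookup q b when c = a + b)"
    unfolding times_poly_mapping.rep_eq by (rule prod_fun_unfold_prod) auto
  also have "\<dots> = (\<Sum>x\<in>{(a, b). a + b = c}. case x of (a, b) \<Rightarrow> lookup p a * lookup q b when c = a + b)"
    by (rule Sum_any.expand_superset[OF finite_sum_pairs]) (auto simp: when_def split: if_splits)
  also have "\<dots> = (\<Sum>(a, b)\<in>{(a, b). a + b = c}. lookup p a * lookup q b)"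
    by (rule sum.cong) auto
  finally show ?thesis .
qed

lemma bounded_degree_series_mult:
  assumes "bounded_degree f" "bounded_degree g"
  shows "bounded_degree (series_mult f g)"
proof -
  obtain d d' where d: "\<And>a. f a \<noteq> 0 \<Longrightarrow> mdeg a \<le> d" "\<And>a. g a \<noteq> 0 \<Longrightarrow> mdeg a \<le> d'"
    using assms unfolding bounded_degree_def by blast
  have "mdeg c \<le> d + d'" if "series_mult f g c \<noteq> 0" for c
  proof -
    from that obtain x where "x \<in> {(a, b). a + b = c}" "(case x of (a, b) \<Rightarrow> f a * g b) \<noteq> 0"
      unfolding series_mult_def by (rule sum.not_neutral_contains_not_neutral)
    then obtain a b where "a + b = c" "f a \<noteq> 0" "g b \<noteq> 0" by auto
    then show ?thesis using d(1)[of a] d(2)[of b] by (auto simp: mdeg_add)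
  qed
  then show ?thesis unfolding bounded_degree_def by blast
qed

lemma restrict_series_mult:
  assumes "bounded_degree f" "bounded_degree g"
  shows "restrict_vars n (series_mult f g) = restrict_vars n f * restrict_vars n g"
proof (rule poly_mapping_eqI)
  fix c
  show "lookup (restrict_vars n (series_mult f g)) c = lookup (restrict_vars n f * restrict_vars n g) c"
  proof (cases "keys c \<subseteq> {..<n}")
    case True
    then show ?thesis
      unfolding lookup_times lookup_restrict_vars[OF assms(1)] lookup_restrict_vars[OF assms(2)]
        lookup_restrict_vars[OF bounded_degree_series_mult[OF assms]]
      by (simp add: series_mult_def) (rule sum.cong, auto simp: keys_add_nat)
  next
    case False
    then show ?thesis
      unfolding lookup_times lookup_restrict_vars[OF assms(1)] lookup_restrict_vars[OF assms(2)]
        lookup_restrict_vars[OF bounded_degree_series_mult[OF assms]]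
      unfolding if_not_P[OF False] by (intro sum.neutral[symmetric]) (auto simp: keys_add_nat)
  qed
qed

lemma Lam_series_mult:
  assumes "f \<in> Lam" "g \<in> Lam"
  shows "series_mult f g \<in> Lam"
proof -
  have "series_mult f g (Poly_Mapping.map_key \<pi> c) = series_mult f g c" if "bij \<pi>" for \<pi> c
  proof -
    let ?m = "Poly_Mapping.map_key \<pi>" and ?m' = "Poly_Mapping.map_key (Hilbert_Choice.inv \<pi>)"
    have inj: "inj \<pi>" "inj (Hilbert_Choice.inv \<pi>)"
      using that by (auto intro: bij_is_inj bij_imp_bij_inv)
    have m: "?m (?m' a) = a" "?m' (?m a) = a" for a :: monom
      using that inj by (simp_all add: map_key_compose map_key_id bij_is_surj surj_iff[THEN iffD1] inv_o_cancel id_def[symmetric])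
        (simp_all add: id_def map_key_id)
    have sym: "f (?m a) = f a" "g (?m a) = g a" for a
      using assms that unfolding Lam_def symmetric_def by auto
    show ?thesis
      unfolding series_mult_def
      by (rule sum.reindex_bij_witness[of _ "\<lambda>(a, b). (?m a, ?m b)" "\<lambda>(a, b). (?m' a, ?m' b)"])
         (auto simp: m sym map_key_plus[OF inj(1), symmetric] map_key_plus[OF inj(2), symmetric],
          metis m(1) sym)
  qed
  moreover have "bounded_degree (series_mult f g)" using assms by (intro bounded_degree_series_mult Lam_bounded_degree)
  ultimately show ?thesis unfolding Lam_def symmetric_def bounded_degree_def by simp
qed

lemma Lam_sum:
  assumes "finite A" "\<forall>x\<in>A. f x \<in> Lam"
  shows "(\<lambda>a. \<Sum>x\<in>A. c x * f x a) \<in> Lam"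
proof -
  have "\<exists>d. \<forall>a. f x a \<noteq> 0 \<longrightarrow> mdeg a \<le> d" if "x \<in> A" for x
    using bspec[OF assms(2) that] unfolding Lam_def by blast
  then obtain d where d: "\<And>x a. x \<in> A \<Longrightarrow> f x a \<noteq> 0 \<Longrightarrow> mdeg a \<le> d x" by metis
  have "mdeg a \<le> sum d A" if nz: "(\<Sum>x\<in>A. c x * f x a) \<noteq> 0" for a
  proof -
    from nz obtain x where x: "x \<in> A" "c x * f x a \<noteq> 0" by (rule sum.not_neutral_contains_not_neutral)
    then have "mdeg a \<le> d x" using d by auto
    also have "\<dots> \<le> sum d A" using assms(1) x by (intro member_le_sum) auto
    finally show ?thesis .
  qed
  moreover have "f x (Poly_Mapping.map_key \<pi> a) = f x a" if "bij \<pi>" "x \<in> A" for \<pi> x a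
    using bspec[OF assms(2) that(2)] that(1) unfolding Lam_def symmetric_def by auto
  ultimately show ?thesis unfolding Lam_def symmetric_def by auto
qed

lemma restrict_sum:
  assumes "finite A" "\<forall>x\<in>A. f x \<in> Lam"
  shows "restrict_vars n (\<lambda>a. \<Sum>x\<in>A. c x * f x a) = (\<Sum>x\<in>A. cst (c x) * restrict_vars n (f x))"
proof (rule poly_mapping_eqI)
  fix a
  have "lookup (\<Sum>x\<in>A. cst (c x) * restrict_vars n (f x)) a = (\<Sum>x\<in>A. c x * (if keys a \<subseteq> {..<n} then f x a else 0))"
    unfolding Poly_Mapping.lookup_sum lookup_cst_mult
    by (rule sum.cong) (simp_all add: lookup_restrict_vars[OF Lam_bounded_degree[OF bspec[OF assms(2)]]])
  then show "lookup (restrict_vars n (\<lambda>a. \<Sum>x\<in>A. c x * f x a)) a = lookup (\<Sum>x\<in>A. cst (c x) * restrict_vars n (f x)) a"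
    unfolding lookup_restrict_vars[OF Lam_bounded_degree[OF Lam_sum[of A f c, OF assms]]] by auto
qed

text \<open>Every monomial uses finitely many variables and is therefore visible in all large
  restrictions. The threshold \<open>N\<close> is there because bialternant equations hold only from
  the length of the partition on.\<close>

lemma Lam_eqI:
  assumes "f \<in> Lam" "g \<in> Lam" "\<And>n. N \<le> n \<Longrightarrow> restrict_vars n f = restrict_vars n g"
  shows "f = g"
proof
  fix a :: monom
  obtain m where m: "keys a \<subseteq> {..<m}"
    using finite_nat_set_iff_bounded[of "keys a"] by auto
  let ?n = "max N m"
  have "keys a \<subseteq> {..<?n}" using m by auto
  then show "f a = g a"
    using arg_cong[OF assms(3)[of ?n], of "\<lambda>p. lookup p a"]
    by (simp add: lookup_restrict_vars[OF Lam_bounded_degree] assms(1,2))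
qed

text \<open>Compatibility is expressed by the existence of one common series, so that closure under
  sums, products and determinants is inherited from the operations on \<open>Lam\<close>. Witnesses
  can then be written as determinants of polynomials.\<close>

definition stable_family :: "(nat \<Rightarrow> kpoly) \<Rightarrow> bool" where
  "stable_family P \<longleftrightarrow> (\<exists>f\<in>Lam. \<forall>n. restrict_vars n f = P n)"

lemma stable_family_h: "stable_family (\<lambda>n. h n p)"
proof -
  have "hsym p \<in> Lam" using bounded_degree_hsym[of p]
    unfolding Lam_def symmetric_def bounded_degree_def by (auto simp: hsym_def mdeg_map_key)
  then show ?thesis unfolding stable_family_def by blast
qed

lemma stable_family_cst: "stable_family (\<lambda>n. cst c)"
proof -
  let ?f = "\<lambda>a. if mdeg a = 0 then c else 0"
  have "?f \<in> Lam" unfolding Lam_def symmetric_def by (auto simp: mdeg_map_key)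
  moreover have "restrict_vars n ?f = cst c" for n
    by (rule poly_mapping_eqI, subst lookup_restrict_vars[OF Lam_bounded_degree[OF \<open>?f \<in> Lam\<close>]])
       (auto simp: cst_def mdeg_eq_0_iff Poly_Mapping.lookup_single when_def)
  ultimately show ?thesis unfolding stable_family_def by blast
qed

lemma stable_family_mult: "stable_family P \<Longrightarrow> stable_family Q \<Longrightarrow> stable_family (\<lambda>n. P n * Q n)"
proof -
  assume "stable_family P" "stable_family Q"
  then obtain f g where fg: "f \<in> Lam" "g \<in> Lam" "\<And>n. restrict_vars n f = P n" "\<And>n. restrict_vars n g = Q n"
    unfolding stable_family_def by blast
  have "restrict_vars n (series_mult f g) = P n * Q n" for n
    using restrict_series_mult[OF Lam_bounded_degree Lam_bounded_degree, OF fg(1,2)] fg(3,4) by simp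
  then show ?thesis unfolding stable_family_def using Lam_series_mult[OF fg(1,2)] by blast
qed

lemma stable_family_sum:
  assumes "finite A" "\<And>x. x \<in> A \<Longrightarrow> stable_family (P x)"
  shows "stable_family (\<lambda>n. \<Sum>x\<in>A. P x n)"
proof -
  have "\<exists>f. f \<in> Lam \<and> (\<forall>n. restrict_vars n f = P x n)" if "x \<in> A" for x
    using assms(2)[OF that] unfolding stable_family_def by blast
  then obtain f where f: "\<forall>x\<in>A. f x \<in> Lam" "\<And>x n. x \<in> A \<Longrightarrow> restrict_vars n (f x) = P x n"
    by metis
  have "(\<lambda>a. \<Sum>x\<in>A. 1 * f x a) \<in> Lam" by (rule Lam_sum[of A f, OF assms(1) f(1)])
  moreover have "restrict_vars n (\<lambda>a. \<Sum>x\<in>A. 1 * f x a) = (\<Sum>x\<in>A. P x n)" for n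
    unfolding restrict_sum[of A f n "\<lambda>_. 1", OF assms(1) f(1)] using f(2) by simp
  ultimately show ?thesis unfolding stable_family_def by blast
qed

lemma stable_family_prod:
  assumes "finite A" "\<And>x. x \<in> A \<Longrightarrow> stable_family (P x)"
  shows "stable_family (\<lambda>n. \<Prod>x\<in>A. P x n)"
  using assms
proof (induction A rule: finite_induct)
  case empty
  then show ?case using stable_family_cst[of 1] by simp
next
  case (insert x A)
  then show ?case using stable_family_mult[of "P x" "\<lambda>n. \<Prod>x\<in>A. P x n"] by simp
qed

lemma stable_family_fdet:
  assumes "\<And>i j. i < r \<Longrightarrow> j < r \<Longrightarrow> stable_family (\<lambda>n. F n i j)"
  shows "stable_family (\<lambda>n. fdet r (F n))"
  unfolding fdet_rows cst_of_int[symmetric]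
  by (intro stable_family_sum stable_family_mult stable_family_prod stable_family_cst) (auto simp: finite_permutations assms permutes_lt)

lemma stable_family_skew_jt: "stable_family (\<lambda>n. skew_jt n r \<rho> \<kappa>)"
  unfolding skew_jt_def by (rule stable_family_fdet) (rule stable_family_h)

section \<open>Existence and uniqueness of the Schur functions\<close>

lemma schur_exists:
  obtains f where "f \<in> Lam" "\<And>n. restrict_vars n f = skew_jt n (len la) la empty_ptn"
  using stable_family_skew_jt[of "len la" la empty_ptn] unfolding stable_family_def by blast

lemma skew_jt_len_alternant: "len la \<le> n \<Longrightarrow> skew_jt n (len la) la empty_ptn * vandermonde n = alternant n (shifted n la)"
  unfolding alternant_shifted using skew_jt_stable[of la "len la" empty_ptn n n] by (simp add: len_empty_ptn mult.commute)

text \<open>The witness is the Jacobi-Trudi determinant of size \<open>len la\<close>, a size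
  independent of n; uniqueness is cancellation of the Vandermonde product. The formula also gives
  the value for n below \<open>len la\<close>, where the defining equation is silent.\<close>

lemma schur_characterization:
  "schur la \<in> Lam \<and> (\<forall>n. restrict_vars n (schur la) = skew_jt n (len la) la empty_ptn)"
proof -
  obtain f where f: "f \<in> Lam" "\<And>n. restrict_vars n f = skew_jt n (len la) la empty_ptn"
    using schur_exists[of la] by blast
  have alternant: "det (mat n n (\<lambda>(i, j). xvar i ^ (part la j + n - Suc j))) = alternant n (shifted n la)" for n
    unfolding alternant_def fdet_def shifted_def ..
  have "schur la = f"
    unfolding schur_def alternant
  proof (rule the_equality)
    show "f \<in> Lam \<and> (\<forall>n\<ge>len la. restrict_vars n f * vandermonde n = alternant n (shifted n la))"
      using f skew_jt_len_alternant by simp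
    fix g assume g: "g \<in> Lam \<and> (\<forall>n\<ge>len la. restrict_vars n g * vandermonde n = alternant n (shifted n la))"
    show "g = f"
    proof (rule Lam_eqI)
      fix n assume "len la \<le> n"
      then have "restrict_vars n g * vandermonde n = restrict_vars n f * vandermonde n"
        using g f skew_jt_len_alternant by simp
      then show "restrict_vars n g = restrict_vars n f" using vandermonde_neq_0 by simp
    qed (use g f in auto)
  qed
  then show ?thesis using f by simp
qed

lemma schur_Lam: "schur la \<in> Lam"
  using schur_characterization by blast

lemma schur_Lam_ball: "\<forall>x\<in>A. schur x \<in> Lam"
  using schur_Lam by blast

lemma restrict_schur: "len la \<le> r \<Longrightarrow> restrict_vars n (schur la) = skew_jt n r la empty_ptn"
  using schur_characterization[of la] skew_jt_stable[of la "len la" empty_ptn r n] by (simp add: len_empty_ptn)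

lemma restrict_schur_alternant: "len la \<le> n \<Longrightarrow> restrict_vars n (schur la) * vandermonde n = alternant n (shifted n la)"
  using schur_characterization[of la] skew_jt_len_alternant by simp

section \<open>Coefficients in the Schur basis\<close>

lemma zcoeff_restrict:
  assumes "bounded_degree f"
  shows "zcoeff n (restrict_vars n f) e = (if \<forall>i<n. 0 \<le> e i then f (monom_of n (\<lambda>i. nat (e i))) else 0)"
  unfolding zcoeff_def lookup_restrict_vars[OF assms] using keys_monom_of[of n] by auto

lemma zcoeff_restrict_Suc:
  assumes "bounded_degree f" "e n = 0"
  shows "zcoeff (Suc n) (restrict_vars (Suc n) f) e = zcoeff n (restrict_vars n f) e"
proof -
  have "monom_of (Suc n) (\<lambda>i. nat (e i)) = monom_of n (\<lambda>i. nat (e i))"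
    by (rule poly_mapping_eqI) (use assms in \<open>auto simp: lookup_monom_of less_Suc_eq\<close>)
  then show ?thesis unfolding zcoeff_restrict[OF assms(1)] using assms(2) by (auto simp: less_Suc_eq)
qed

lemma Lam_restrict_perm:
  assumes "f \<in> Lam" "w permutes {..<n}"
  shows "zcoeff n (restrict_vars n f) (\<lambda>i. e (w i)) = zcoeff n (restrict_vars n f) e"
proof -
  have "(\<forall>i<n. 0 \<le> e (w i)) \<longleftrightarrow> (\<forall>i<n. 0 \<le> e i)"
    using permutes_lt[OF assms(2)] permutes_lt[OF permutes_inv[OF assms(2)]] permutes_inverses[OF assms(2)]
    by metis
  moreover have "monom_of n (\<lambda>i. nat (e (w i))) = Poly_Mapping.map_key w (monom_of n (\<lambda>i. nat (e i)))"
  proof (rule poly_mapping_eqI)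
    fix i
    show "lookup (monom_of n (\<lambda>i. nat (e (w i)))) i = lookup (Poly_Mapping.map_key w (monom_of n (\<lambda>i. nat (e i)))) i"
      unfolding map_key.rep_eq[OF permutes_inj[OF assms(2)]] lookup_monom_of o_def
      using permutes_lt[OF assms(2), of i] permutes_not_in[OF assms(2), of i] by (cases "i < n") auto
  qed
  moreover have "bij w" using assms(2) by (rule permutes_bij)
  ultimately show ?thesis
    using assms(1) unfolding zcoeff_restrict[OF Lam_bounded_degree[OF assms(1)]] Lam_def symmetric_def by auto
qed

text \<open>A symmetric factor times an alternating one is alternating: permuting the exponents is
  absorbed by reindexing the sum over permutations.\<close>

lemma zcoeff_mult_alternant_antisym:
  assumes "f \<in> Lam" "w permutes {..<n}"
  shows "zcoeff n (restrict_vars n f * alternant n \<alpha>) (\<lambda>i. e (w i)) = signof w * zcoeff n (restrict_vars n f * alternant n \<alpha>) e"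
proof -
  have "zcoeff n (restrict_vars n f * alternant n \<alpha>) (\<lambda>i. e (w i)) =
      (\<Sum>p | p permutes {..<n}. signof p * zcoeff n (restrict_vars n f) (\<lambda>i. e (w i) - int (\<alpha> (p i))))"
    by (rule zcoeff_mult_alternant)
  also have "\<dots> = (\<Sum>p | p permutes {..<n}. signof (p \<circ> w) * zcoeff n (restrict_vars n f) (\<lambda>i. e (w i) - int (\<alpha> ((p \<circ> w) i))))"
    by (rule sum_permutations_compose_right[OF assms(2), of "\<lambda>p. signof p * zcoeff n (restrict_vars n f) (\<lambda>i. e (w i) - int (\<alpha> (p i)))"])
  also have "\<dots> = (\<Sum>p | p permutes {..<n}. signof w * (signof p * zcoeff n (restrict_vars n f) (\<lambda>i. e i - int (\<alpha> (p i)))))"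
  proof (rule sum.cong)
    fix p assume "p \<in> {p. p permutes {..<n}}"
    then have p: "p permutes {..<n}" by simp
    have "sign (p \<circ> w) = sign p * sign w"
      using p assms(2) by (intro sign_compose) (auto intro: permutation_permutes[THEN iffD2])
    moreover have "zcoeff n (restrict_vars n f) (\<lambda>i. e (w i) - int (\<alpha> ((p \<circ> w) i))) = zcoeff n (restrict_vars n f) (\<lambda>i. e i - int (\<alpha> (p i)))"
      using Lam_restrict_perm[OF assms, of "\<lambda>i. e i - int (\<alpha> (p i))"] by simp
    ultimately show "signof (p \<circ> w) * zcoeff n (restrict_vars n f) (\<lambda>i. e (w i) - int (\<alpha> ((p \<circ> w) i))) =
       signof w * (signof p * zcoeff n (restrict_vars n f) (\<lambda>i. e i - int (\<alpha> (p i))))"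
      by (simp add: mult_ac)
  qed simp
  also have "\<dots> = signof w * zcoeff n (restrict_vars n f * alternant n \<alpha>) e"
    unfolding zcoeff_mult_alternant sum_distrib_left ..
  finally show ?thesis .
qed

text \<open>Swapping the two equal exponents leaves the coefficient unchanged but also negates it,
  and 2 is nonzero in the ground field.\<close>

lemma zcoeff_mult_alternant_not_inj:
  assumes "f \<in> Lam" "i < n" "j < n" "i \<noteq> j" "e i = e j"
  shows "zcoeff n (restrict_vars n f * alternant n \<alpha>) e = 0"
proof -
  let ?t = "transpose i j"
  have t: "?t permutes {..<n}" using assms by (intro permutes_swap_id) auto
  have "(\<lambda>k. e (?t k)) = e" using assms by (auto simp: transpose_def)
  then have "zcoeff n (restrict_vars n f * alternant n \<alpha>) e = - zcoeff n (restrict_vars n f * alternant n \<alpha>) e"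
    using zcoeff_mult_alternant_antisym[OF assms(1) t, of \<alpha> e] assms(4) by (simp add: sign_swap_id)
  then have "2 * zcoeff n (restrict_vars n f * alternant n \<alpha>) e = 0" by (simp add: eq_neg_iff_add_eq_0)
  then show ?thesis by simp
qed

text \<open>An explicit candidate for the coordinate at \<nu>: the coefficient of x^(\<nu>+\<delta>)
  in f times the Vandermonde product. The fewest possible variables are used here;
  \<open>schur_coeff_eq\<close> frees the choice.\<close>

definition schur_coeff :: "kseries \<Rightarrow> ptn \<Rightarrow> K" where
  "schur_coeff f \<nu> = zcoeff (len \<nu>) (restrict_vars (len \<nu>) f * vandermonde (len \<nu>)) (\<lambda>i. int (shifted (len \<nu>) \<nu> i))"

text \<open>The shifted exponent of the new variable is 0. A permutation p with p n different from n
  would subtract a positive number from it and make it negative, so only permutations fixing n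
  contribute.\<close>

lemma schur_coeff_Suc:
  assumes f: "bounded_degree f" and n: "len \<nu> \<le> n"
  shows "zcoeff (Suc n) (restrict_vars (Suc n) f * vandermonde (Suc n)) (\<lambda>i. int (shifted (Suc n) \<nu> i)) =
    zcoeff n (restrict_vars n f * vandermonde n) (\<lambda>i. int (shifted n \<nu> i))"
proof -
  have z: "part \<nu> n = 0" using n by (simp add: part_eq_0_iff)
  let ?g = "\<lambda>p. signof p * zcoeff (Suc n) (restrict_vars (Suc n) f) (\<lambda>i. int (shifted (Suc n) \<nu> i) - int (Suc n - Suc (p i)))"
  have "zcoeff (Suc n) (restrict_vars (Suc n) f * vandermonde (Suc n)) (\<lambda>i. int (shifted (Suc n) \<nu> i)) = (\<Sum>p | p permutes {..<Suc n}. ?g p)"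
    unfolding alternant_delta[symmetric] by (rule zcoeff_mult_alternant)
  also have "\<dots> = (\<Sum>p | p permutes {..<n}. ?g p)"
  proof (rule sum.mono_neutral_right)
    show "finite {p. p permutes {..<Suc n}}" by (simp add: finite_permutations)
    show "{p. p permutes {..<n}} \<subseteq> {p. p permutes {..<Suc n}}"
      by (auto intro: permutes_subset)
    show "\<forall>p\<in>{p. p permutes {..<Suc n}} - {p. p permutes {..<n}}. ?g p = 0"
    proof
      fix p assume "p \<in> {p. p permutes {..<Suc n}} - {p. p permutes {..<n}}"
      then have p: "p permutes {..<Suc n}" "\<not> p permutes {..<n}" by auto
      have "p n \<noteq> n"
      proof
        assume "p n = n"
        then have "p permutes {..<n}" by (intro permutes_superset[OF p(1)]) (auto simp: less_Suc_eq)
        then show False using p(2) by simp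
      qed
      moreover have "p n < Suc n" by (rule permutes_lt[OF p(1)]) simp
      ultimately have "int (shifted (Suc n) \<nu> n) - int (Suc n - Suc (p n)) < 0"
        by (simp add: shifted_def z)
      then have "zcoeff (Suc n) (restrict_vars (Suc n) f) (\<lambda>i. int (shifted (Suc n) \<nu> i) - int (Suc n - Suc (p i))) = 0"
        unfolding zcoeff_def by (metis lessI not_le)
      then show "?g p = 0" by simp
    qed
  qed
  also have "\<dots> = (\<Sum>p | p permutes {..<n}. signof p * zcoeff n (restrict_vars n f) (\<lambda>i. int (shifted n \<nu> i) - int (n - Suc (p i))))"
  proof (rule sum.cong)
    fix p assume "p \<in> {p. p permutes {..<n}}"
    then have p: "p permutes {..<n}" by simp
    then have "p n = n" by (simp add: permutes_not_in)
    then have "zcoeff (Suc n) (restrict_vars (Suc n) f) (\<lambda>i. int (shifted (Suc n) \<nu> i) - int (Suc n - Suc (p i))) =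
       zcoeff n (restrict_vars n f) (\<lambda>i. int (shifted (Suc n) \<nu> i) - int (Suc n - Suc (p i)))"
      by (intro zcoeff_restrict_Suc[OF f]) (simp add: shifted_def z)
    also have "\<dots> = zcoeff n (restrict_vars n f) (\<lambda>i. int (shifted n \<nu> i) - int (n - Suc (p i)))"
    proof (rule zcoeff_cong)
      fix i assume "i < n"
      moreover from this have "p i < n" by (rule permutes_lt[OF p])
      ultimately show "int (shifted (Suc n) \<nu> i) - int (Suc n - Suc (p i)) = int (shifted n \<nu> i) - int (n - Suc (p i))"
        by (simp add: shifted_Suc)
    qed
    finally show "?g p = signof p * zcoeff n (restrict_vars n f) (\<lambda>i. int (shifted n \<nu> i) - int (n - Suc (p i)))" by simp
  qed simp
  also have "\<dots> = zcoeff n (restrict_vars n f * vandermonde n) (\<lambda>i. int (shifted n \<nu> i))"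
    unfolding alternant_delta[symmetric] by (rule zcoeff_mult_alternant[symmetric])
  finally show ?thesis .
qed

lemma schur_coeff_eq:
  assumes "bounded_degree f" "len \<nu> \<le> n"
  shows "schur_coeff f \<nu> = zcoeff n (restrict_vars n f * vandermonde n) (\<lambda>i. int (shifted n \<nu> i))"
  using assms(2)
proof (induction n rule: dec_induct)
  case base
  show ?case by (simp add: schur_coeff_def)
next
  case (step n)
  then show ?case using schur_coeff_Suc[OF assms(1), of \<nu> n] by simp
qed

lemma schur_coeff_schur: "schur_coeff (schur la) \<nu> = (if la = \<nu> then 1 else 0)"
proof -
  let ?n = "max (len la) (len \<nu>)"
  have "schur_coeff (schur la) \<nu> = zcoeff ?n (alternant ?n (shifted ?n la)) (\<lambda>i. int (shifted ?n \<nu> i))"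
    by (subst schur_coeff_eq[OF Lam_bounded_degree[OF schur_Lam], of _ ?n]) (simp_all add: restrict_schur_alternant)
  then show ?thesis by (simp add: zcoeff_alternant_shifted)
qed

lemma schur_coeff_sum:
  assumes "finite A" "\<forall>x\<in>A. f x \<in> Lam"
  shows "schur_coeff (\<lambda>a. \<Sum>x\<in>A. c x * f x a) \<nu> = (\<Sum>x\<in>A. c x * schur_coeff (f x) \<nu>)"
  unfolding schur_coeff_def restrict_sum[of A f _ c, OF assms] by (simp add: sum_distrib_right zcoeff_sum mult.assoc zcoeff_cst_mult)

text \<open>A nonzero coefficient exhibits a monomial of f with exponents \<open>shifted\<close>
  minus a permuted staircase. Their sum is the size of \<nu>, which is at least its number of
  rows.\<close>

lemma schur_coeff_support_size:
  assumes "\<And>a. f a \<noteq> 0 \<Longrightarrow> mdeg a \<le> d" "schur_coeff f \<nu> \<noteq> 0"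
  shows "len \<nu> \<le> d"
proof -
  let ?n = "len \<nu>"
  have b: "bounded_degree f" using assms(1) unfolding bounded_degree_def by blast
  have "(\<Sum>p | p permutes {..<?n}. signof p * zcoeff ?n (restrict_vars ?n f) (\<lambda>i. int (shifted ?n \<nu> i) - int (?n - Suc (p i)))) \<noteq> 0"
    using assms(2) unfolding schur_coeff_def alternant_delta[symmetric] zcoeff_mult_alternant .
  then obtain p where p: "p \<in> {p. p permutes {..<?n}}"
    "signof p * zcoeff ?n (restrict_vars ?n f) (\<lambda>i. int (shifted ?n \<nu> i) - int (?n - Suc (p i))) \<noteq> 0"
    by (rule sum.not_neutral_contains_not_neutral)
  let ?e = "\<lambda>i. int (shifted ?n \<nu> i) - int (?n - Suc (p i))"
  have "zcoeff ?n (restrict_vars ?n f) ?e \<noteq> 0" using p(2) by auto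
  then have nn: "\<forall>i<?n. 0 \<le> ?e i" and "f (monom_of ?n (\<lambda>i. nat (?e i))) \<noteq> 0"
    unfolding zcoeff_restrict[OF b] by (auto split: if_splits)
  then have "mdeg (monom_of ?n (\<lambda>i. nat (?e i))) \<le> d" using assms(1) by blast
  then have "(\<Sum>i<?n. nat (?e i)) \<le> d" unfolding mdeg_monom_of .
  moreover have "int (\<Sum>i<?n. nat (?e i)) = (\<Sum>i<?n. int (part \<nu> i))"
  proof -
    have "int (\<Sum>i<?n. nat (?e i)) = (\<Sum>i<?n. ?e i)" using nn by simp
    also have "\<dots> = (\<Sum>i<?n. int (shifted ?n \<nu> i)) - (\<Sum>i<?n. int (?n - Suc (p i)))"
      by (rule sum_subtractf)
    also have "(\<Sum>i<?n. int (?n - Suc (p i))) = (\<Sum>i<?n. int (?n - Suc i))"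
      using p(1) sum.permute[of p "{..<?n}" "\<lambda>i. int (?n - Suc i)"] by (simp add: o_def)
    also have "(\<Sum>i<?n. int (shifted ?n \<nu> i)) - (\<Sum>i<?n. int (?n - Suc i)) = (\<Sum>i<?n. int (part \<nu> i))"
      unfolding sum_subtractf[symmetric] by (rule sum.cong) (auto simp: shifted_def)
    finally show ?thesis .
  qed
  moreover have "int ?n \<le> (\<Sum>i<?n. int (part \<nu> i))"
  proof -
    have "(\<Sum>i<?n. 1) \<le> (\<Sum>i<?n. int (part \<nu> i))"
    proof (rule sum_mono)
      fix i assume "i \<in> {..<?n}"
      then have "part \<nu> i \<noteq> 0" by (simp add: part_eq_0_iff)
      then show "1 \<le> int (part \<nu> i)" by simp
    qed
    then show ?thesis by simp
  qed
  ultimately show ?thesis by linarith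
qed

text \<open>Distinct \<nu> give distinct monomials x^(\<nu>+\<delta>), all in the finite support of
  a single polynomial.\<close>

lemma finite_schur_coeff_support_len:
  assumes "bounded_degree f"
  shows "finite {\<nu>. len \<nu> \<le> n \<and> schur_coeff f \<nu> \<noteq> 0}"
proof (rule finite_imageD[of "\<lambda>\<nu>. monom_of n (shifted n \<nu>)"])
  show "finite ((\<lambda>\<nu>. monom_of n (shifted n \<nu>)) ` {\<nu>. len \<nu> \<le> n \<and> schur_coeff f \<nu> \<noteq> 0})"
  proof (rule finite_subset)
    show "(\<lambda>\<nu>. monom_of n (shifted n \<nu>)) ` {\<nu>. len \<nu> \<le> n \<and> schur_coeff f \<nu> \<noteq> 0} \<subseteq> keys (restrict_vars n f * vandermonde n)"
      by (auto simp: schur_coeff_eq[OF assms] zcoeff_nat Poly_Mapping.in_keys_iff)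
  qed simp
  show "inj_on (\<lambda>\<nu>. monom_of n (shifted n \<nu>)) {\<nu>. len \<nu> \<le> n \<and> schur_coeff f \<nu> \<noteq> 0}"
  proof (rule inj_onI)
    fix p q assume pq: "p \<in> {\<nu>. len \<nu> \<le> n \<and> schur_coeff f \<nu> \<noteq> 0}" "q \<in> {\<nu>. len \<nu> \<le> n \<and> schur_coeff f \<nu> \<noteq> 0}"
      and eq: "monom_of n (shifted n p) = monom_of n (shifted n q)"
    have "shifted n p i = shifted n q i" if "i < n" for i
      using arg_cong[OF eq, of "\<lambda>m. lookup m i"] that by (simp add: lookup_monom_of)
    then show "p = q" using pq by (intro ptn_eq_shiftedI[of p n q]) auto
  qed
qed

lemma finite_schur_coeff_support:
  assumes "bounded_degree f"
  shows "finite {\<nu>. schur_coeff f \<nu> \<noteq> 0}"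
proof -
  obtain d where d: "\<And>a. f a \<noteq> 0 \<Longrightarrow> mdeg a \<le> d" using assms unfolding bounded_degree_def by blast
  have "{\<nu>. schur_coeff f \<nu> \<noteq> 0} \<subseteq> {\<nu>. len \<nu> \<le> d \<and> schur_coeff f \<nu> \<noteq> 0}"
    using schur_coeff_support_size[of f d] d by blast
  then show ?thesis using finite_schur_coeff_support_len[OF assms] by (rule finite_subset)
qed

text \<open>Both sides are alternating, so it suffices to compare coefficients at strictly
  decreasing exponents, where they agree by duality. \<open>T\<close> may be any finite superset of
  the support, so that several expansions can later share one index set.\<close>

theorem alternant_expansion:
  assumes f: "f \<in> Lam" and T: "finite T" "\<And>\<nu>. \<nu> \<in> T \<Longrightarrow> len \<nu> \<le> n"
    and supp: "\<And>\<nu>. len \<nu> \<le> n \<Longrightarrow> schur_coeff f \<nu> \<noteq> 0 \<Longrightarrow> \<nu> \<in> T"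
  shows "restrict_vars n f * vandermonde n = (\<Sum>\<nu>\<in>T. cst (schur_coeff f \<nu>) * alternant n (shifted n \<nu>))"
    (is "?L = ?R")
proof (rule poly_mapping_eqI)
  \<comment> \<open>The constant 1 is written as a restricted element of \<open>Lam\<close>, so that
    the antisymmetry lemmas for \<open>restrict_vars n f * alternant n \<alpha>\<close> also apply
    to bare alternants on the right.\<close>
  have one: "(\<lambda>a. if mdeg a = 0 then 1 else 0) \<in> Lam" (is "?one \<in> _")
    unfolding Lam_def symmetric_def by (auto simp: mdeg_map_key)
  have rone: "restrict_vars n ?one = 1"
    by (rule poly_mapping_eqI, subst lookup_restrict_vars[OF Lam_bounded_degree[OF one]])
       (auto simp: mdeg_eq_0_iff Poly_Mapping.lookup_one when_def)
  have cR: "zcoeff n ?R e = (\<Sum>\<nu>\<in>T. schur_coeff f \<nu> * zcoeff n (restrict_vars n ?one * alternant n (shifted n \<nu>)) e)" for e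
    unfolding zcoeff_sum zcoeff_cst_mult rone by simp
  have key: "zcoeff n ?L (\<lambda>i. int (e i)) = zcoeff n ?R (\<lambda>i. int (e i))" for e :: "nat \<Rightarrow> nat"
  proof (cases "inj_on e {..<n}")
    case False
    then obtain i j where ij: "i < n" "j < n" "i \<noteq> j" "int (e i) = int (e j)" by (auto simp: inj_on_def)
    show ?thesis unfolding cR
      using zcoeff_mult_alternant_not_inj[where e = "\<lambda>i. int (e i)", OF f ij]
        zcoeff_mult_alternant_not_inj[where e = "\<lambda>i. int (e i)", OF one ij]
      by (simp add: alternant_delta[symmetric])
  next
    case True
    then obtain \<kappa> q where \<kappa>: "len \<kappa> \<le> n" and q: "q permutes {..<n}" and e: "\<And>i. i < n \<Longrightarrow> e i = shifted n \<kappa> (q i)"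
      using sort_exponents by blast
    have e': "zcoeff n P (\<lambda>i. int (e i)) = zcoeff n P (\<lambda>i. (\<lambda>k. int (shifted n \<kappa> k)) (q i))" for P
      by (rule zcoeff_cong) (simp add: e)
    have "zcoeff n ?L (\<lambda>i. int (e i)) = signof q * schur_coeff f \<kappa>"
      unfolding e' using zcoeff_mult_alternant_antisym[OF f q, of "\<lambda>j. n - Suc j" "\<lambda>k. int (shifted n \<kappa> k)"]
      unfolding alternant_delta schur_coeff_eq[OF Lam_bounded_degree[OF f] \<kappa>] .
    moreover have "zcoeff n ?R (\<lambda>i. int (e i)) = signof q * (\<Sum>\<nu>\<in>T. schur_coeff f \<nu> * (if \<nu> = \<kappa> then 1 else 0))"
      unfolding e' unfolding cR sum_distrib_left
    proof (rule sum.cong)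
      fix \<nu> assume \<nu>: "\<nu> \<in> T"
      have "zcoeff n (restrict_vars n ?one * alternant n (shifted n \<nu>)) (\<lambda>i. int (shifted n \<kappa> (q i))) = signof q * (if \<nu> = \<kappa> then 1 else 0)"
        using zcoeff_mult_alternant_antisym[OF one q, of "shifted n \<nu>" "\<lambda>k. int (shifted n \<kappa> k)"] zcoeff_alternant_shifted[OF T(2)[OF \<nu>] \<kappa>]
        unfolding rone by simp
      then show "schur_coeff f \<nu> * zcoeff n (restrict_vars n ?one * alternant n (shifted n \<nu>)) (\<lambda>i. int (shifted n \<kappa> (q i))) =
          signof q * (schur_coeff f \<nu> * (if \<nu> = \<kappa> then 1 else 0))"
        by simp
    qed simp
    moreover have "(\<Sum>\<nu>\<in>T. schur_coeff f \<nu> * (if \<nu> = \<kappa> then 1 else 0)) = (\<Sum>\<nu>\<in>T. if \<kappa> = \<nu> then schur_coeff f \<nu> else 0)"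
      by (rule sum.cong) auto
    moreover have "\<dots> = schur_coeff f \<kappa>"
      using supp[OF \<kappa>] by (auto simp: sum.delta'[OF T(1)])
    ultimately show ?thesis by simp
  qed
  fix a :: monom
  show "lookup ?L a = lookup ?R a"
  proof (cases "keys a \<subseteq> {..<n}")
    case True
    then show ?thesis using key[of "lookup a"] by (simp add: zcoeff_nat monom_of_lookup)
  next
    case False
    \<comment> \<open>\<open>zcoeff\<close> only inspects monomials in the first n variables;
      monomials with further variables are absent from both sides and have to be treated
      separately.\<close>
    have alt0: "lookup (g * alternant n \<alpha>) a = 0" if g: "keys g \<subseteq> {b. keys b \<subseteq> {..<n}}" for g :: kpoly and \<alpha>
    proof -
      have "lookup (g * single (monom_of n e) 1) a = 0" for e
      proof -
        have "keys (g * single (monom_of n e) 1) \<subseteq> {a. keys a \<subseteq> {..<n}}"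
          using keys_mult[of g "single (monom_of n e) 1"] keys_monom_of[of n e] g by (fastforce simp: keys_add_nat)
        then show ?thesis using False by (auto simp: Poly_Mapping.in_keys_iff)
      qed
      then show ?thesis
        unfolding alternant_expand sum_distrib_left Poly_Mapping.lookup_sum
        by (intro sum.neutral ballI) (simp add: mult.left_commute[of g] lookup_cst_mult)
    qed
    have "lookup ?L a = 0" unfolding alternant_delta[symmetric]
    proof (rule alt0, rule subsetI)
      fix b assume "b \<in> keys (restrict_vars n f)"
      then have "lookup (restrict_vars n f) b \<noteq> 0" by (simp add: Poly_Mapping.in_keys_iff)
      then show "b \<in> {b. keys b \<subseteq> {..<n}}"
        unfolding lookup_restrict_vars[OF Lam_bounded_degree[OF f]] by (auto split: if_splits)
    qed
    moreover have "lookup (cst (schur_coeff f \<nu>) * alternant n (shifted n \<nu>)) a = 0" for \<nu>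
      by (rule alt0) (auto simp: cst_def Poly_Mapping.in_keys_iff Poly_Mapping.lookup_single when_def split: if_splits)
    ultimately show ?thesis by (simp add: Poly_Mapping.lookup_sum)
  qed
qed

theorem schur_expansion_restrict:
  assumes f: "f \<in> Lam" and T: "finite T" "\<And>\<nu>. \<nu> \<in> T \<Longrightarrow> len \<nu> \<le> n"
    and supp: "\<And>\<nu>. len \<nu> \<le> n \<Longrightarrow> schur_coeff f \<nu> \<noteq> 0 \<Longrightarrow> \<nu> \<in> T"
  shows "restrict_vars n f = (\<Sum>\<nu>\<in>T. cst (schur_coeff f \<nu>) * restrict_vars n (schur \<nu>))"
proof -
  have "restrict_vars n f * vandermonde n = (\<Sum>\<nu>\<in>T. cst (schur_coeff f \<nu>) * alternant n (shifted n \<nu>))"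
    by (rule alternant_expansion[OF assms])
  also have "\<dots> = (\<Sum>\<nu>\<in>T. cst (schur_coeff f \<nu>) * restrict_vars n (schur \<nu>)) * vandermonde n"
    unfolding sum_distrib_right by (rule sum.cong) (simp_all add: restrict_schur_alternant[symmetric] T(2) mult.assoc)
  finally show ?thesis using vandermonde_neq_0 by simp
qed

lemma schur_expansion:
  assumes f: "f \<in> Lam" and T: "finite T" and supp: "\<And>\<nu>. schur_coeff f \<nu> \<noteq> 0 \<Longrightarrow> \<nu> \<in> T"
  shows "f = (\<lambda>a. \<Sum>\<nu>\<in>T. schur_coeff f \<nu> * schur \<nu> a)"
proof (rule Lam_eqI[OF f Lam_sum[OF T schur_Lam_ball]])
  \<comment> \<open>From this threshold on, no partition in \<open>T\<close> is cut off by the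
    restriction.\<close>
  fix n assume n: "Max (insert 0 (len ` T)) \<le> n"
  then have len: "\<And>\<nu>. \<nu> \<in> T \<Longrightarrow> len \<nu> \<le> n" using T by simp
  show "restrict_vars n f = restrict_vars n (\<lambda>a. \<Sum>\<nu>\<in>T. schur_coeff f \<nu> * schur \<nu> a)"
    unfolding restrict_sum[OF T schur_Lam_ball] by (rule schur_expansion_restrict[OF f T len supp])
qed

lemma schur_coeffs_eq:
  assumes f: "f \<in> Lam"
  shows "schur_coeffs f = schur_coeff f"
  unfolding schur_coeffs_def
proof (rule the_equality)
  have fin: "finite {\<nu>. schur_coeff f \<nu> \<noteq> 0}" by (rule finite_schur_coeff_support[OF Lam_bounded_degree[OF f]])
  show "finite {la. schur_coeff f la \<noteq> 0} \<and> f = (\<lambda>a. \<Sum>la | schur_coeff f la \<noteq> 0. schur_coeff f la * schur la a)"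
    using fin schur_expansion[OF f fin] by blast
  fix c assume c: "finite {la. c la \<noteq> 0} \<and> f = (\<lambda>a. \<Sum>la | c la \<noteq> 0. c la * schur la a)"
  show "c = schur_coeff f"
  proof
    fix \<nu>
    have "schur_coeff f \<nu> = (\<Sum>la | c la \<noteq> 0. c la * schur_coeff (schur la) \<nu>)"
      by (subst conjunct2[OF c]) (rule schur_coeff_sum[OF conjunct1[OF c] schur_Lam_ball])
    also have "\<dots> = (\<Sum>la | c la \<noteq> 0. if \<nu> = la then c la else 0)"
      by (rule sum.cong) (auto simp: schur_coeff_schur)
    also have "\<dots> = c \<nu>" by (subst sum.delta'[OF conjunct1[OF c]]) simp
    finally show "c \<nu> = schur_coeff f \<nu>" by simp
  qed
qed

section \<open>The Hall pairing in Schur coordinates\<close>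

lemma hall_eq:
  assumes "f \<in> Lam" "finite T" "\<And>\<nu>. schur_coeff f \<nu> \<noteq> 0 \<Longrightarrow> \<nu> \<in> T"
  shows "hall c f = (\<Sum>\<nu>\<in>T. c \<nu> * schur_coeff f \<nu>)"
  unfolding hall_def schur_coeffs_eq[OF assms(1)]
  by (rule sum.mono_neutral_left) (use assms in auto)

lemma hall_schur: "hall c (schur \<nu>) = c \<nu>"
  by (subst hall_eq[OF schur_Lam, of "{\<nu>}"]) (auto simp: schur_coeff_schur split: if_splits)

lemma hall_sum:
  assumes "finite A" "\<forall>x\<in>A. f x \<in> Lam"
  shows "hall c (\<lambda>a. \<Sum>x\<in>A. d x * f x a) = (\<Sum>x\<in>A. d x * hall c (f x))"
proof -
  let ?T = "\<Union>x\<in>A. {\<nu>. schur_coeff (f x) \<nu> \<noteq> 0}"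
  have fin: "finite ?T" using assms by (auto intro: finite_schur_coeff_support[OF Lam_bounded_degree])
  have "hall c (\<lambda>a. \<Sum>x\<in>A. d x * f x a) = (\<Sum>\<nu>\<in>?T. c \<nu> * (\<Sum>x\<in>A. d x * schur_coeff (f x) \<nu>))"
  proof (subst hall_eq[OF Lam_sum[of A f d, OF assms] fin])
    fix \<nu> assume "schur_coeff (\<lambda>a. \<Sum>x\<in>A. d x * f x a) \<nu> \<noteq> 0"
    then have "(\<Sum>x\<in>A. d x * schur_coeff (f x) \<nu>) \<noteq> 0" unfolding schur_coeff_sum[of A f d, OF assms] .
    then obtain x where "x \<in> A" "d x * schur_coeff (f x) \<nu> \<noteq> 0" by (rule sum.not_neutral_contains_not_neutral)
    then show "\<nu> \<in> ?T" by auto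
  next
    show "(\<Sum>\<nu>\<in>?T. c \<nu> * schur_coeff (\<lambda>a. \<Sum>x\<in>A. d x * f x a) \<nu>) = (\<Sum>\<nu>\<in>?T. c \<nu> * (\<Sum>x\<in>A. d x * schur_coeff (f x) \<nu>))"
      unfolding schur_coeff_sum[of A f d, OF assms] ..
  qed
  also have "\<dots> = (\<Sum>x\<in>A. \<Sum>\<nu>\<in>?T. c \<nu> * (d x * schur_coeff (f x) \<nu>))"
    unfolding sum_distrib_left by (rule sum.swap)
  also have "\<dots> = (\<Sum>x\<in>A. d x * hall c (f x))"
  proof (rule sum.cong)
    fix x assume x: "x \<in> A"
    have "hall c (f x) = (\<Sum>\<nu>\<in>?T. c \<nu> * schur_coeff (f x) \<nu>)"
      by (rule hall_eq[OF bspec[OF assms(2) x] fin]) (use x in auto)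
    then show "(\<Sum>\<nu>\<in>?T. c \<nu> * (d x * schur_coeff (f x) \<nu>)) = d x * hall c (f x)"
      by (simp add: sum_distrib_left mult_ac)
  qed simp
  finally show ?thesis .
qed

section \<open>Unitriangular change of basis\<close>

text \<open>Rows and columns are numbered from 0, so \<open>binom_ser i\<close> = (1 + \<beta> t)^i
  is the series F of row i + 1, and \<open>neg_binom_ser j\<close> = (1 + \<beta> t)^(-j-1) is the
  series E of column j + 1.\<close>

definition binom_ser :: "nat \<Rightarrow> K fps" where
  "binom_ser i = Abs_fps (\<lambda>k. of_nat (i choose k) * \<beta> ^ k)"

definition neg_binom_ser :: "nat \<Rightarrow> K fps" where
  "neg_binom_ser j = Abs_fps (\<lambda>k. (of_int (- int (Suc j)) gchoose k) * \<beta> ^ k)"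

definition one_plus_bX :: "K fps" where
  "one_plus_bX = 1 + fps_const \<beta> * fps_X"

lemma mult_one_plus_bX_nth: "fps_nth (A * one_plus_bX) k = fps_nth A k + (if k = 0 then 0 else \<beta> * fps_nth A (k - 1))"
proof -
  have "A * one_plus_bX = A + fps_const \<beta> * (fps_X * A)" by (simp add: one_plus_bX_def algebra_simps)
  then show ?thesis by (cases k) simp_all
qed

lemma binom_ser_0: "binom_ser 0 = 1"
proof (rule fps_ext)
  fix k show "fps_nth (binom_ser 0) k = fps_nth 1 k" by (cases k) (simp_all add: binom_ser_def)
qed

lemma binom_ser_Suc: "binom_ser (Suc i) = binom_ser i * one_plus_bX"
proof (rule fps_ext)
  fix k show "fps_nth (binom_ser (Suc i)) k = fps_nth (binom_ser i * one_plus_bX) k"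
    unfolding mult_one_plus_bX_nth by (cases k) (simp_all add: binom_ser_def algebra_simps)
qed

lemma binom_ser_eq_power: "binom_ser i = one_plus_bX ^ i"
  by (induction i) (simp_all add: binom_ser_0 binom_ser_Suc mult.commute)

lemma binom_ser_nth_eq_0: "i < k \<Longrightarrow> fps_nth (binom_ser i) k = 0"
  by (simp add: binom_ser_def)

lemma neg_binom_ser_Suc: "neg_binom_ser (Suc j) * one_plus_bX = neg_binom_ser j"
proof (rule fps_ext)
  fix k show "fps_nth (neg_binom_ser (Suc j) * one_plus_bX) k = fps_nth (neg_binom_ser j) k"
    unfolding mult_one_plus_bX_nth
  proof (cases k)
    case (Suc l)
    \<comment> \<open>Writing the upper index -(j + 1) as -(j + 2) + 1 exposes Pascal's rule for
      generalized binomials.\<close>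
    have a: "(of_int (- int (Suc j)) :: K) = of_int (- int (Suc (Suc j))) + 1" by simp
    show "fps_nth (neg_binom_ser (Suc j)) k + (if k = 0 then 0 else \<beta> * fps_nth (neg_binom_ser (Suc j)) (k - 1)) = fps_nth (neg_binom_ser j) k"
      unfolding Suc neg_binom_ser_def fps_nth_Abs_fps a gbinomial_Suc_Suc by (simp add: algebra_simps)
  qed (simp add: neg_binom_ser_def)
qed

lemma neg_binom_ser_0: "neg_binom_ser 0 * one_plus_bX = 1"
proof (rule fps_ext)
  fix k show "fps_nth (neg_binom_ser 0 * one_plus_bX) k = fps_nth 1 k"
    unfolding mult_one_plus_bX_nth
  proof (cases k)
    case (Suc l)
    have "((0::K) gchoose Suc l) = (-1 gchoose l) + (-1 gchoose Suc l)"
      using gbinomial_Suc_Suc[of "-1::K" l] by simp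
    then have "(-1 gchoose Suc l :: K) = - (-1 gchoose l)"
      by (simp add: eq_neg_iff_add_eq_0 add.commute)
    then show "fps_nth (neg_binom_ser 0) k + (if k = 0 then 0 else \<beta> * fps_nth (neg_binom_ser 0) (k - 1)) = fps_nth 1 k"
      by (simp add: Suc neg_binom_ser_def)
  qed (simp add: neg_binom_ser_def)
qed

lemma neg_binom_ser_0_nth: "fps_nth (neg_binom_ser 0) k = (- \<beta>) ^ k"
proof (induction k)
  case (Suc k)
  have "fps_nth (neg_binom_ser 0 * one_plus_bX) (Suc k) = 0" unfolding neg_binom_ser_0 by simp
  then have "fps_nth (neg_binom_ser 0) (Suc k) = - (\<beta> * fps_nth (neg_binom_ser 0) k)"
    unfolding mult_one_plus_bX_nth by (simp add: eq_neg_iff_add_eq_0)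
  then show ?case using Suc by simp
qed (simp add: neg_binom_ser_def)

lemma binom_ser_neg_binom_ser_diag: "binom_ser j * neg_binom_ser j = neg_binom_ser 0"
proof (induction j)
  case (Suc j)
  have "binom_ser (Suc j) * neg_binom_ser (Suc j) = binom_ser j * (neg_binom_ser (Suc j) * one_plus_bX)" by (simp add: binom_ser_Suc mult_ac)
  then show ?case using Suc by (simp add: neg_binom_ser_Suc)
qed (simp add: binom_ser_0)

lemma binom_ser_neg_binom_ser_below: "j < i \<Longrightarrow> binom_ser i * neg_binom_ser j = binom_ser (i - Suc j)"
proof -
  assume "j < i"
  then have i: "i = (i - Suc j) + 1 + j" by simp
  have "binom_ser i * neg_binom_ser j = binom_ser (i - Suc j) * (one_plus_bX * (binom_ser j * neg_binom_ser j))"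
    by (subst i) (simp only: binom_ser_eq_power power_add power_one_right mult_ac)
  also have "\<dots> = binom_ser (i - Suc j)" unfolding binom_ser_neg_binom_ser_diag by (simp add: mult.commute[of one_plus_bX] neg_binom_ser_0)
  finally show ?thesis .
qed

section \<open>Toeplitz-type minors\<close>

lemma fps_znth_mult_sum:
  assumes "q < N"
  shows "fps_znth (A * B) (int q - int p) = (\<Sum>l<N. fps_znth A (int l - int p) * fps_znth B (int q - int l))"
proof (cases "q < p")
  case True
  then have "fps_znth A (int l - int p) * fps_znth B (int q - int l) = 0" for l
    by (cases "l < p") (simp_all add: fps_znth_def)
  then show ?thesis using True by (simp add: fps_znth_def)
next
  case False
  have "(\<Sum>l<N. fps_znth A (int l - int p) * fps_znth B (int q - int l)) = (\<Sum>l\<in>{p..q}. fps_znth A (int l - int p) * fps_znth B (int q - int l))"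
    by (rule sum.mono_neutral_right) (use assms in \<open>auto simp: fps_znth_def\<close>)
  also have "\<dots> = (\<Sum>l=0..q - p. fps_nth A l * fps_nth B (q - p - l))"
    using False by (intro sum.reindex_bij_witness[of _ "\<lambda>l. l + p" "\<lambda>l. l - p"])
      (auto simp: fps_znth_def nat_diff_distrib of_nat_diff intro!: arg_cong2[where f = "(*)"] arg_cong[of _ _ "fps_nth _"])
  also have "\<dots> = fps_znth (A * B) (int q - int p)"
    using False by (simp add: fps_znth_def fps_mult_nth nat_diff_distrib)
  finally show ?thesis by simp
qed

text \<open>For constant \<open>G\<close> this is a minor of an infinite Toeplitz matrix with rows
  and columns selected by \<kappa> and \<sigma>. Series depending only on the row, or only on the
  column, are the two kinds that Cauchy-Binet can multiply.\<close>

definition toeplitz_det :: "nat \<Rightarrow> (nat \<Rightarrow> nat \<Rightarrow> K fps) \<Rightarrow> ptn \<Rightarrow> ptn \<Rightarrow> K" where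
  "toeplitz_det r G \<kappa> \<sigma> = fdet r (\<lambda>i j. fps_znth (G i j) (int (shifted r \<sigma> j) - int (shifted r \<kappa> i)))"

lemma contained_shiftedI:
  assumes "len \<kappa> \<le> r" "\<And>i. i < r \<Longrightarrow> shifted r \<kappa> i \<le> shifted r \<sigma> i"
  shows "contained \<kappa> \<sigma>"
  unfolding contained_def
proof
  fix i show "part \<kappa> i \<le> part \<sigma> i"
    using assms(2)[of i] assms(1) part_eq_0_iff[of \<kappa> i] by (cases "i < r") (auto simp: shifted_def)
qed

lemma contained_refl: "contained p p"
  unfolding contained_def by simp

lemma contained_trans: "contained p q \<Longrightarrow> contained q s \<Longrightarrow> contained p s"
  unfolding contained_def using order_trans by blast

lemma contained_antisym: "contained p q \<Longrightarrow> contained q p \<Longrightarrow> p = q"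
  unfolding contained_def by (intro ptn_eqI order_antisym) auto

lemma contained_len: "contained p q \<Longrightarrow> len p \<le> len q"
  unfolding contained_def len_le_iff by (metis part_eq_0_iff le_zero_eq order_refl)

lemma contained_ptn_box: "contained p q \<Longrightarrow> len q \<le> n \<Longrightarrow> part q 0 \<le> M \<Longrightarrow> p \<in> ptn_box n M"
  using contained_len[of p q] unfolding ptn_box_def contained_def by (auto intro: order_trans)

text \<open>If \<kappa> exceeds \<sigma> in row k, then all entries in rows up to k and columns from
  k on have a negative index. This zero block forces the determinant to vanish, whatever the series
  are.\<close>

lemma toeplitz_det_eq_0:
  assumes "len \<kappa> \<le> r" "\<not> contained \<kappa> \<sigma>"
  shows "toeplitz_det r G \<kappa> \<sigma> = 0"
proof -
  obtain k where k: "k < r" "shifted r \<sigma> k < shifted r \<kappa> k"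
    using contained_shiftedI[of \<kappa> r \<sigma>] assms not_le by blast
  have mono: "shifted r p j \<le> shifted r p i" if "i \<le> j" "j < r" for p i j
    using shifted_strict[of i j r p] that by (cases "i = j") auto
  show ?thesis unfolding toeplitz_det_def
  proof (rule fdet_zero_block[OF k(1)])
    fix i j assume ij: "i \<le> k" "k \<le> j" "j < r"
    have "shifted r \<sigma> j \<le> shifted r \<sigma> k" "shifted r \<kappa> k \<le> shifted r \<kappa> i"
      using mono[of k j \<sigma>] mono[of i k \<kappa>] ij k by auto
    then show "fps_znth (G i j) (int (shifted r \<sigma> j) - int (shifted r \<kappa> i)) = 0" using k(2) by (simp add: fps_znth_def)
  qed
qed

text \<open>Splitting each product coefficient over an intermediate exponent l leaves a factor that
  knows the row and one that knows the column. Cauchy-Binet turns the chosen exponents into the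
  partition \<tau>; exponents beyond the largest one of \<sigma> contribute nothing, so the box is
  large enough.\<close>

lemma toeplitz_det_mult:
  assumes "len \<sigma> \<le> r" "part \<sigma> 0 \<le> M"
  shows "toeplitz_det r (\<lambda>i j. A i * B j) \<kappa> \<sigma> = (\<Sum>\<tau>\<in>ptn_box r M. toeplitz_det r (\<lambda>i j. A i) \<kappa> \<tau> * toeplitz_det r (\<lambda>i j. B j) \<tau> \<sigma>)"
proof -
  have "toeplitz_det r (\<lambda>i j. A i * B j) \<kappa> \<sigma> =
      fdet r (\<lambda>i j. \<Sum>l<M + r. fps_znth (A i) (int l - int (shifted r \<kappa> i)) * fps_znth (B j) (int (shifted r \<sigma> j) - int l))"
    unfolding toeplitz_det_def
  proof (rule fdet_cong)
    fix i j assume "j < r"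
    moreover have "\<sigma> \<in> ptn_box r M" using assms by (simp add: ptn_box_def)
    ultimately have "shifted r \<sigma> j < M + r" by (intro shifted_bound)
    then show "fps_znth (A i * B j) (int (shifted r \<sigma> j) - int (shifted r \<kappa> i)) =
      (\<Sum>l<M + r. fps_znth (A i) (int l - int (shifted r \<kappa> i)) * fps_znth (B j) (int (shifted r \<sigma> j) - int l))"
      by (rule fps_znth_mult_sum)
  qed
  then show ?thesis unfolding cauchy_binet toeplitz_det_def .
qed

text \<open>\<open>Groth_det r\<close> and \<open>Groth_inv_det r\<close> are the matrices a and c
  of the overview, meant for partitions with at most r rows.\<close>

definition Groth_det :: "nat \<Rightarrow> ptn \<Rightarrow> ptn \<Rightarrow> K" where
  "Groth_det r = toeplitz_det r (\<lambda>i j. binom_ser i)"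

definition Groth_inv_det :: "nat \<Rightarrow> ptn \<Rightarrow> ptn \<Rightarrow> K" where
  "Groth_inv_det r = toeplitz_det r (\<lambda>i j. neg_binom_ser j)"

lemma Groth_det_refl: "Groth_det r p p = 1"
proof -
  have "Groth_det r p p = (\<Prod>i<r. fps_znth (binom_ser i) (int (shifted r p i) - int (shifted r p i)))"
    unfolding Groth_det_def toeplitz_det_def
    by (rule fdet_lower_triangular) (simp add: fps_znth_def shifted_strict)
  then show ?thesis by (simp add: fps_znth_def binom_ser_def)
qed

lemma Groth_det_Suc:
  assumes "len p \<le> n" "len q \<le> n"
  shows "Groth_det (Suc n) p q = Groth_det n p q"
proof -
  have z: "part p n = 0" "part q n = 0" using assms by (simp_all add: part_eq_0_iff)
  \<comment> \<open>Transposed, because the added column, not the added row, has the form (0, ...,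
    0, 1).\<close>
  let ?f = "\<lambda>j i. fps_znth (binom_ser i) (int (shifted (Suc n) q j) - int (shifted (Suc n) p i))"
  have "Groth_det (Suc n) p q = fdet (Suc n) ?f"
    unfolding Groth_det_def toeplitz_det_def by (rule fdet_transpose[symmetric])
  also have "\<dots> = ?f n n * fdet n ?f"
    by (rule fdet_last_row) (simp add: fps_znth_def shifted_def z)
  also have "fdet n ?f = fdet n (\<lambda>j i. fps_znth (binom_ser i) (int (shifted n q j) - int (shifted n p i)))"
    by (rule fdet_cong) (simp add: shifted_Suc)
  also have "\<dots> = Groth_det n p q"
    unfolding Groth_det_def toeplitz_det_def by (rule fdet_transpose)
  finally show ?thesis by (simp add: fps_znth_def shifted_def z binom_ser_def)
qed

lemma Groth_det_stable:
  assumes "len p \<le> n" "len q \<le> n" "n \<le> m"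
  shows "Groth_det m p q = Groth_det n p q"
  using assms(3)
proof (induction m rule: dec_induct)
  case (step k)
  then show ?case using Groth_det_Suc[of p k q] assms by simp
qed simp

text \<open>On or below the diagonal the series $(1 + \beta t)^{i-1-j}$ is $(1 + \beta t)^{-1}$ or a polynomial
  of degree less than the index of the entry, so the matrix is upper triangular.\<close>

lemma toeplitz_det_binom_ser_neg_binom_ser:
  assumes "len p \<le> r" "len q \<le> r"
  shows "toeplitz_det r (\<lambda>i j. binom_ser i * neg_binom_ser j) p q = (if contained p q then \<Prod>i<r. (- \<beta>) ^ (part q i - part p i) else 0)"
proof (cases "contained p q")
  case True
  have "toeplitz_det r (\<lambda>i j. binom_ser i * neg_binom_ser j) p q = (\<Prod>i<r. fps_znth (binom_ser i * neg_binom_ser i) (int (shifted r q i) - int (shifted r p i)))"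
    unfolding toeplitz_det_def
  proof (rule fdet_upper_triangular)
    fix i j assume ij: "j < i" "i < r"
    have "part p i \<le> part q j"
      using part_antimono[of j i p] True ij unfolding contained_def by (meson less_imp_le order_trans)
    then have ge: "int (shifted r q j) - int (shifted r p i) \<ge> int i - int j" using ij by (simp add: shifted_def)
    then have "i - Suc j < nat (int (shifted r q j) - int (shifted r p i))" using ij by linarith
    then show "fps_znth (binom_ser i * neg_binom_ser j) (int (shifted r q j) - int (shifted r p i)) = 0"
      unfolding binom_ser_neg_binom_ser_below[OF ij(1)] fps_znth_def by (simp add: binom_ser_nth_eq_0)
  qed
  also have "\<dots> = (\<Prod>i<r. (- \<beta>) ^ (part q i - part p i))"
  proof (rule prod.cong)
    fix i assume "i \<in> {..<r}"
    moreover have "part p i \<le> part q i" using True by (simp add: contained_def)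
    ultimately have "int (shifted r q i) - int (shifted r p i) = int (part q i - part p i)" by (simp add: shifted_def)
    then show "fps_znth (binom_ser i * neg_binom_ser i) (int (shifted r q i) - int (shifted r p i)) = (- \<beta>) ^ (part q i - part p i)"
      by (simp only: fps_znth_def binom_ser_neg_binom_ser_diag neg_binom_ser_0_nth) simp
  qed simp
  finally show ?thesis using True by simp
next
  case False
  then show ?thesis using toeplitz_det_eq_0[OF assms(1)] by simp
qed

section \<open>Rook strips\<close>

text \<open>With at most one box removed per row, the box removed from row i lies in column
  \<open>part mu i - 1\<close>. Two removed boxes share a column exactly when their rows in
  \<open>mu\<close> have equal length.\<close>

lemma rook_strip_iff:
  "rook_strip mu sg \<longleftrightarrow> contained sg mu \<and> (\<forall>i. part mu i \<le> Suc (part sg i)) \<and>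
    (\<forall>i j. part sg i < part mu i \<longrightarrow> part sg j < part mu j \<longrightarrow> part mu i = part mu j \<longrightarrow> i = j)"
    (is "?L \<longleftrightarrow> ?R")
proof
  assume L: ?L
  then have c: "contained sg mu" unfolding rook_strip_def by blast
  have r: "b = c \<or> fst b \<noteq> fst c \<and> snd b \<noteq> snd c"
    if "b \<in> skew_diagram mu sg" "c \<in> skew_diagram mu sg" for b c
    using L that unfolding rook_strip_def by blast
  have "part mu i \<le> Suc (part sg i)" for i
  proof (rule ccontr)
    assume "\<not> ?thesis"
    then show False using r[of "(i, part sg i)" "(i, Suc (part sg i))"] by (simp add: skew_diagram_def)
  qed
  moreover have "i = j" if "part sg i < part mu i" "part sg j < part mu j" "part mu i = part mu j" for i j
    using r[of "(i, part mu i - 1)" "(j, part mu j - 1)"] that by (auto simp: skew_diagram_def)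
  ultimately show ?R using c by blast
next
  assume R: ?R
  have "fst b \<noteq> fst c \<and> snd b \<noteq> snd c"
    if b: "b \<in> skew_diagram mu sg" and c: "c \<in> skew_diagram mu sg" and ne: "b \<noteq> c" for b c
  proof -
    obtain i a j e where bc: "b = (i, a)" "c = (j, e)" by (cases b; cases c)
    have "Suc a = part mu i" "Suc e = part mu j" "part sg i < part mu i" "part sg j < part mu j"
      using b c R[THEN conjunct2, THEN conjunct1, THEN spec, of i] R[THEN conjunct2, THEN conjunct1, THEN spec, of j]
      by (auto simp: bc skew_diagram_def)
    moreover then have "i = j" if "a = e" using R that by (metis)
    ultimately show ?thesis using ne bc by auto
  qed
  then show ?L unfolding rook_strip_def using R by blast
qed

lemma finite_rook_strips: "finite {sg. rook_strip mu sg}"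
  by (rule finite_subset[OF _ finite_ptn_box[of "len mu" "part mu 0"]])
     (auto simp: rook_strip_def intro: contained_ptn_box)

lemma rook_strip_refl: "rook_strip mu mu"
  unfolding rook_strip_iff by (simp add: contained_refl)

lemma card_skew_diagram:
  assumes "len mu \<le> r"
  shows "card (skew_diagram mu sg) = (\<Sum>i<r. part mu i - part sg i)"
proof -
  have "skew_diagram mu sg = (SIGMA i:{..<r}. {part sg i..<part mu i})"
  proof -
    have "i < r" if "j < part mu i" for i j
    proof (rule ccontr)
      assume "\<not> i < r"
      then have "part mu i = 0" using assms by (simp add: part_eq_0_iff)
      then show False using that by simp
    qed
    then show ?thesis unfolding skew_diagram_def by auto
  qed
  then show ?thesis by simp
qed

text \<open>Row i is the lowest one where \<open>mu\<close> exceeds \<open>la\<close>; the rows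
  below are strictly shorter, so its last box is a corner of \<open>mu\<close>. That box may be
  removed or restored without leaving the rook strips over \<open>la\<close>, which supplies the
  sign-reversing involution.\<close>

lemma toggle_corner:
  assumes i: "part la i < part mu i" and max: "\<And>j. i < j \<Longrightarrow> part mu j = part la j"
    and sg: "rook_strip mu sg" "contained la sg"
  obtains sg' where "\<And>j. part sg' j = (if j = i then (if part sg i = part mu i then part mu i - 1 else part mu i) else part sg j)"
    "rook_strip mu sg'" "contained la sg'"
proof -
  define p where "p j = (if j = i then (if part sg i = part mu i then part mu i - 1 else part mu i) else part sg j)" for j
  have R: "\<And>j. part sg j \<le> part mu j" "\<And>j. part mu j \<le> Suc (part sg j)" "\<And>j. part la j \<le> part sg j"
    and inj: "\<And>j k. part sg j < part mu j \<Longrightarrow> part sg k < part mu k \<Longrightarrow> part mu j = part mu k \<Longrightarrow> j = k"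
    using sg unfolding rook_strip_iff contained_def by blast+
  have below: "part mu k < part mu i" if "i < k" for k
    using part_antimono[of i k la] max[OF that] that i by simp
  have pi: "p i \<le> part mu i" "part mu i \<le> Suc (p i)" "part la i \<le> p i" using i by (auto simp: p_def)
  have "p (Suc j) \<le> p j" for j
  proof (cases "j = i")
    case True
    then have "p (Suc j) \<le> part mu (Suc i)" using R(1)[of "Suc i"] by (simp add: p_def)
    then show ?thesis using below[of "Suc i"] pi True by simp
  next
    case False
    show ?thesis
    proof (cases "Suc j = i")
      case True
      \<comment> \<open>Otherwise rows i - 1 and i would both lose a box, and the bound of one box
        per row would put these boxes in the same column.\<close>
      have "part mu i \<le> part sg j"
      proof (rule ccontr)
        assume "\<not> ?thesis"
        then have "part sg j < part mu i" by simp
        moreover have "part mu i \<le> part mu j" using part_antimono[of j i mu] True by simp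
        moreover have "part sg i \<le> part sg j" using part_antimono[of j i sg] True by simp
        ultimately have "j = i" using inj[of j i] R(2)[of j] by linarith
        then show False using False by simp
      qed
      then show ?thesis using pi True False by (simp add: p_def)
    next
      case False
      then show ?thesis using \<open>j \<noteq> i\<close> part_antimono[of j "Suc j" sg] by (simp add: p_def)
    qed
  qed
  then have "antimono p" unfolding antimono_iff_le_Suc by simp
  moreover have "finite {j. p j \<noteq> 0}"
    by (rule finite_subset[OF _ finite.insertI[OF finite_part_support[of sg], of i]]) (auto simp: p_def)
  ultimately have P: "part (Ptn p) = p" by (rule part_Ptn)
  show ?thesis
  proof (rule that[of "Ptn p"])
    show "part (Ptn p) j = (if j = i then (if part sg i = part mu i then part mu i - 1 else part mu i) else part sg j)" for j
      by (simp add: P p_def)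
    show "contained la (Ptn p)"
      unfolding contained_def P using pi(3) R(3) by (auto simp: p_def)
    have "p j \<le> part mu j" "part mu j \<le> Suc (p j)" for j
      using pi R by (cases "j = i", auto simp: p_def)+
    \<comment> \<open>A second removed box in the column of the corner is impossible: a row above is
      at least as long as \<open>part sg i\<close>, which equals \<open>part mu i\<close>, and a row
      below is too short to reach the column.\<close>
    moreover have no: "part mu k \<noteq> part mu i" if "k \<noteq> i" "p i < part mu i" "part sg k < part mu k" for k
    proof
      assume eq: "part mu k = part mu i"
      have sgi: "part sg i = part mu i" using that(2) by (auto simp: p_def split: if_splits)
      show False
      proof (cases "k < i")
        case True
        then show False using part_antimono[of k i sg] sgi eq that(3) by simp
      next
        case False
        then show False using below[of k] that(1) eq by simp
      qed
    qed
    moreover have "j = k" if "p j < part mu j" "p k < part mu k" "part mu j = part mu k" for j k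
      using that inj[of j k] no[of k] no[of j] by (cases "j = i"; cases "k = i") (auto simp: p_def split: if_splits)
    ultimately show "rook_strip mu (Ptn p)" unfolding rook_strip_iff contained_def P by blast
  qed
qed

text \<open>Removing or restoring the lowest corner of $\mu$ outside $\lambda$ changes the sign of a summand.\<close>

lemma rook_strip_moebius:
  assumes "len mu \<le> r"
  shows "(\<Sum>sg | rook_strip mu sg. \<beta> ^ card (skew_diagram mu sg) *
      (if contained la sg then \<Prod>i<r. (- \<beta>) ^ (part sg i - part la i) else 0)) = (if la = mu then 1 else 0)"
proof -
  let ?t = "\<lambda>sg. \<Prod>i<r. \<beta> ^ (part mu i - part sg i) * (- \<beta>) ^ (part sg i - part la i)"
  let ?S = "{sg. rook_strip mu sg \<and> contained la sg}"
  have fin: "finite ?S" by (rule finite_subset[OF _ finite_rook_strips[of mu]]) auto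
  have "(\<Sum>sg | rook_strip mu sg. \<beta> ^ card (skew_diagram mu sg) *
      (if contained la sg then \<Prod>i<r. (- \<beta>) ^ (part sg i - part la i) else 0)) = (\<Sum>sg\<in>?S. ?t sg)"
    by (rule sum.mono_neutral_cong_right[OF finite_rook_strips])
       (auto simp: card_skew_diagram[OF assms] power_sum prod.distrib)
  also have "\<dots> = (if la = mu then 1 else 0)"
  proof (cases "la = mu")
    case True
    have "?S = {mu}"
    proof (intro equalityI subsetI)
      fix sg assume "sg \<in> ?S"
      then have "contained sg mu" "contained mu sg" using True by (simp_all add: rook_strip_def)
      then show "sg \<in> {mu}" using contained_antisym by simp
    qed (simp add: True rook_strip_refl contained_refl)
    then show ?thesis using True by simp
  next
    case False
    have "(\<Sum>sg\<in>?S. ?t sg) = 0"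
    proof (cases "contained la mu")
      case False
      then have "?S = {}" by (auto simp: rook_strip_def dest: contained_trans)
      then show ?thesis by (simp only: sum.empty)
    next
      case c: True
      let ?D = "{i. part la i < part mu i}"
      have D: "i < len mu" if "i \<in> ?D" for i
        using that part_eq_0_iff[of mu i] by (cases "i < len mu") auto
      have finD: "finite ?D" by (rule finite_subset[of _ "{..<len mu}"]) (use D in auto)
      have "?D \<noteq> {}"
      proof
        assume "?D = {}"
        then have "contained mu la" unfolding contained_def by (auto simp: not_less)
        then show False using c \<open>la \<noteq> mu\<close> contained_antisym by blast
      qed
      define i where "i = Max ?D"
      have iD: "part la i < part mu i" using Max_in[OF finD \<open>?D \<noteq> {}\<close>] unfolding i_def by simp
      have max: "part mu j = part la j" if "i < j" for j
      proof -
        have "j \<notin> ?D" using Max_ge[OF finD, of j] that unfolding i_def by auto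
        then show ?thesis using c unfolding contained_def by (simp add: order_antisym)
      qed
      have ir: "i < r" using D[of i] iD assms by simp
      let ?Q = "\<lambda>sg sg'. (\<forall>j. part sg' j = (if j = i then (if part sg i = part mu i then part mu i - 1 else part mu i) else part sg j)) \<and> sg' \<in> ?S"
      have "\<forall>sg\<in>?S. \<exists>sg'. ?Q sg sg'"
      proof
        fix sg assume "sg \<in> ?S"
        then have rs: "rook_strip mu sg" "contained la sg" by auto
        show "\<exists>sg'. ?Q sg sg'"
        proof (rule toggle_corner[OF iD max rs])
          fix sg' assume "\<And>j. part sg' j = (if j = i then (if part sg i = part mu i then part mu i - 1 else part mu i) else part sg j)"
            "rook_strip mu sg'" "contained la sg'"
          then show "\<exists>sg'. ?Q sg sg'" by blast
        qed
      qed
      from bchoice[OF this] obtain tog where tog': "\<forall>sg\<in>?S. ?Q sg (tog sg)" by (rule exE)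
      note tog = bspec[OF tog']
      have cases: "part sg i = part mu i \<or> Suc (part sg i) = part mu i" if "sg \<in> ?S" for sg
      proof -
        have "part sg i \<le> part mu i" "part mu i \<le> Suc (part sg i)"
          using that unfolding rook_strip_iff contained_def by auto
        then show ?thesis by linarith
      qed
      have wit: "tog (tog sg) = sg \<and> tog sg \<in> ?S \<and> - ?t (tog sg) = ?t sg" if sg: "sg \<in> ?S" for sg
      proof (intro conjI)
        note t1 = tog[OF sg]
        note t2 = tog[OF conjunct2[OF t1]]
        show "tog (tog sg) = sg"
        proof (rule ptn_eqI)
          fix j
          show "part (tog (tog sg)) j = part sg j"
            unfolding conjunct1[OF t2, rule_format] conjunct1[OF t1, rule_format]
            using cases[OF sg] iD by auto
        qed
        show "tog sg \<in> ?S" using t1 by blast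
        let ?g = "\<lambda>sg i. \<beta> ^ (part mu i - part sg i) * (- \<beta>) ^ (part sg i - part la i)"
        have split: "(\<Prod>j<r. ?g s j) = ?g s i * (\<Prod>j\<in>{..<r} - {i}. ?g s j)" for s
          using ir by (intro prod.remove) auto
        have rest: "(\<Prod>j\<in>{..<r} - {i}. ?g (tog sg) j) = (\<Prod>j\<in>{..<r} - {i}. ?g sg j)"
          by (rule prod.cong) (simp_all add: conjunct1[OF t1, rule_format])
        \<comment> \<open>The two exponents in row i have a fixed sum; the toggle moves one factor
          between \<beta> and -\<beta>.\<close>
        have "?g (tog sg) i = - ?g sg i"
        proof -
          obtain d where d: "part mu i = Suc (part la i + d)" using iD less_imp_Suc_add by blast
          show ?thesis
            unfolding conjunct1[OF t1, rule_format] using cases[OF sg] by (auto simp: d)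
        qed
        then show "- ?t (tog sg) = ?t sg" unfolding split rest by simp
      qed
      have "(\<Sum>sg\<in>?S. ?t sg) = (\<Sum>sg\<in>?S. - ?t sg)"
        by (rule sum.reindex_bij_witness[of _ tog tog])
           (erule wit[THEN conjunct1] wit[THEN conjunct2, THEN conjunct1] wit[THEN conjunct2, THEN conjunct2])+
      then have "2 * (\<Sum>sg\<in>?S. ?t sg) = 0" by (simp add: sum_negf eq_neg_iff_add_eq_0)
      then show ?thesis by simp
    qed
    then show ?thesis using False by simp
  qed
  finally show ?thesis .
qed

text \<open>The coefficient of s_\<kappa> in g_mu, as the inverse matrix predicts it; the size r is
  any bound on the rows.\<close>

definition dual_g_coeff :: "nat \<Rightarrow> ptn \<Rightarrow> ptn \<Rightarrow> K" where
  "dual_g_coeff r \<kappa> mu = (\<Sum>sg | rook_strip mu sg. \<beta> ^ card (skew_diagram mu sg) * Groth_inv_det r \<kappa> sg)"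

text \<open>Summing over \<kappa> first multiplies a by c and leaves the signed containment matrix,
  which the rook strip sum then inverts.\<close>

lemma Groth_det_dual_g_coeff:
  assumes "len la \<le> r" "len mu \<le> r"
  shows "(\<Sum>\<kappa>\<in>ptn_box r (part mu 0). dual_g_coeff r \<kappa> mu * Groth_det r la \<kappa>) = (if la = mu then 1 else 0)"
proof -
  let ?P = "ptn_box r (part mu 0)"
  have "(\<Sum>\<kappa>\<in>?P. dual_g_coeff r \<kappa> mu * Groth_det r la \<kappa>) =
      (\<Sum>\<kappa>\<in>?P. \<Sum>sg | rook_strip mu sg. \<beta> ^ card (skew_diagram mu sg) * (Groth_det r la \<kappa> * Groth_inv_det r \<kappa> sg))"
    unfolding dual_g_coeff_def sum_distrib_right by (simp only: mult_ac)
  also have "\<dots> = (\<Sum>sg | rook_strip mu sg. \<Sum>\<kappa>\<in>?P. \<beta> ^ card (skew_diagram mu sg) * (Groth_det r la \<kappa> * Groth_inv_det r \<kappa> sg))"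
    by (rule sum.swap)
  also have "\<dots> = (\<Sum>sg | rook_strip mu sg. \<beta> ^ card (skew_diagram mu sg) *
      (if contained la sg then \<Prod>i<r. (- \<beta>) ^ (part sg i - part la i) else 0))"
  proof (rule sum.cong)
    fix sg assume "sg \<in> {sg. rook_strip mu sg}"
    then have c: "contained sg mu" by (simp add: rook_strip_def)
    then have sg: "len sg \<le> r" "part sg 0 \<le> part mu 0"
      using contained_len[OF c] assms unfolding contained_def by auto
    show "(\<Sum>\<kappa>\<in>?P. \<beta> ^ card (skew_diagram mu sg) * (Groth_det r la \<kappa> * Groth_inv_det r \<kappa> sg)) = \<beta> ^ card (skew_diagram mu sg) *
      (if contained la sg then \<Prod>i<r. (- \<beta>) ^ (part sg i - part la i) else 0)"
      unfolding sum_distrib_left[symmetric] Groth_det_def Groth_inv_det_def toeplitz_det_mult[OF sg, symmetric] toeplitz_det_binom_ser_neg_binom_ser[OF assms(1) sg(1)] ..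
  qed simp
  also have "\<dots> = (if la = mu then 1 else 0)" by (rule rook_strip_moebius[OF assms(2)])
  finally show ?thesis .
qed

section \<open>Grothendieck polynomials\<close>

text \<open>The smallest size that accommodates both partitions; stability replaces it by any larger
  one. G_la has terms of unbounded length, so no fixed size would serve.\<close>

definition Groth_coeff :: "ptn \<Rightarrow> ptn \<Rightarrow> K" where
  "Groth_coeff la \<rho> = Groth_det (max (len la) (len \<rho>)) la \<rho>"

lemma Groth_coeff_eq_Groth_det: "len la \<le> n \<Longrightarrow> len \<rho> \<le> n \<Longrightarrow> Groth_coeff la \<rho> = Groth_det n la \<rho>"
  unfolding Groth_coeff_def by (rule Groth_det_stable[symmetric]) auto

lemma Groth_coeff_contained: "Groth_coeff la \<rho> \<noteq> 0 \<Longrightarrow> contained la \<rho>"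
  unfolding Groth_coeff_def Groth_det_def using toeplitz_det_eq_0 by (metis max.cobounded1)

lemma Groth_coeff_refl: "Groth_coeff la la = 1"
  unfolding Groth_coeff_def by (rule Groth_det_refl)

text \<open>The row series are polynomials of degree less than n. If the first part of \<rho>
  exceeds that of \<open>la\<close> by more than n, all of column 0 vanishes. So for bounded length
  only finitely many \<rho> occur, as \<open>Lam_hat\<close> requires.\<close>

lemma Groth_coeff_ptn_box:
  assumes "len la \<le> n" "len \<rho> \<le> n" "Groth_coeff la \<rho> \<noteq> 0"
  shows "\<rho> \<in> ptn_box n (part la 0 + n)"
proof (rule ccontr)
  assume "\<rho> \<notin> ptn_box n (part la 0 + n)"
  then have big: "part la 0 + n < part \<rho> 0" using assms by (simp add: ptn_box_def)
  then have n: "0 < n" using assms(2) part_eq_0_iff[of \<rho> 0] by (cases n) auto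
  have "fdet n (\<lambda>i j. fps_znth (binom_ser i) (int (shifted n \<rho> j) - int (shifted n la i))) = 0"
    unfolding fdet_cols
  proof (rule sum.neutral, rule ballI)
    fix p assume "p \<in> {p. p permutes {..<n}}"
    then have "p 0 < n" using n by (auto intro: permutes_lt)
    moreover from this have "shifted n la (p 0) \<le> part la 0 + n"
      using part_antimono[of 0 "p 0" la] by (simp add: shifted_def)
    ultimately have "p 0 < nat (int (shifted n \<rho> 0) - int (shifted n la (p 0)))"
      using big n by (simp add: shifted_def)
    then have "fps_znth (binom_ser (p 0)) (int (shifted n \<rho> 0) - int (shifted n la (p 0))) = 0"
      unfolding fps_znth_def by (simp add: binom_ser_nth_eq_0)
    then have "(\<Prod>i<n. fps_znth (binom_ser (p i)) (int (shifted n \<rho> i) - int (shifted n la (p i)))) = 0"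
      using n by (intro prod_zero bexI[of _ 0]) auto
    then show "signof p * (\<Prod>i<n. fps_znth (binom_ser (p i)) (int (shifted n \<rho> i) - int (shifted n la (p i)))) = 0" by simp
  qed
  then show False using assms by (simp add: Groth_coeff_eq_Groth_det[of la n] Groth_det_def toeplitz_det_def)
qed

lemma Groth_coeff_Lam_hat: "Groth_coeff la \<in> Lam_hat"
  unfolding Lam_hat_def
proof (rule CollectI, rule allI)
  fix n
  let ?n = "max n (len la)"
  have "{\<rho>. len \<rho> \<le> n \<and> Groth_coeff la \<rho> \<noteq> 0} \<subseteq> ptn_box ?n (part la 0 + ?n)"
    using Groth_coeff_ptn_box[of la ?n] by auto
  then show "finite {\<rho>. len \<rho> \<le> n \<and> Groth_coeff la \<rho> \<noteq> 0}" using finite_ptn_box by (rule finite_subset)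
qed

lemma hat_restrict_superset:
  assumes "finite T" "\<And>\<rho>. \<rho> \<in> T \<Longrightarrow> len \<rho> \<le> n" "\<And>\<rho>. len \<rho> \<le> n \<Longrightarrow> c \<rho> \<noteq> 0 \<Longrightarrow> \<rho> \<in> T"
  shows "hat_restrict n c = (\<Sum>\<rho>\<in>T. cst (c \<rho>) * restrict_vars n (schur \<rho>))"
  unfolding hat_restrict_def by (rule sum.mono_neutral_left) (use assms in auto)

lemma hat_restrict_alternant:
  assumes "finite T" "\<And>\<rho>. \<rho> \<in> T \<Longrightarrow> len \<rho> \<le> n" "\<And>\<rho>. len \<rho> \<le> n \<Longrightarrow> c \<rho> \<noteq> 0 \<Longrightarrow> \<rho> \<in> T"
  shows "hat_restrict n c * vandermonde n = (\<Sum>\<rho>\<in>T. cst (c \<rho>) * alternant n (shifted n \<rho>))"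
proof -
  have "hat_restrict n c = (\<Sum>\<rho>\<in>T. cst (c \<rho>) * restrict_vars n (schur \<rho>))"
    by (rule hat_restrict_superset[OF assms])
  then show ?thesis
    by (simp add: sum_distrib_right) (rule sum.cong, simp_all add: mult.assoc restrict_schur_alternant assms(2))
qed

text \<open>Duality of alternants and leading monomials recovers a formal sum from its restrictions;
  this yields uniqueness in \<open>Lam_hat\<close>.\<close>

lemma hat_restrict_coeff:
  assumes "c \<in> Lam_hat" "len \<nu> \<le> n"
  shows "zcoeff n (hat_restrict n c * vandermonde n) (\<lambda>i. int (shifted n \<nu> i)) = c \<nu>"
proof -
  let ?T = "{\<rho>. len \<rho> \<le> n \<and> c \<rho> \<noteq> 0}"
  have fin: "finite ?T" using assms(1) by (simp add: Lam_hat_def)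
  have "zcoeff n (hat_restrict n c * vandermonde n) (\<lambda>i. int (shifted n \<nu> i)) = (\<Sum>\<rho>\<in>?T. c \<rho> * (if \<rho> = \<nu> then 1 else 0))"
    by (subst hat_restrict_alternant[OF fin]) (auto simp: zcoeff_sum zcoeff_cst_mult zcoeff_alternant_shifted assms(2) intro!: sum.cong)
  also have "\<dots> = (\<Sum>\<rho>\<in>?T. if \<nu> = \<rho> then c \<rho> else 0)" by (rule sum.cong) auto
  also have "\<dots> = c \<nu>" using assms(2) by (auto simp: sum.delta'[OF fin])
  finally show ?thesis .
qed

lemma Lam_hat_eqI:
  assumes "c \<in> Lam_hat" "c' \<in> Lam_hat"
    "\<And>n. N \<le> n \<Longrightarrow> hat_restrict n c * vandermonde n = hat_restrict n c' * vandermonde n"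
  shows "c = c'"
proof
  fix \<nu>
  show "c \<nu> = c' \<nu>"
    using hat_restrict_coeff[OF assms(1), of \<nu> "max N (len \<nu>)"] hat_restrict_coeff[OF assms(2), of \<nu> "max N (len \<nu>)"]
      assms(3)[of "max N (len \<nu>)"] by simp
qed

text \<open>Brings the entry into the shape of a matrix product over exponents l, with the powers of
  x on one side and the scalar coefficients on the other, as Cauchy-Binet needs.\<close>

lemma bialternant_entry:
  assumes "p + j < N"
  shows "x ^ p * (1 + cst \<beta> * x) ^ j = (\<Sum>l<N. x ^ l * cst (fps_znth (binom_ser j) (int l - int p)))"
proof -
  have "(1 + cst \<beta> * x) ^ j = (\<Sum>k\<le>j. cst (fps_nth (binom_ser j) k) * x ^ k)"
  proof -
    have "(cst \<beta> * x + 1) ^ j = (\<Sum>k\<le>j. of_nat (j choose k) * (cst \<beta> * x) ^ k * 1 ^ (j - k))"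
      by (rule binomial_ring)
    also have "\<dots> = (\<Sum>k\<le>j. cst (fps_nth (binom_ser j) k) * x ^ k)"
    proof (rule sum.cong)
      fix k
      have "cst (of_nat (j choose k)) = of_nat (j choose k)"
        using cst_of_int[of "int (j choose k)"] by simp
      then show "of_nat (j choose k) * (cst \<beta> * x) ^ k * 1 ^ (j - k) = cst (fps_nth (binom_ser j) k) * x ^ k"
        by (simp add: binom_ser_def cst_mult cst_power power_mult_distrib mult.assoc)
    qed simp
    finally show ?thesis by (simp add: add.commute)
  qed
  then have "x ^ p * (1 + cst \<beta> * x) ^ j = (\<Sum>k\<le>j. x ^ (p + k) * cst (fps_nth (binom_ser j) k))"
    by (simp add: sum_distrib_left power_add mult_ac)
  also have "\<dots> = (\<Sum>l\<in>{p..p + j}. x ^ l * cst (fps_znth (binom_ser j) (int l - int p)))"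
    by (rule sum.reindex_bij_witness[of _ "\<lambda>l. l - p" "\<lambda>k. p + k"]) (auto simp: fps_znth_def)
  also have "\<dots> = (\<Sum>l<N. x ^ l * cst (fps_znth (binom_ser j) (int l - int p)))"
    by (rule sum.mono_neutral_left) (use assms in \<open>auto simp: fps_znth_def binom_ser_nth_eq_0\<close>)
  finally show ?thesis .
qed

lemma Groth_coeff_bialternant:
  assumes "len la \<le> n"
  shows "hat_restrict n (Groth_coeff la) * vandermonde n =
    fdet n (\<lambda>i j. xvar i ^ shifted n la j * (1 + cst \<beta> * xvar i) ^ j)"
proof -
  let ?M = "part la 0 + n"
  have "fdet n (\<lambda>i j. xvar i ^ shifted n la j * (1 + cst \<beta> * xvar i) ^ j) =
      fdet n (\<lambda>i j. \<Sum>l<?M + n. xvar i ^ l * cst (fps_znth (binom_ser j) (int l - int (shifted n la j))))"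
  proof (rule fdet_cong)
    fix i j assume "j < n"
    then have "shifted n la j + j < ?M + n"
      using part_antimono[of 0 j la] by (simp add: shifted_def)
    then show "xvar i ^ shifted n la j * (1 + cst \<beta> * xvar i) ^ j =
      (\<Sum>l<?M + n. xvar i ^ l * cst (fps_znth (binom_ser j) (int l - int (shifted n la j))))"
      by (rule bialternant_entry)
  qed
  also have "\<dots> = (\<Sum>\<rho>\<in>ptn_box n ?M. alternant n (shifted n \<rho>) * fdet n (\<lambda>k j. cst (fps_znth (binom_ser j) (int (shifted n \<rho> k) - int (shifted n la j)))))"
    unfolding cauchy_binet alternant_def ..
  also have "\<dots> = (\<Sum>\<rho>\<in>ptn_box n ?M. cst (Groth_coeff la \<rho>) * alternant n (shifted n \<rho>))"
  proof (rule sum.cong)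
    fix \<rho> assume "\<rho> \<in> ptn_box n ?M"
    then have "Groth_coeff la \<rho> = fdet n (\<lambda>i j. fps_znth (binom_ser i) (int (shifted n \<rho> j) - int (shifted n la i)))"
      using assms by (simp add: Groth_coeff_eq_Groth_det[of la n] ptn_box_def Groth_det_def toeplitz_det_def)
    also have "\<dots> = fdet n (\<lambda>k j. fps_znth (binom_ser j) (int (shifted n \<rho> k) - int (shifted n la j)))"
      by (rule fdet_transpose[symmetric])
    finally show "alternant n (shifted n \<rho>) * fdet n (\<lambda>k j. cst (fps_znth (binom_ser j) (int (shifted n \<rho> k) - int (shifted n la j)))) = cst (Groth_coeff la \<rho>) * alternant n (shifted n \<rho>)"
      by (simp add: cst_fdet mult.commute)
  qed simp
  also have "\<dots> = hat_restrict n (Groth_coeff la) * vandermonde n"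
    by (rule hat_restrict_alternant[symmetric]) (use Groth_coeff_ptn_box[OF assms] finite_ptn_box in \<open>auto simp: ptn_box_def\<close>)
  finally show ?thesis by simp
qed

theorem Groth_eq: "Groth la = Groth_coeff la"
proof -
  have det: "det (mat n n (\<lambda>(i, j). xvar i ^ (part la j + n - Suc j) * (1 + cst \<beta> * xvar i) ^ j)) =
    fdet n (\<lambda>i j. xvar i ^ shifted n la j * (1 + cst \<beta> * xvar i) ^ j)" for n
    unfolding fdet_def shifted_def ..
  show ?thesis unfolding Groth_def det
  proof (rule the_equality)
    show "Groth_coeff la \<in> Lam_hat \<and> (\<forall>n\<ge>len la. hat_restrict n (Groth_coeff la) * vandermonde n =
      fdet n (\<lambda>i j. xvar i ^ shifted n la j * (1 + cst \<beta> * xvar i) ^ j))"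
      using Groth_coeff_Lam_hat Groth_coeff_bialternant by blast
    fix c assume c: "c \<in> Lam_hat \<and> (\<forall>n\<ge>len la. hat_restrict n c * vandermonde n =
      fdet n (\<lambda>i j. xvar i ^ shifted n la j * (1 + cst \<beta> * xvar i) ^ j))"
    show "c = Groth_coeff la"
      by (rule Lam_hat_eqI[OF conjunct1[OF c] Groth_coeff_Lam_hat, of "len la"]) (use c Groth_coeff_bialternant in auto)
  qed
qed

text \<open>G_\<nu> is s_\<nu> plus terms for strictly larger partitions. At a partition \<nu> of
  maximal size where the Schur coefficients of f and g differ, pairing with G_\<nu> sees only that
  difference.\<close>

lemma hall_Groth_injective:
  assumes "f \<in> Lam" "g \<in> Lam" "\<And>la. hall (Groth_coeff la) f = hall (Groth_coeff la) g"
  shows "f = g"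
proof -
  let ?N = "{\<nu>. schur_coeff f \<nu> \<noteq> 0} \<union> {\<nu>. schur_coeff g \<nu> \<noteq> 0}"
  have fin: "finite ?N" using finite_schur_coeff_support[OF Lam_bounded_degree] assms by auto
  let ?D = "{\<nu> \<in> ?N. schur_coeff f \<nu> \<noteq> schur_coeff g \<nu>}"
  have "?D = {}"
  proof (rule ccontr)
    assume ne: "?D \<noteq> {}"
    have finD: "finite ?D" using fin by (rule finite_subset[rotated]) auto
    let ?sz = "\<lambda>\<nu>. \<Sum>i<len \<nu>. part \<nu> i"
    obtain \<nu> where \<nu>: "\<nu> \<in> ?D" "\<And>\<kappa>. \<kappa> \<in> ?D \<Longrightarrow> ?sz \<kappa> \<le> ?sz \<nu>"
    proof -
      have "Max (?sz ` ?D) \<in> ?sz ` ?D" using finD ne by (intro Max_in) blast+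
      then obtain \<nu> where "\<nu> \<in> ?D" "Max (?sz ` ?D) = ?sz \<nu>" by (rule imageE)
      moreover have "?sz \<kappa> \<le> Max (?sz ` ?D)" if "\<kappa> \<in> ?D" for \<kappa>
        using finD that by (intro Max_ge) blast+
      ultimately show ?thesis using that by (metis (no_types, lifting))
    qed
    have bigger: "?sz \<nu> < ?sz \<kappa>" if "contained \<nu> \<kappa>" "\<nu> \<noteq> \<kappa>" for \<kappa>
    proof -
      have eq: "?sz \<nu> = (\<Sum>i<len \<kappa>. part \<nu> i)"
        by (rule sum.mono_neutral_left) (use contained_len[OF that(1)] in \<open>auto simp: part_eq_0_iff\<close>)
      have "\<not> contained \<kappa> \<nu>" using that contained_antisym[of \<nu> \<kappa>] by blast
      then obtain i where i: "part \<nu> i < part \<kappa> i"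
        unfolding contained_def by (auto simp: not_le)
      then have "i < len \<kappa>" using part_eq_0_iff[of \<kappa> i] by (cases "i < len \<kappa>") auto
      then have "(\<Sum>i<len \<kappa>. part \<nu> i) < (\<Sum>i<len \<kappa>. part \<kappa> i)"
        using i that(1) by (intro sum_strict_mono_ex1) (auto simp: contained_def)
      then show ?thesis using eq by simp
    qed
    have "(\<Sum>\<kappa>\<in>?N. Groth_coeff \<nu> \<kappa> * (schur_coeff f \<kappa> - schur_coeff g \<kappa>)) = hall (Groth_coeff \<nu>) f - hall (Groth_coeff \<nu>) g"
      by (subst (1 2) hall_eq[OF _ fin]) (auto simp: assms sum_subtractf right_diff_distrib)
    then have "(\<Sum>\<kappa>\<in>?N. Groth_coeff \<nu> \<kappa> * (schur_coeff f \<kappa> - schur_coeff g \<kappa>)) = 0" using assms(3) by simp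
    moreover have "(\<Sum>\<kappa>\<in>?N. Groth_coeff \<nu> \<kappa> * (schur_coeff f \<kappa> - schur_coeff g \<kappa>)) = (\<Sum>\<kappa>\<in>{\<nu>}. Groth_coeff \<nu> \<kappa> * (schur_coeff f \<kappa> - schur_coeff g \<kappa>))"
    proof (rule sum.mono_neutral_right[OF fin])
      show "\<forall>\<kappa>\<in>?N - {\<nu>}. Groth_coeff \<nu> \<kappa> * (schur_coeff f \<kappa> - schur_coeff g \<kappa>) = 0"
      proof (rule ballI, rule ccontr)
        fix \<kappa> assume \<kappa>: "\<kappa> \<in> ?N - {\<nu>}" and nz: "Groth_coeff \<nu> \<kappa> * (schur_coeff f \<kappa> - schur_coeff g \<kappa>) \<noteq> 0"
        then have "contained \<nu> \<kappa>" "\<kappa> \<in> ?D" using Groth_coeff_contained[of \<nu> \<kappa>] by auto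
        then show False using bigger[of \<kappa>] \<nu>(2)[of \<kappa>] \<kappa> by simp
      qed
    qed (use \<nu>(1) in auto)
    ultimately show False using \<nu>(1) by (simp add: Groth_coeff_refl)
  qed
  have eq: "schur_coeff f = schur_coeff g"
  proof
    fix \<nu> show "schur_coeff f \<nu> = schur_coeff g \<nu>"
    proof (rule ccontr)
      assume "schur_coeff f \<nu> \<noteq> schur_coeff g \<nu>"
      then have "\<nu> \<in> ?D" by auto
      then show False unfolding \<open>?D = {}\<close> by simp
    qed
  qed
  show ?thesis
    using schur_expansion[OF assms(1) fin] schur_expansion[OF assms(2) fin] unfolding eq by auto
qed

text \<open>Unitriangularity gives uniqueness, the inverse matrix gives the witness. The size r
  stays free so that it can later be matched with that of the determinant in the theorem.\<close>

theorem dual_g_eq: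
  assumes "len mu \<le> r"
  shows "dual_g mu = (\<lambda>a. \<Sum>\<kappa>\<in>ptn_box r (part mu 0). dual_g_coeff r \<kappa> mu * schur \<kappa> a)"
    and "dual_g mu \<in> Lam"
proof -
  let ?f = "\<lambda>a. \<Sum>\<kappa>\<in>ptn_box r (part mu 0). dual_g_coeff r \<kappa> mu * schur \<kappa> a"
  have L: "?f \<in> Lam" by (rule Lam_sum[OF finite_ptn_box schur_Lam_ball])
  have hall: "hall (Groth_coeff la) ?f = (if la = mu then 1 else 0)" for la
  proof -
    have "hall (Groth_coeff la) ?f = (\<Sum>\<kappa>\<in>ptn_box r (part mu 0). dual_g_coeff r \<kappa> mu * Groth_coeff la \<kappa>)"
      unfolding hall_sum[OF finite_ptn_box schur_Lam_ball] hall_schur ..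
    also have "\<dots> = (if la = mu then 1 else 0)"
    proof (cases "len la \<le> r")
      case True
      have "(\<Sum>\<kappa>\<in>ptn_box r (part mu 0). dual_g_coeff r \<kappa> mu * Groth_coeff la \<kappa>) = (\<Sum>\<kappa>\<in>ptn_box r (part mu 0). dual_g_coeff r \<kappa> mu * Groth_det r la \<kappa>)"
        by (rule sum.cong) (auto simp: ptn_box_def Groth_coeff_eq_Groth_det[OF True])
      then show ?thesis using Groth_det_dual_g_coeff[OF True assms] by simp
    next
      case False
      \<comment> \<open>A partition \<open>la\<close> with more than r rows is not contained in any
        \<kappa> of the box, so every term vanishes.\<close>
      have "dual_g_coeff r \<kappa> mu * Groth_coeff la \<kappa> = 0" if "\<kappa> \<in> ptn_box r (part mu 0)" for \<kappa>
        using Groth_coeff_contained[of la \<kappa>] contained_len[of la \<kappa>] that False by (auto simp: ptn_box_def)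
      then show ?thesis using False assms by (auto intro!: sum.neutral)
    qed
    finally show ?thesis .
  qed
  show "dual_g mu = ?f" unfolding dual_g_def Groth_eq
  proof (rule the_equality)
    show "?f \<in> Lam \<and> (\<forall>la. hall (Groth_coeff la) ?f = (if la = mu then 1 else 0))" using L hall by blast
    fix f assume f: "f \<in> Lam \<and> (\<forall>la. hall (Groth_coeff la) f = (if la = mu then 1 else 0))"
    show "f = ?f" by (rule hall_Groth_injective) (use f L hall in auto)
  qed
  then show "dual_g mu \<in> Lam" using L by simp
qed

section \<open>Multiplication by Schur functions and its adjoint\<close>

lemma h_eq_sum: "h n (int k) = (\<Sum>a\<in>{a. keys a \<subseteq> {..<n} \<and> mdeg a = k}. single a 1)"
proof (rule poly_mapping_eqI)
  fix b
  have fin: "finite {a. keys a \<subseteq> {..<n} \<and> mdeg a = k}"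
    by (rule finite_subset[OF _ finite_monoms[of n k]]) auto
  have "lookup (\<Sum>a\<in>{a. keys a \<subseteq> {..<n} \<and> mdeg a = k}. single a (1::K)) b =
      (\<Sum>a\<in>{a. keys a \<subseteq> {..<n} \<and> mdeg a = k}. if b = a then 1 else 0)"
    unfolding Poly_Mapping.lookup_sum by (rule sum.cong) (auto simp: Poly_Mapping.lookup_single when_def)
  also have "\<dots> = lookup (h n (int k)) b"
    by (subst sum.delta'[OF fin]) (simp add: lookup_h)
  finally show "lookup (h n (int k)) b = lookup (\<Sum>a\<in>{a. keys a \<subseteq> {..<n} \<and> mdeg a = k}. single a (1::K)) b" ..
qed

lemma prod_single: "finite A \<Longrightarrow> (\<Prod>i\<in>A. single (g i) (1::K)) = single (\<Sum>i\<in>A. g i :: monom) 1"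
  by (induction A rule: finite_induct) (simp_all add: Poly_Mapping.mult_single)

text \<open>The coefficient of $x^c$ in $h_{b_1} \cdots h_{b_n}$ counts the nonnegative integer matrices
  with row sums $b$ and column sums $c$; a matrix is encoded by its rows as monomials.\<close>

definition margin_mats :: "nat \<Rightarrow> (nat \<Rightarrow> nat) \<Rightarrow> (nat \<Rightarrow> nat) \<Rightarrow> (nat \<Rightarrow> monom) set" where
  "margin_mats n b c = {g \<in> PiE {..<n} (\<lambda>i. {a. keys a \<subseteq> {..<n} \<and> mdeg a = b i}). (\<Sum>i<n. g i) = monom_of n c}"

lemma lookup_prod_h: "lookup (\<Prod>i<n. h n (int (b i))) (monom_of n c) = of_nat (card (margin_mats n b c))"
proof -
  let ?D = "\<lambda>i. {a. keys a \<subseteq> {..<n} \<and> mdeg a = b i}"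
  have finD: "finite (?D i)" for i
    by (rule finite_subset[OF _ finite_monoms[of n "b i"]]) auto
  have fin: "finite (PiE {..<n} ?D)" by (rule finite_PiE) (use finD in auto)
  have "(\<Prod>i<n. h n (int (b i))) = (\<Sum>g\<in>PiE {..<n} ?D. \<Prod>i<n. single (g i) 1)"
    unfolding h_eq_sum by (rule prod_sum_PiE) (use finD in auto)
  also have "\<dots> = (\<Sum>g\<in>PiE {..<n} ?D. single (\<Sum>i<n. g i) 1)"
    by (simp add: prod_single)
  finally have "lookup (\<Prod>i<n. h n (int (b i))) (monom_of n c) =
      (\<Sum>g\<in>PiE {..<n} ?D. if (\<Sum>i<n. g i) = monom_of n c then 1 else 0)"
    by (simp add: Poly_Mapping.lookup_sum Poly_Mapping.lookup_single when_def)
  also have "\<dots> = (\<Sum>g\<in>margin_mats n b c. 1)"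
    unfolding margin_mats_def by (subst sum.inter_filter[OF fin]) simp
  finally show ?thesis by simp
qed

definition margin_transpose :: "nat \<Rightarrow> (nat \<Rightarrow> monom) \<Rightarrow> nat \<Rightarrow> monom" where
  "margin_transpose n g = restrict (\<lambda>j. monom_of n (\<lambda>i. lookup (g i) j)) {..<n}"

lemma margin_transpose_margin_mats:
  assumes "g \<in> margin_mats n b c"
  shows "margin_transpose n g \<in> margin_mats n c b" "margin_transpose n (margin_transpose n g) = g"
proof -
  have g: "\<And>i. i < n \<Longrightarrow> keys (g i) \<subseteq> {..<n}" "\<And>i. i < n \<Longrightarrow> mdeg (g i) = b i"
    "(\<Sum>i<n. g i) = monom_of n c" and ext: "\<And>i. \<not> i < n \<Longrightarrow> g i = undefined"
    using assms unfolding margin_mats_def by (auto simp: PiE_def extensional_def Pi_def)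
  have col: "(\<Sum>i<n. lookup (g i) j) = (if j < n then c j else 0)" for j
    using arg_cong[OF g(3), of "\<lambda>m. lookup m j"] by (simp add: Poly_Mapping.lookup_sum lookup_monom_of)
  have row: "(\<Sum>j<n. lookup (g i) j) = b i" if "i < n" for i
    using g(1,2)[OF that] mdeg_superset[of "{..<n}" "g i"] by simp
  have "(\<Sum>j<n. margin_transpose n g j) = monom_of n b"
  proof (rule poly_mapping_eqI)
    fix i
    have "lookup (\<Sum>j<n. margin_transpose n g j) i = (\<Sum>j<n. if i < n then lookup (g i) j else 0)"
      unfolding Poly_Mapping.lookup_sum by (rule sum.cong) (simp_all add: margin_transpose_def lookup_monom_of)
    then show "lookup (\<Sum>j<n. margin_transpose n g j) i = lookup (monom_of n b) i"
      by (simp add: row lookup_monom_of)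
  qed
  moreover have "margin_transpose n g \<in> PiE {..<n} (\<lambda>i. {a. keys a \<subseteq> {..<n} \<and> mdeg a = c i})"
    unfolding margin_transpose_def restrict_PiE_iff using col keys_monom_of[of n] by (simp add: mdeg_monom_of)
  ultimately show "margin_transpose n g \<in> margin_mats n c b" unfolding margin_mats_def by blast
  show "margin_transpose n (margin_transpose n g) = g"
  proof
    fix i
    show "margin_transpose n (margin_transpose n g) i = g i"
    proof (cases "i < n")
      case True
      then have "margin_transpose n (margin_transpose n g) i = monom_of n (\<lambda>j. lookup (margin_transpose n g j) i)"
        by (simp add: margin_transpose_def)
      also have "\<dots> = monom_of n (lookup (g i))"
        by (rule monom_of_cong) (simp add: margin_transpose_def lookup_monom_of True)
      finally show ?thesis using g(1)[OF True] by (simp add: monom_of_lookup)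
    qed (simp add: margin_transpose_def ext)
  qed
qed

lemma card_margin_mats: "card (margin_mats n b c) = card (margin_mats n c b)"
proof -
  have "(\<Sum>g\<in>margin_mats n b c. 1::nat) = (\<Sum>g\<in>margin_mats n c b. 1)"
    by (rule sum.reindex_bij_witness[of _ "margin_transpose n" "margin_transpose n"]) (simp_all add: margin_transpose_margin_mats)
  then show ?thesis by simp
qed

text \<open>Transposing the integer matrices exchanges row sums and column sums. A negative entry of
  b or c kills one side through h_p = 0 and the other through the default value of
  \<open>zcoeff\<close>.\<close>

lemma zcoeff_prod_h_symmetric:
  "zcoeff n (\<Prod>i<n. h n (b i)) c = zcoeff n (\<Prod>i<n. h n (c i)) b"
proof -
  have neg: "zcoeff n (\<Prod>i<n. h n (b i)) c = 0 \<and> zcoeff n (\<Prod>i<n. h n (c i)) b = 0"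
    if ex: "\<exists>i<n. b i < 0" for b c
  proof -
    obtain i where i: "i < n" "b i < 0" using ex by blast
    then have 1: "(\<Prod>i<n. h n (b i)) = 0" by (intro prod_zero bexI[of _ i]) (auto simp: h_neg)
    have "\<not> (\<forall>i<n. 0 \<le> b i)" using i by auto
    then have "zcoeff n f b = 0" for f unfolding zcoeff_def by (rule if_not_P)
    then show ?thesis unfolding 1 by simp
  qed
  show ?thesis
  proof (cases "(\<exists>i<n. b i < 0) \<or> (\<exists>i<n. c i < 0)")
    case True
    then show ?thesis
    proof
      assume "\<exists>i<n. b i < 0"
      from neg[OF this, of c] show ?thesis by simp
    next
      assume "\<exists>i<n. c i < 0"
      from neg[OF this, of b] show ?thesis by simp
    qed
  next
    case False
    then have "0 \<le> b i \<and> 0 \<le> c i" if "i < n" for i using that by (meson not_less)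
    then have bc: "\<And>i. i < n \<Longrightarrow> b i = int (nat (b i))" "\<And>i. i < n \<Longrightarrow> c i = int (nat (c i))"
      by simp_all
    have "zcoeff n (\<Prod>i<n. h n (b i)) c = zcoeff n (\<Prod>i<n. h n (int (nat (b i)))) (\<lambda>i. int (nat (c i)))"
    proof -
      have "(\<Prod>i<n. h n (b i)) = (\<Prod>i<n. h n (int (nat (b i))))"
        by (rule prod.cong) (use bc(1) in auto)
      moreover have "zcoeff n f c = zcoeff n f (\<lambda>i. int (nat (c i)))" for f
        by (rule zcoeff_cong) (rule bc(2))
      ultimately show ?thesis by simp
    qed
    also have "\<dots> = zcoeff n (\<Prod>i<n. h n (int (nat (c i)))) (\<lambda>i. int (nat (b i)))"
      unfolding zcoeff_nat lookup_prod_h card_margin_mats[of n "\<lambda>i. nat (b i)"] ..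
    also have "\<dots> = zcoeff n (\<Prod>i<n. h n (c i)) b"
    proof -
      have "(\<Prod>i<n. h n (c i)) = (\<Prod>i<n. h n (int (nat (c i))))"
        by (rule prod.cong) (use bc(2) in auto)
      moreover have "zcoeff n f b = zcoeff n f (\<lambda>i. int (nat (b i)))" for f
        by (rule zcoeff_cong) (rule bc(1))
      ultimately show ?thesis by simp
    qed
    finally show ?thesis .
  qed
qed

lemma fdet_expand_cst: "fdet n f = (\<Sum>p | p permutes {..<n}. cst (signof p) * (\<Prod>i<n. f i (p i)))" for f :: "nat \<Rightarrow> nat \<Rightarrow> kpoly"
  unfolding fdet_rows by (simp add: cst_of_int)

text \<open>Since $s_\kappa$ times the Vandermonde product is an alternant, both sides are signed sums of
  coefficients of products of the $h_m$, matched by the symmetry of these coefficients.\<close>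

theorem schur_product_coeff:
  assumes "len \<nu> \<le> n" "len \<kappa> \<le> n" "len \<rho> \<le> n"
  shows "schur_coeff (series_mult (schur \<kappa>) (schur \<nu>)) \<rho> = zcoeff n (skew_jt n n \<rho> \<kappa> * vandermonde n) (\<lambda>i. int (shifted n \<nu> i))"
proof -
  have b: "bounded_degree (schur \<kappa>)" "bounded_degree (schur \<nu>)" by (rule Lam_bounded_degree[OF schur_Lam])+
  define w where "w = (\<lambda>p i. int (shifted n \<rho> i) - int (shifted n \<kappa> (p i)))"
  define v where "v = (\<lambda>q i. int (shifted n \<nu> i) - int (n - Suc (q i)))"
  have s: "restrict_vars n (schur \<nu>) = (\<Sum>q | q permutes {..<n}. cst (signof q) * (\<Prod>i<n. h n (v q i)))"
    unfolding restrict_schur[OF assms(1)] skew_jt_def shifted_empty_ptn fdet_expand_cst v_def ..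
  have "schur_coeff (series_mult (schur \<kappa>) (schur \<nu>)) \<rho> =
      zcoeff n (restrict_vars n (schur \<kappa>) * restrict_vars n (schur \<nu>) * vandermonde n) (\<lambda>i. int (shifted n \<rho> i))"
    unfolding schur_coeff_eq[OF bounded_degree_series_mult[OF b] assms(3)] restrict_series_mult[OF b] ..
  also have "restrict_vars n (schur \<kappa>) * restrict_vars n (schur \<nu>) * vandermonde n = restrict_vars n (schur \<nu>) * alternant n (shifted n \<kappa>)"
    unfolding restrict_schur_alternant[OF assms(2), symmetric] by (simp only: mult_ac)
  also have "zcoeff n (restrict_vars n (schur \<nu>) * alternant n (shifted n \<kappa>)) (\<lambda>i. int (shifted n \<rho> i)) =
      (\<Sum>p | p permutes {..<n}. signof p * zcoeff n (restrict_vars n (schur \<nu>)) (w p))"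
    unfolding w_def by (rule zcoeff_mult_alternant)
  also have "\<dots> = (\<Sum>p | p permutes {..<n}. signof p * zcoeff n ((\<Prod>i<n. h n (w p i)) * vandermonde n) (\<lambda>i. int (shifted n \<nu> i)))"
  proof (rule sum.cong)
    fix p
    have "zcoeff n (restrict_vars n (schur \<nu>)) (w p) =
        (\<Sum>q | q permutes {..<n}. signof q * zcoeff n (\<Prod>i<n. h n (v q i)) (w p))"
      unfolding s zcoeff_sum zcoeff_cst_mult ..
    also have "\<dots> = (\<Sum>q | q permutes {..<n}. signof q * zcoeff n (\<Prod>i<n. h n (w p i)) (v q))"
      by (simp only: zcoeff_prod_h_symmetric[of n "v _" "w p"])
    also have "\<dots> = zcoeff n ((\<Prod>i<n. h n (w p i)) * vandermonde n) (\<lambda>i. int (shifted n \<nu> i))"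
      unfolding alternant_delta[symmetric] zcoeff_mult_alternant v_def ..
    finally show "signof p * zcoeff n (restrict_vars n (schur \<nu>)) (w p) =
      signof p * zcoeff n ((\<Prod>i<n. h n (w p i)) * vandermonde n) (\<lambda>i. int (shifted n \<nu> i))" by simp
  qed simp
  also have "\<dots> = zcoeff n (skew_jt n n \<rho> \<kappa> * vandermonde n) (\<lambda>i. int (shifted n \<nu> i))"
    unfolding skew_jt_def fdet_expand_cst sum_distrib_right zcoeff_sum mult.assoc zcoeff_cst_mult w_def ..
  finally show ?thesis .
qed

section \<open>Skew Schur functions and the effect of finitely many variables\<close>

definition skew_schur :: "ptn \<Rightarrow> ptn \<Rightarrow> kseries" where
  "skew_schur \<rho> \<kappa> = (SOME f. f \<in> Lam \<and> (\<forall>n. restrict_vars n f = skew_jt n (max (len \<rho>) (len \<kappa>)) \<rho> \<kappa>))"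

lemma skew_schur_props: "skew_schur \<rho> \<kappa> \<in> Lam \<and> (\<forall>n. restrict_vars n (skew_schur \<rho> \<kappa>) = skew_jt n (max (len \<rho>) (len \<kappa>)) \<rho> \<kappa>)"
proof -
  have "\<exists>f. f \<in> Lam \<and> (\<forall>n. restrict_vars n f = skew_jt n (max (len \<rho>) (len \<kappa>)) \<rho> \<kappa>)"
    using stable_family_skew_jt[of "max (len \<rho>) (len \<kappa>)" \<rho> \<kappa>] unfolding stable_family_def by blast
  then show ?thesis unfolding skew_schur_def by (rule someI_ex)
qed

lemma skew_schur_Lam: "skew_schur \<rho> \<kappa> \<in> Lam"
  using skew_schur_props by blast

lemma restrict_skew_schur: "len \<rho> \<le> r \<Longrightarrow> len \<kappa> \<le> r \<Longrightarrow> restrict_vars n (skew_schur \<rho> \<kappa>) = skew_jt n r \<rho> \<kappa>"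
  using skew_schur_props[of \<rho> \<kappa>] skew_jt_stable[of \<rho> "max (len \<rho>) (len \<kappa>)" \<kappa> r n] by simp

text \<open>The adjointness of s_\<rho> -> s_{\<rho>/\<kappa>} and multiplication by s_\<kappa>,
  freed from the number of variables by taking enough of them for all three partitions.\<close>

lemma schur_coeff_skew_schur: "schur_coeff (skew_schur \<rho> \<kappa>) \<nu> = schur_coeff (series_mult (schur \<kappa>) (schur \<nu>)) \<rho>"
proof -
  let ?n = "max (len \<nu>) (max (len \<kappa>) (len \<rho>))"
  have "schur_coeff (skew_schur \<rho> \<kappa>) \<nu> = zcoeff ?n (restrict_vars ?n (skew_schur \<rho> \<kappa>) * vandermonde ?n) (\<lambda>i. int (shifted ?n \<nu> i))"
    by (rule schur_coeff_eq[OF Lam_bounded_degree[OF skew_schur_Lam]]) simp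
  also have "\<dots> = schur_coeff (series_mult (schur \<kappa>) (schur \<nu>)) \<rho>"
    by (subst restrict_skew_schur[of _ ?n]) (simp_all add: schur_product_coeff[of \<nu> ?n \<kappa> \<rho>])
  finally show ?thesis .
qed

text \<open>In $m$ variables the $h_k$ satisfy a recurrence of length $m+1$, which gives a linear relation
  between the last $m+1$ columns.\<close>

lemma skew_jt_vanish:
  assumes "len \<kappa> + m < len \<rho>"
  shows "skew_jt m (len \<rho>) \<rho> \<kappa> = 0"
  unfolding skew_jt_def
proof (rule fdet_eq_0_kernel)
  let ?R = "len \<rho>" and ?Q = "e_series {..<m}"
  show "?R - 1 < ?R" using assms by simp
  show "fps_nth ?Q (?R - Suc (?R - 1)) \<noteq> 0" by (simp add: e_series_nth_0)
  fix i assume i: "i < ?R"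
  have "(\<Sum>j<?R. h m (int (shifted ?R \<rho> i) - int (shifted ?R \<kappa> j)) * fps_nth ?Q (?R - Suc j)) =
      (\<Sum>j<?R. fps_nth ?Q (?R - Suc j) * fps_znth (h_series m) (int (shifted ?R \<rho> i) - int (?R - Suc j)))"
  proof (rule sum.cong)
    fix j assume j: "j \<in> {..<?R}"
    show "h m (int (shifted ?R \<rho> i) - int (shifted ?R \<kappa> j)) * fps_nth ?Q (?R - Suc j) =
      fps_nth ?Q (?R - Suc j) * fps_znth (h_series m) (int (shifted ?R \<rho> i) - int (?R - Suc j))"
    \<comment> \<open>For these columns the coefficient index exceeds m, so the kernel vector
      vanishes there. In the remaining columns \<kappa> has zero parts and the indices run down by
      one, as in the recurrence.\<close>
    proof (cases "j < len \<kappa>")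
      case True
      then have "fps_nth ?Q (?R - Suc j) = 0"
        using assms by (intro e_series_nth_eq_0) auto
      then show ?thesis by simp
    next
      case False
      then have "shifted ?R \<kappa> j = ?R - Suc j" by (simp add: shifted_def part_eq_0_iff[THEN iffD2])
      then show ?thesis by (simp add: h_h_series mult.commute)
    qed
  qed simp
  also have "\<dots> = (\<Sum>k<?R. fps_nth ?Q k * fps_znth (h_series m) (int (shifted ?R \<rho> i) - int k))"
    by (rule sum.nat_diff_reindex)
  also have "\<dots> = fps_znth (h_series m * ?Q) (int (shifted ?R \<rho> i))"
    by (rule fps_znth_mult_left[symmetric]) (use assms in \<open>auto intro!: e_series_nth_eq_0\<close>)
  also have "\<dots> = 0"
  proof -
    \<comment> \<open>Every row of the matrix belongs to a nonzero part, so the recurrence is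
      evaluated at a positive index, where the series 1 has coefficient 0.\<close>
    have "part \<rho> i \<noteq> 0" using i by (simp add: part_eq_0_iff)
    then have "shifted ?R \<rho> i \<noteq> 0" using i by (simp add: shifted_def)
    then show ?thesis by (simp add: h_series_e_series fps_znth_def)
  qed
  finally show "(\<Sum>j<?R. h m (int (shifted ?R \<rho> i) - int (shifted ?R \<kappa> j)) * fps_nth ?Q (?R - Suc j)) = 0" .
qed

text \<open>Here the number of variables becomes a bound on rows: a longer \<rho> makes the skew
  Schur polynomial vanish in m variables, and with it all coefficients at \<nu> of length at most
  m.\<close>

lemma schur_coeff_skew_schur_len:
  assumes "len \<nu> \<le> m" "schur_coeff (skew_schur \<rho> \<kappa>) \<nu> \<noteq> 0"
  shows "len \<rho> \<le> len \<kappa> + m"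
proof (rule ccontr)
  assume "\<not> ?thesis"
  then have lt: "len \<kappa> + m < len \<rho>" by simp
  have "restrict_vars m (skew_schur \<rho> \<kappa>) = 0"
    using restrict_skew_schur[of \<rho> "len \<rho>" \<kappa> m] skew_jt_vanish[OF lt] lt by simp
  then have "schur_coeff (skew_schur \<rho> \<kappa>) \<nu> = 0"
    using schur_coeff_eq[OF Lam_bounded_degree[OF skew_schur_Lam] assms(1), of \<rho> \<kappa>] by simp
  then show False using assms(2) by simp
qed

text \<open>Some rook strip \<open>mu\<close>/\<open>sg\<close> contributes, and then \<kappa> lies
  in \<open>sg\<close> and \<open>sg\<close> in \<open>mu\<close>. This passes the row bound from
  \<open>mu\<close> to \<kappa>.\<close>

lemma dual_g_coeff_contained: "len \<kappa> \<le> r \<Longrightarrow> dual_g_coeff r \<kappa> mu \<noteq> 0 \<Longrightarrow> contained \<kappa> mu"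
proof -
  assume k: "len \<kappa> \<le> r" and "dual_g_coeff r \<kappa> mu \<noteq> 0"
  then obtain sg where sg: "sg \<in> {sg. rook_strip mu sg}" "\<beta> ^ card (skew_diagram mu sg) * Groth_inv_det r \<kappa> sg \<noteq> 0"
    unfolding dual_g_coeff_def by (elim sum.not_neutral_contains_not_neutral)
  then have "contained \<kappa> sg" using toeplitz_det_eq_0[OF k] unfolding Groth_inv_det_def by (metis mult_zero_right)
  moreover have "contained sg mu" using sg by (simp add: rook_strip_def)
  ultimately show ?thesis by (rule contained_trans)
qed

section \<open>The adjoint operator and the series \<open>G_dslash\<close>\<close>

lemma series_mult_commute: "series_mult f g = series_mult g f"
proof
  fix c
  show "series_mult f g c = series_mult g f c"
    unfolding series_mult_def
    by (rule sum.reindex_bij_witness[of _ "\<lambda>(a, b). (b, a)" "\<lambda>(a, b). (b, a)"]) (auto simp: add.commute mult.commute)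
qed

lemma series_mult_sum_left:
  "series_mult (\<lambda>a. \<Sum>x\<in>A. d x * f x a) g = (\<lambda>a. \<Sum>x\<in>A. d x * series_mult (f x) g a)"
proof
  fix c
  have "series_mult (\<lambda>a. \<Sum>x\<in>A. d x * f x a) g c =
      (\<Sum>y\<in>{(a, b). a + b = c}. \<Sum>x\<in>A. d x * (f x (fst y) * g (snd y)))"
    unfolding series_mult_def by (rule sum.cong) (auto simp: sum_distrib_right mult.assoc)
  also have "\<dots> = (\<Sum>x\<in>A. \<Sum>y\<in>{(a, b). a + b = c}. d x * (f x (fst y) * g (snd y)))"
    by (rule sum.swap)
  also have "\<dots> = (\<Sum>x\<in>A. d x * series_mult (f x) g c)"
    unfolding series_mult_def by (simp add: sum_distrib_left case_prod_beta)
  finally show "series_mult (\<lambda>a. \<Sum>x\<in>A. d x * f x a) g c = (\<Sum>x\<in>A. d x * series_mult (f x) g c)" .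
qed

text \<open>The adjoint identity is linear in w and hence needs checking only on Schur functions,
  which also determine the result. That the candidate lies in the completion is left as a
  hypothesis, since it depends on f and c.\<close>

lemma perp_eq:
  assumes f: "f \<in> Lam" and u: "(\<lambda>\<nu>. hall c (series_mult f (schur \<nu>))) \<in> Lam_hat"
  shows "perp f c = (\<lambda>\<nu>. hall c (series_mult f (schur \<nu>)))"
  unfolding perp_def
proof (rule the_equality)
  let ?u = "\<lambda>\<nu>. hall c (series_mult f (schur \<nu>))"
  have "hall ?u w = hall c (series_mult f w)" if w: "w \<in> Lam" for w
  proof -
    let ?T = "{\<nu>. schur_coeff w \<nu> \<noteq> 0}"
    have fin: "finite ?T" by (rule finite_schur_coeff_support[OF Lam_bounded_degree[OF w]])
    have L: "\<forall>\<nu>\<in>?T. series_mult (schur \<nu>) f \<in> Lam" using Lam_series_mult schur_Lam f by blast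
    have "w = (\<lambda>a. \<Sum>\<nu>\<in>?T. schur_coeff w \<nu> * schur \<nu> a)" by (rule schur_expansion[OF w fin]) simp
    then have "series_mult f w = (\<lambda>a. \<Sum>\<nu>\<in>?T. schur_coeff w \<nu> * series_mult (schur \<nu>) f a)"
      unfolding series_mult_commute[of f w] using series_mult_sum_left[of "schur_coeff w" schur ?T f] by simp
    then have "hall c (series_mult f w) = (\<Sum>\<nu>\<in>?T. schur_coeff w \<nu> * hall c (series_mult (schur \<nu>) f))"
      using hall_sum[OF fin L, of c "schur_coeff w"] by simp
    also have "\<dots> = hall ?u w"
      by (subst hall_eq[OF w fin]) (simp_all add: series_mult_commute[of f] mult.commute)
    finally show ?thesis ..
  qed
  then show "?u \<in> Lam_hat \<and> (\<forall>w\<in>Lam. hall ?u w = hall c (series_mult f w))" using u by blast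
  fix v assume v: "v \<in> Lam_hat \<and> (\<forall>w\<in>Lam. hall v w = hall c (series_mult f w))"
  show "v = ?u"
  proof
    fix \<nu>
    have "hall v (schur \<nu>) = hall c (series_mult f (schur \<nu>))" using v schur_Lam by blast
    then show "v \<nu> = ?u \<nu>" by (simp add: hall_schur)
  qed
qed

text \<open>G_la is an infinite sum over \<rho>, but for \<nu> with at most m rows only \<rho> with
  at most len \<kappa> + m <= r rows pair nontrivially. So all coefficients can be written with
  determinants of the single size r.\<close>

lemma dslash_coeff:
  assumes "len la \<le> r" "len mu + m \<le> r" "len \<nu> \<le> m"
  shows "hall (Groth_coeff la) (series_mult (dual_g mu) (schur \<nu>)) =
    (\<Sum>\<kappa>\<in>ptn_box r (part mu 0). \<Sum>\<rho>\<in>ptn_box r (part la 0 + r). dual_g_coeff r \<kappa> mu * Groth_det r la \<rho> * schur_coeff (skew_schur \<rho> \<kappa>) \<nu>)"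
proof -
  have mu: "len mu \<le> r" using assms by simp
  have L: "\<forall>\<kappa>\<in>ptn_box r (part mu 0). series_mult (schur \<kappa>) (schur \<nu>) \<in> Lam" using Lam_series_mult schur_Lam by blast
  have "hall (Groth_coeff la) (series_mult (dual_g mu) (schur \<nu>)) =
      (\<Sum>\<kappa>\<in>ptn_box r (part mu 0). dual_g_coeff r \<kappa> mu * hall (Groth_coeff la) (series_mult (schur \<kappa>) (schur \<nu>)))"
    unfolding dual_g_eq(1)[OF mu] series_mult_sum_left by (rule hall_sum[OF finite_ptn_box L])
  also have "\<dots> = (\<Sum>\<kappa>\<in>ptn_box r (part mu 0). \<Sum>\<rho>\<in>ptn_box r (part la 0 + r). dual_g_coeff r \<kappa> mu * Groth_det r la \<rho> * schur_coeff (skew_schur \<rho> \<kappa>) \<nu>)"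
  proof (rule sum.cong)
    fix \<kappa> assume \<kappa>: "\<kappa> \<in> ptn_box r (part mu 0)"
    let ?f = "series_mult (schur \<kappa>) (schur \<nu>)"
    have f: "?f \<in> Lam" using L \<kappa> by blast
    let ?T = "{\<rho>. schur_coeff ?f \<rho> \<noteq> 0}"
    have fin: "finite ?T" by (rule finite_schur_coeff_support[OF Lam_bounded_degree[OF f]])
    show "dual_g_coeff r \<kappa> mu * hall (Groth_coeff la) ?f = (\<Sum>\<rho>\<in>ptn_box r (part la 0 + r). dual_g_coeff r \<kappa> mu * Groth_det r la \<rho> * schur_coeff (skew_schur \<rho> \<kappa>) \<nu>)"
    \<comment> \<open>The box allows \<kappa> up to r rows; only a nonzero coefficient confines
      \<kappa> to \<open>mu\<close> and gives the sharper bound on its length.\<close>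
    proof (cases "dual_g_coeff r \<kappa> mu = 0")
      case False
      then have "contained \<kappa> mu" using \<kappa> by (intro dual_g_coeff_contained) (auto simp: ptn_box_def)
      then have lk: "len \<kappa> + m \<le> r" using contained_len[of \<kappa> mu] assms by simp
      have sup: "\<rho> \<in> ptn_box r (part la 0 + r)" if "Groth_coeff la \<rho> * schur_coeff (skew_schur \<rho> \<kappa>) \<nu> \<noteq> 0" for \<rho>
      proof (rule Groth_coeff_ptn_box[OF assms(1)])
        show "len \<rho> \<le> r" using schur_coeff_skew_schur_len[OF assms(3), of \<rho> \<kappa>] that lk by simp
        show "Groth_coeff la \<rho> \<noteq> 0" using that by auto
      qed
      have "hall (Groth_coeff la) ?f = (\<Sum>\<rho>\<in>?T. Groth_coeff la \<rho> * schur_coeff (skew_schur \<rho> \<kappa>) \<nu>)"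
        unfolding schur_coeff_skew_schur by (rule hall_eq[OF f fin]) simp
      also have "\<dots> = (\<Sum>\<rho>\<in>?T \<union> ptn_box r (part la 0 + r). Groth_coeff la \<rho> * schur_coeff (skew_schur \<rho> \<kappa>) \<nu>)"
        by (rule sum.mono_neutral_left) (auto simp: fin finite_ptn_box schur_coeff_skew_schur)
      also have "\<dots> = (\<Sum>\<rho>\<in>ptn_box r (part la 0 + r). Groth_coeff la \<rho> * schur_coeff (skew_schur \<rho> \<kappa>) \<nu>)"
        by (rule sum.mono_neutral_right) (use fin finite_ptn_box sup in auto)
      also have "\<dots> = (\<Sum>\<rho>\<in>ptn_box r (part la 0 + r). Groth_det r la \<rho> * schur_coeff (skew_schur \<rho> \<kappa>) \<nu>)"
        by (rule sum.cong) (auto simp: ptn_box_def Groth_coeff_eq_Groth_det[OF assms(1)])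
      finally show ?thesis by (simp add: sum_distrib_left mult.assoc)
    qed simp
  qed simp
  finally show ?thesis .
qed

text \<open>One finite index set serving all \<kappa> and \<rho> at once, so that the sum over \<nu>
  can later be interchanged with the other two.\<close>

lemma G_dslash_support:
  assumes "len la \<le> r" "len mu + m \<le> r"
  defines "T \<equiv> (\<Union>\<kappa>\<in>ptn_box r (part mu 0). \<Union>\<rho>\<in>ptn_box r (part la 0 + r). {\<nu>. len \<nu> \<le> m \<and> schur_coeff (skew_schur \<rho> \<kappa>) \<nu> \<noteq> 0})"
  shows "finite T" "\<And>\<nu>. len \<nu> \<le> m \<Longrightarrow> hall (Groth_coeff la) (series_mult (dual_g mu) (schur \<nu>)) \<noteq> 0 \<Longrightarrow> \<nu> \<in> T"
proof -
  show "finite T" unfolding T_def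
    by (intro finite_UN_I finite_ptn_box finite_schur_coeff_support_len Lam_bounded_degree skew_schur_Lam)
  fix \<nu> assume \<nu>: "len \<nu> \<le> m" "hall (Groth_coeff la) (series_mult (dual_g mu) (schur \<nu>)) \<noteq> 0"
  then have "(\<Sum>\<kappa>\<in>ptn_box r (part mu 0). \<Sum>\<rho>\<in>ptn_box r (part la 0 + r). dual_g_coeff r \<kappa> mu * Groth_det r la \<rho> * schur_coeff (skew_schur \<rho> \<kappa>) \<nu>) \<noteq> 0"
    using dslash_coeff[OF assms(1,2) \<nu>(1)] by simp
  then obtain \<kappa> where \<kappa>: "\<kappa> \<in> ptn_box r (part mu 0)" "(\<Sum>\<rho>\<in>ptn_box r (part la 0 + r). dual_g_coeff r \<kappa> mu * Groth_det r la \<rho> * schur_coeff (skew_schur \<rho> \<kappa>) \<nu>) \<noteq> 0"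
    by (rule sum.not_neutral_contains_not_neutral)
  from \<kappa>(2) obtain \<rho> where \<rho>: "\<rho> \<in> ptn_box r (part la 0 + r)" "dual_g_coeff r \<kappa> mu * Groth_det r la \<rho> * schur_coeff (skew_schur \<rho> \<kappa>) \<nu> \<noteq> 0"
    by (rule sum.not_neutral_contains_not_neutral)
  then have "schur_coeff (skew_schur \<rho> \<kappa>) \<nu> \<noteq> 0" by auto
  then show "\<nu> \<in> T" unfolding T_def using \<nu>(1) \<kappa>(1) \<rho>(1) by blast
qed

lemma G_dslash_eq: "G_dslash la mu = (\<lambda>\<nu>. hall (Groth_coeff la) (series_mult (dual_g mu) (schur \<nu>)))"
  and G_dslash_Lam_hat: "G_dslash la mu \<in> Lam_hat"
proof -
  let ?u = "\<lambda>\<nu>. hall (Groth_coeff la) (series_mult (dual_g mu) (schur \<nu>))"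
  have u: "?u \<in> Lam_hat" unfolding Lam_hat_def
  proof (rule CollectI, rule allI)
    fix m
    \<comment> \<open>Membership in \<open>Lam_hat\<close> concerns one m at a time, so the size may
      grow with m.\<close>
    let ?r = "max (len la) (len mu + m)"
    let ?T = "\<Union>\<kappa>\<in>ptn_box ?r (part mu 0). \<Union>\<rho>\<in>ptn_box ?r (part la 0 + ?r). {\<nu>. len \<nu> \<le> m \<and> schur_coeff (skew_schur \<rho> \<kappa>) \<nu> \<noteq> 0}"
    have "{\<nu>. len \<nu> \<le> m \<and> ?u \<nu> \<noteq> 0} \<subseteq> ?T"
      using G_dslash_support(2)[of la ?r mu m] by auto
    moreover have "finite ?T" by (rule G_dslash_support(1)) simp_all
    ultimately show "finite {\<nu>. len \<nu> \<le> m \<and> ?u \<nu> \<noteq> 0}" by (rule finite_subset)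
  qed
  show "G_dslash la mu = ?u"
    unfolding G_dslash_def Groth_eq by (rule perp_eq[OF dual_g_eq(2)[OF order_refl] u])
  then show "G_dslash la mu \<in> Lam_hat" using u by simp
qed

text \<open>The determinant of the theorem in shifted exponents: \<open>shifted r sg j\<close> is
  the upper limit sg_j - j + r in 1-based notation, and differences of shifted exponents absorb the
  terms -i + j.\<close>

definition skew_Groth_det :: "nat \<Rightarrow> nat \<Rightarrow> ptn \<Rightarrow> ptn \<Rightarrow> kpoly" where
  "skew_Groth_det r m la sg = fdet r (\<lambda>i j. \<Sum>k=0..shifted r sg j. cst (fps_nth (neg_binom_ser j) k) * H_fun m i (int (shifted r la i) - int (shifted r sg j) + int k))"

text \<open>H is the convolution of (1 + \<beta> t)^i with the h_p. Substituting l = p + n for its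
  summation index n gives a sum over an absolute exponent, ready for Cauchy-Binet.\<close>

lemma H_fun_eq_sum:
  assumes "p + i < N"
  shows "H_fun m i (int p - q) = (\<Sum>l<N. cst (fps_znth (binom_ser i) (int l - int p)) * h m (int l - q))"
proof -
  have "H_fun m i (int p - q) = (\<Sum>n\<le>i. cst (fps_znth (binom_ser i) (int (p + n) - int p)) * h m (int (p + n) - q))"
    unfolding H_fun_def by (rule sum.cong) (simp_all add: fps_znth_def binom_ser_def algebra_simps)
  also have "\<dots> = (\<Sum>l\<in>{p..p + i}. cst (fps_znth (binom_ser i) (int l - int p)) * h m (int l - q))"
    by (rule sum.reindex_bij_witness[of _ "\<lambda>l. l - p" "\<lambda>k. p + k"]) auto
  also have "\<dots> = (\<Sum>l<N. cst (fps_znth (binom_ser i) (int l - int p)) * h m (int l - q))"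
    by (rule sum.mono_neutral_left) (use assms in \<open>auto simp: fps_znth_def binom_ser_nth_eq_0\<close>)
  finally show ?thesis .
qed

text \<open>Cauchy-Binet read backwards: a supplies minors in the exponents of \<rho>, the skew
  Schur polynomial the complementary ones, and the sum over \<rho> restores the convolution row by
  row.\<close>

lemma sum_Groth_det_skew_jt:
  assumes "len la \<le> r"
  shows "(\<Sum>\<rho>\<in>ptn_box r (part la 0 + r). cst (Groth_det r la \<rho>) * skew_jt m r \<rho> \<kappa>) =
    fdet r (\<lambda>i j. H_fun m i (int (shifted r la i) - int (shifted r \<kappa> j)))"
proof -
  let ?M = "part la 0 + r"
  have "fdet r (\<lambda>i j. H_fun m i (int (shifted r la i) - int (shifted r \<kappa> j))) =
      fdet r (\<lambda>i j. \<Sum>l<?M + r. cst (fps_znth (binom_ser i) (int l - int (shifted r la i))) * h m (int l - int (shifted r \<kappa> j)))"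
  proof (rule fdet_cong)
    fix i j assume "i < r"
    then have "shifted r la i + i < ?M + r" using part_antimono[of 0 i la] by (simp add: shifted_def)
    then show "H_fun m i (int (shifted r la i) - int (shifted r \<kappa> j)) =
        (\<Sum>l<?M + r. cst (fps_znth (binom_ser i) (int l - int (shifted r la i))) * h m (int l - int (shifted r \<kappa> j)))"
      by (rule H_fun_eq_sum)
  qed
  then show ?thesis unfolding cauchy_binet Groth_det_def toeplitz_det_def skew_jt_def cst_fdet by simp
qed

text \<open>Second use of Cauchy-Binet, now column by column. The intermediate exponent is l =
  \<open>shifted r sg j\<close> - k; the condition l >= 0 is what cuts the binomial series of column
  j off at k = \<open>shifted r sg j\<close>.\<close>

lemma sum_Groth_inv_det_H:
  assumes "len sg \<le> r" "part sg 0 \<le> M"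
  shows "(\<Sum>\<kappa>\<in>ptn_box r M. cst (Groth_inv_det r \<kappa> sg) * fdet r (\<lambda>i j. H_fun m i (int (shifted r la i) - int (shifted r \<kappa> j)))) = skew_Groth_det r m la sg"
proof -
  have "skew_Groth_det r m la sg = fdet r (\<lambda>i j. \<Sum>l<M + r. H_fun m i (int (shifted r la i) - int l) * cst (fps_znth (neg_binom_ser j) (int (shifted r sg j) - int l)))"
    unfolding skew_Groth_det_def
  proof (rule fdet_cong)
    fix i j assume "j < r"
    moreover have "sg \<in> ptn_box r M" using assms by (simp add: ptn_box_def)
    ultimately have b: "shifted r sg j < M + r" by (intro shifted_bound)
    have "(\<Sum>k=0..shifted r sg j. cst (fps_nth (neg_binom_ser j) k) * H_fun m i (int (shifted r la i) - int (shifted r sg j) + int k)) =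
        (\<Sum>l\<in>{..shifted r sg j}. H_fun m i (int (shifted r la i) - int l) * cst (fps_znth (neg_binom_ser j) (int (shifted r sg j) - int l)))"
      by (rule sum.reindex_bij_witness[of _ "\<lambda>l. shifted r sg j - l" "\<lambda>k. shifted r sg j - k"])
         (auto simp: fps_znth_def of_nat_diff algebra_simps)
    also have "\<dots> = (\<Sum>l<M + r. H_fun m i (int (shifted r la i) - int l) * cst (fps_znth (neg_binom_ser j) (int (shifted r sg j) - int l)))"
      by (rule sum.mono_neutral_left) (use b in \<open>auto simp: fps_znth_def\<close>)
    finally show "(\<Sum>k=0..shifted r sg j. cst (fps_nth (neg_binom_ser j) k) * H_fun m i (int (shifted r la i) - int (shifted r sg j) + int k)) =
        (\<Sum>l<M + r. H_fun m i (int (shifted r la i) - int l) * cst (fps_znth (neg_binom_ser j) (int (shifted r sg j) - int l)))" .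
  qed
  then show ?thesis unfolding cauchy_binet Groth_inv_det_def toeplitz_det_def cst_fdet by (simp add: mult.commute)
qed

theorem hat_restrict_G_dslash:
  assumes "len la \<le> r" "len mu + m \<le> r"
  shows "hat_restrict m (G_dslash la mu) =
    (\<Sum>sg | rook_strip mu sg. cst (\<beta> ^ card (skew_diagram mu sg)) * skew_Groth_det r m la sg)"
proof -
  let ?K = "ptn_box r (part mu 0)" and ?P = "ptn_box r (part la 0 + r)"
  let ?T = "\<Union>\<kappa>\<in>?K. \<Union>\<rho>\<in>?P. {\<nu>. len \<nu> \<le> m \<and> schur_coeff (skew_schur \<rho> \<kappa>) \<nu> \<noteq> 0}"
  let ?s = "\<lambda>\<nu>. restrict_vars m (schur \<nu>)"
  have finT: "finite ?T" by (rule G_dslash_support(1)[OF assms])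
  have lenT: "\<And>\<nu>. \<nu> \<in> ?T \<Longrightarrow> len \<nu> \<le> m" by auto
  have "hat_restrict m (G_dslash la mu) = (\<Sum>\<nu>\<in>?T. cst (G_dslash la mu \<nu>) * ?s \<nu>)"
    by (rule hat_restrict_superset[OF finT lenT]) (use G_dslash_support(2)[OF assms] in \<open>auto simp: G_dslash_eq\<close>)
  also have "\<dots> = (\<Sum>\<nu>\<in>?T. \<Sum>\<kappa>\<in>?K. \<Sum>\<rho>\<in>?P. cst (dual_g_coeff r \<kappa> mu) * (cst (Groth_det r la \<rho>) * (cst (schur_coeff (skew_schur \<rho> \<kappa>) \<nu>) * ?s \<nu>)))"
    by (rule sum.cong)
       (simp_all add: G_dslash_eq dslash_coeff[OF assms lenT] cst_sum cst_mult sum_distrib_right mult.assoc)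
  also have "\<dots> = (\<Sum>\<kappa>\<in>?K. \<Sum>\<nu>\<in>?T. \<Sum>\<rho>\<in>?P. cst (dual_g_coeff r \<kappa> mu) * (cst (Groth_det r la \<rho>) * (cst (schur_coeff (skew_schur \<rho> \<kappa>) \<nu>) * ?s \<nu>)))"
    by (rule sum.swap)
  also have "\<dots> = (\<Sum>\<kappa>\<in>?K. \<Sum>\<rho>\<in>?P. \<Sum>\<nu>\<in>?T. cst (dual_g_coeff r \<kappa> mu) * (cst (Groth_det r la \<rho>) * (cst (schur_coeff (skew_schur \<rho> \<kappa>) \<nu>) * ?s \<nu>)))"
    by (rule sum.cong[OF refl], rule sum.swap)
  also have "\<dots> = (\<Sum>\<kappa>\<in>?K. \<Sum>\<rho>\<in>?P. cst (dual_g_coeff r \<kappa> mu) * (cst (Groth_det r la \<rho>) * skew_jt m r \<rho> \<kappa>))"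
  proof (intro sum.cong refl)
    fix \<kappa> \<rho> assume kr: "\<kappa> \<in> ?K" "\<rho> \<in> ?P"
    have "skew_jt m r \<rho> \<kappa> = restrict_vars m (skew_schur \<rho> \<kappa>)"
      using restrict_skew_schur[of \<rho> r \<kappa> m] kr by (simp add: ptn_box_def)
    \<comment> \<open>The sum over \<nu> is folded back into a skew Schur polynomial in m variables;
      Schur functions with more than m rows vanish there, so \<open>?T\<close> captures the whole
      expansion.\<close>
    also have "\<dots> = (\<Sum>\<nu>\<in>?T. cst (schur_coeff (skew_schur \<rho> \<kappa>) \<nu>) * ?s \<nu>)"
      by (rule schur_expansion_restrict[OF skew_schur_Lam finT lenT]) (use kr in auto)
    finally show "(\<Sum>\<nu>\<in>?T. cst (dual_g_coeff r \<kappa> mu) * (cst (Groth_det r la \<rho>) * (cst (schur_coeff (skew_schur \<rho> \<kappa>) \<nu>) * ?s \<nu>))) =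
        cst (dual_g_coeff r \<kappa> mu) * (cst (Groth_det r la \<rho>) * skew_jt m r \<rho> \<kappa>)"
      by (simp only: sum_distrib_left)
  qed
  also have "\<dots> = (\<Sum>\<kappa>\<in>?K. cst (dual_g_coeff r \<kappa> mu) * fdet r (\<lambda>i j. H_fun m i (int (shifted r la i) - int (shifted r \<kappa> j))))"
    unfolding sum_distrib_left[symmetric] sum_Groth_det_skew_jt[OF assms(1)] ..
  also have "\<dots> = (\<Sum>\<kappa>\<in>?K. \<Sum>sg | rook_strip mu sg. cst (\<beta> ^ card (skew_diagram mu sg)) *
      (cst (Groth_inv_det r \<kappa> sg) * fdet r (\<lambda>i j. H_fun m i (int (shifted r la i) - int (shifted r \<kappa> j)))))"
    unfolding dual_g_coeff_def cst_sum cst_mult sum_distrib_right mult.assoc ..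
  also have "\<dots> = (\<Sum>sg | rook_strip mu sg. \<Sum>\<kappa>\<in>?K. cst (\<beta> ^ card (skew_diagram mu sg)) *
      (cst (Groth_inv_det r \<kappa> sg) * fdet r (\<lambda>i j. H_fun m i (int (shifted r la i) - int (shifted r \<kappa> j)))))"
    by (rule sum.swap)
  also have "\<dots> = (\<Sum>sg | rook_strip mu sg. cst (\<beta> ^ card (skew_diagram mu sg)) * skew_Groth_det r m la sg)"
  proof (rule sum.cong)
    fix sg assume "sg \<in> {sg. rook_strip mu sg}"
    then have c: "contained sg mu" by (simp add: rook_strip_def)
    have "len sg \<le> r" "part sg 0 \<le> part mu 0"
      using contained_len[OF c] assms c unfolding contained_def by auto
    then show "(\<Sum>\<kappa>\<in>?K. cst (\<beta> ^ card (skew_diagram mu sg)) *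
      (cst (Groth_inv_det r \<kappa> sg) * fdet r (\<lambda>i j. H_fun m i (int (shifted r la i) - int (shifted r \<kappa> j))))) =
      cst (\<beta> ^ card (skew_diagram mu sg)) * skew_Groth_det r m la sg"
      unfolding sum_distrib_left[symmetric] by (subst sum_Groth_inv_det_H) simp_all
  qed simp
  finally show ?thesis .
qed

section \<open>Skew Grothendieck polynomials\<close>

lemma Lam_hat_sum:
  assumes "finite A" "\<forall>x\<in>A. c x \<in> Lam_hat"
  shows "(\<lambda>\<nu>. \<Sum>x\<in>A. d x * c x \<nu>) \<in> Lam_hat"
  unfolding Lam_hat_def
proof (rule CollectI, rule allI)
  fix n
  have "{\<nu>. len \<nu> \<le> n \<and> (\<Sum>x\<in>A. d x * c x \<nu>) \<noteq> 0} \<subseteq> (\<Union>x\<in>A. {\<nu>. len \<nu> \<le> n \<and> c x \<nu> \<noteq> 0})"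
  proof
    fix \<nu> assume "\<nu> \<in> {\<nu>. len \<nu> \<le> n \<and> (\<Sum>x\<in>A. d x * c x \<nu>) \<noteq> 0}"
    then have l: "len \<nu> \<le> n" and nz: "(\<Sum>x\<in>A. d x * c x \<nu>) \<noteq> 0" by auto
    from nz obtain x where "x \<in> A" "d x * c x \<nu> \<noteq> 0" by (rule sum.not_neutral_contains_not_neutral)
    then show "\<nu> \<in> (\<Union>x\<in>A. {\<nu>. len \<nu> \<le> n \<and> c x \<nu> \<noteq> 0})" using l by auto
  qed
  moreover have "finite (\<Union>x\<in>A. {\<nu>. len \<nu> \<le> n \<and> c x \<nu> \<noteq> 0})"
    using assms by (auto simp: Lam_hat_def)
  ultimately show "finite {\<nu>. len \<nu> \<le> n \<and> (\<Sum>x\<in>A. d x * c x \<nu>) \<noteq> 0}" by (rule finite_subset)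
qed

lemma hat_restrict_sum:
  assumes "finite A" "\<forall>x\<in>A. c x \<in> Lam_hat"
  shows "hat_restrict n (\<lambda>\<nu>. \<Sum>x\<in>A. d x * c x \<nu>) = (\<Sum>x\<in>A. cst (d x) * hat_restrict n (c x))"
proof -
  let ?T = "\<Union>x\<in>A. {\<nu>. len \<nu> \<le> n \<and> c x \<nu> \<noteq> 0}"
  have fin: "finite ?T" using assms by (auto simp: Lam_hat_def)
  have len: "\<And>\<nu>. \<nu> \<in> ?T \<Longrightarrow> len \<nu> \<le> n" by auto
  have "hat_restrict n (\<lambda>\<nu>. \<Sum>x\<in>A. d x * c x \<nu>) = (\<Sum>\<nu>\<in>?T. cst (\<Sum>x\<in>A. d x * c x \<nu>) * restrict_vars n (schur \<nu>))"
  proof (rule hat_restrict_superset[OF fin len])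
    fix \<nu> assume l: "len \<nu> \<le> n" and nz: "(\<Sum>x\<in>A. d x * c x \<nu>) \<noteq> 0"
    from nz obtain x where "x \<in> A" "d x * c x \<nu> \<noteq> 0" by (rule sum.not_neutral_contains_not_neutral)
    then show "\<nu> \<in> ?T" using l by auto
  qed
  also have "\<dots> = (\<Sum>\<nu>\<in>?T. \<Sum>x\<in>A. cst (d x) * (cst (c x \<nu>) * restrict_vars n (schur \<nu>)))"
    unfolding cst_sum cst_mult sum_distrib_right mult.assoc ..
  also have "\<dots> = (\<Sum>x\<in>A. \<Sum>\<nu>\<in>?T. cst (d x) * (cst (c x \<nu>) * restrict_vars n (schur \<nu>)))"
    by (rule sum.swap)
  also have "\<dots> = (\<Sum>x\<in>A. cst (d x) * hat_restrict n (c x))"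
  proof (rule sum.cong)
    fix x assume x: "x \<in> A"
    have "hat_restrict n (c x) = (\<Sum>\<nu>\<in>?T. cst (c x \<nu>) * restrict_vars n (schur \<nu>))"
      by (rule hat_restrict_superset[OF fin len]) (use x in auto)
    then show "(\<Sum>\<nu>\<in>?T. cst (d x) * (cst (c x \<nu>) * restrict_vars n (schur \<nu>))) = cst (d x) * hat_restrict n (c x)"
      by (simp only: sum_distrib_left)
  qed simp
  finally show ?thesis .
qed

lemma rook_strip_contained: "rook_strip mu sg \<Longrightarrow> contained mu la \<Longrightarrow> contained sg la"
  unfolding rook_strip_def using contained_trans by blast

text \<open>Removing a nonempty rook strip lowers the size. Sizes are summed over the rows of
  \<open>la\<close>, a range common to all partitions contained in it.\<close>

lemma rook_strip_induct [consumes 1, case_names less]: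
  assumes "contained mu la"
    and step: "\<And>mu. contained mu la \<Longrightarrow> (\<And>sg. rook_strip mu sg \<Longrightarrow> sg \<noteq> mu \<Longrightarrow> P sg) \<Longrightarrow> P mu"
  shows "P mu"
  using assms(1)
proof (induction "\<Sum>i<len la. part mu i" arbitrary: mu rule: less_induct)
  case less
  show ?case
  proof (rule step[OF less.prems])
    fix sg assume sg: "rook_strip mu sg" "sg \<noteq> mu"
    then have c: "contained sg mu" by (simp add: rook_strip_def)
    then have "\<not> contained mu sg" using sg(2) contained_antisym by blast
    then obtain i where i: "part sg i < part mu i" unfolding contained_def by (auto simp: not_le)
    moreover have "part mu i \<le> part la i" using less.prems by (simp add: contained_def)
    ultimately have "i < len la" using part_eq_0_iff[of la i] by (cases "i < len la") auto
    then have "(\<Sum>i<len la. part sg i) < (\<Sum>i<len la. part mu i)"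
      using i c by (intro sum_strict_mono_ex1) (auto simp: contained_def)
    then show "P sg" by (rule less.hyps) (rule rook_strip_contained[OF sg(1) less.prems])
  qed
qed

lemma sum_rook_strip_split:
  "(\<Sum>sg | rook_strip mu sg. f sg) = f mu + (\<Sum>sg | rook_strip mu sg \<and> sg \<noteq> mu. f sg)"
proof -
  have "(\<Sum>sg | rook_strip mu sg. f sg) = f mu + (\<Sum>sg\<in>{sg. rook_strip mu sg} - {mu}. f sg)"
    by (rule sum.remove) (simp_all add: finite_rook_strips rook_strip_refl)
  also have "{sg. rook_strip mu sg} - {mu} = {sg. rook_strip mu sg \<and> sg \<noteq> mu}" by auto
  finally show ?thesis .
qed

lemma card_skew_diagram_refl: "card (skew_diagram mu mu) = 0"
  by (simp add: card_skew_diagram[OF order_refl])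

text \<open>The definition is useful only once the system is shown to have exactly one solution.
  Existence comes from the explicit inverse of the rook strip matrix, uniqueness from its unit
  diagonal by induction.\<close>

lemma G_skew_props:
  shows "contained mu la \<Longrightarrow> G_skew la mu \<in> Lam_hat"
    and "contained mu la \<Longrightarrow> G_dslash la mu = (\<lambda>nu. \<Sum>sg | rook_strip mu sg. \<beta> ^ card (skew_diagram mu sg) * G_skew la sg nu)"
proof -
  let ?r = "len la" and ?M = "part la 0"
  let ?C = "\<lambda>ta sg. if contained ta sg then \<Prod>i<?r. (- \<beta>) ^ (part sg i - part ta i) else 0"
  let ?Q = "\<lambda>F. (\<forall>mu. \<not> contained mu la \<longrightarrow> F mu = (\<lambda>_. 0)) \<and>
     (\<forall>mu. contained mu la \<longrightarrow> F mu \<in> Lam_hat \<and>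
        G_dslash la mu = (\<lambda>nu. \<Sum>sg | rook_strip mu sg. \<beta> ^ card (skew_diagram mu sg) * F sg nu))"
  \<comment> \<open>The inverted system: the sum of (-\<beta>)^|mu/ta| G_{la//ta} over
    \<open>ta\<close> contained in \<open>mu\<close>. The identity \<open>rook_strip_moebius\<close>
    that yields g_mu verifies it.\<close>
  define F where "F mu = (if contained mu la then (\<lambda>nu. \<Sum>ta\<in>ptn_box ?r ?M. ?C ta mu * G_dslash la ta nu) else (\<lambda>_. 0))" for mu
  have F: "?Q F"
  proof (intro conjI allI impI)
    fix mu assume mu: "contained mu la"
    show "F mu \<in> Lam_hat" 
      unfolding F_def if_P[OF mu] by (rule Lam_hat_sum[OF finite_ptn_box]) (simp add: G_dslash_Lam_hat)
    show "G_dslash la mu = (\<lambda>nu. \<Sum>sg | rook_strip mu sg. \<beta> ^ card (skew_diagram mu sg) * F sg nu)"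
    proof
      fix nu
      have "(\<Sum>sg | rook_strip mu sg. \<beta> ^ card (skew_diagram mu sg) * F sg nu) =
          (\<Sum>sg | rook_strip mu sg. \<Sum>ta\<in>ptn_box ?r ?M. (\<beta> ^ card (skew_diagram mu sg) * ?C ta sg) * G_dslash la ta nu)"
      proof (rule sum.cong)
        fix sg assume "sg \<in> {sg. rook_strip mu sg}"
        then have "contained sg la" using rook_strip_contained mu by blast
        then show "\<beta> ^ card (skew_diagram mu sg) * F sg nu =
            (\<Sum>ta\<in>ptn_box ?r ?M. (\<beta> ^ card (skew_diagram mu sg) * ?C ta sg) * G_dslash la ta nu)"
          unfolding F_def by (simp only: if_True sum_distrib_left mult.assoc)
      qed simp
      also have "\<dots> = (\<Sum>ta\<in>ptn_box ?r ?M. \<Sum>sg | rook_strip mu sg. (\<beta> ^ card (skew_diagram mu sg) * ?C ta sg) * G_dslash la ta nu)"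
        by (rule sum.swap)
      also have "\<dots> = (\<Sum>ta\<in>ptn_box ?r ?M. (if ta = mu then 1 else 0) * G_dslash la ta nu)"
        unfolding sum_distrib_right[symmetric] rook_strip_moebius[OF contained_len[OF mu]] ..
      also have "\<dots> = (\<Sum>ta\<in>ptn_box ?r ?M. if mu = ta then G_dslash la ta nu else 0)"
        by (rule sum.cong) auto
      also have "\<dots> = G_dslash la mu nu"
        using contained_ptn_box[OF mu, of ?r ?M] by (simp add: sum.delta'[OF finite_ptn_box])
      finally show "G_dslash la mu nu = (\<Sum>sg | rook_strip mu sg. \<beta> ^ card (skew_diagram mu sg) * F sg nu)" ..
    qed
  qed (simp add: F_def)
  have "G_skew la = F" unfolding G_skew_def
  proof (rule the_equality)
    show "?Q F" by (rule F)
    fix F' assume F': "?Q F'"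
    show "F' = F"
    proof
      fix mu
      show "F' mu = F mu"
      proof (cases "contained mu la")
        case True
        then show ?thesis
        proof (induction mu rule: rook_strip_induct)
          case (less mu)
          show ?case
          proof
            fix nu
            have eq: "(\<Sum>sg | rook_strip mu sg. \<beta> ^ card (skew_diagram mu sg) * F' sg nu) =
              (\<Sum>sg | rook_strip mu sg. \<beta> ^ card (skew_diagram mu sg) * F sg nu)"
            proof -
              have "G_dslash la mu = (\<lambda>nu. \<Sum>sg | rook_strip mu sg. \<beta> ^ card (skew_diagram mu sg) * F sg nu)"
                using F less(1) by blast
              moreover have "G_dslash la mu = (\<lambda>nu. \<Sum>sg | rook_strip mu sg. \<beta> ^ card (skew_diagram mu sg) * F' sg nu)"
                using F' less(1) by blast
              ultimately show ?thesis by (metis (no_types, lifting))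
            qed
            have "(\<Sum>sg | rook_strip mu sg \<and> sg \<noteq> mu. \<beta> ^ card (skew_diagram mu sg) * F' sg nu) =
              (\<Sum>sg | rook_strip mu sg \<and> sg \<noteq> mu. \<beta> ^ card (skew_diagram mu sg) * F sg nu)"
              by (rule sum.cong) (simp_all add: less(2))
            with eq show "F' mu nu = F mu nu"
              unfolding sum_rook_strip_split[of _ mu] card_skew_diagram_refl by simp
          qed
        qed
      next
        case False
        then show ?thesis using F F' by simp
      qed
    qed
  qed
  then have Q: "?Q (G_skew la)" using F by (simp only:)
  show "contained mu la \<Longrightarrow> G_skew la mu \<in> Lam_hat"
    using Q by blast
  show "contained mu la \<Longrightarrow> G_dslash la mu = (\<lambda>nu. \<Sum>sg | rook_strip mu sg. \<beta> ^ card (skew_diagram mu sg) * G_skew la sg nu)"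
    using Q by blast
qed

text \<open>The restrictions of the skew polynomials and the determinants satisfy the same rook
  strip relation with unit diagonal. The bound on m passes to every \<open>sg\<close> in the
  recursion, since \<open>sg\<close> is contained in \<open>mu\<close> and so has no more
  rows.\<close>

theorem hat_restrict_G_skew:
  assumes "contained mu la" "len la \<le> r" "len mu + m \<le> r"
  shows "hat_restrict m (G_skew la mu) = skew_Groth_det r m la mu"
  using assms(1,3)
proof (induction mu rule: rook_strip_induct)
  case (less mu)
  let ?S = "{sg. rook_strip mu sg}"
  have L: "\<forall>sg\<in>?S. G_skew la sg \<in> Lam_hat"
    using G_skew_props(1) rook_strip_contained less(1) by blast
  have IH: "hat_restrict m (G_skew la sg) = skew_Groth_det r m la sg" if "rook_strip mu sg" "sg \<noteq> mu" for sg
  proof (rule less(2)[OF that])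
    have "len sg \<le> len mu" using that(1) by (intro contained_len) (simp add: rook_strip_def)
    then show "len sg + m \<le> r" using less(3) by simp
  qed
  have "(\<Sum>sg\<in>?S. cst (\<beta> ^ card (skew_diagram mu sg)) * hat_restrict m (G_skew la sg)) = hat_restrict m (G_dslash la mu)"
    unfolding G_skew_props(2)[OF less(1)] by (rule hat_restrict_sum[OF finite_rook_strips L, symmetric])
  also have "\<dots> = (\<Sum>sg\<in>?S. cst (\<beta> ^ card (skew_diagram mu sg)) * skew_Groth_det r m la sg)"
    by (rule hat_restrict_G_dslash[OF assms(2) less(3)])
  finally have eq: "(\<Sum>sg\<in>?S. cst (\<beta> ^ card (skew_diagram mu sg)) * hat_restrict m (G_skew la sg)) =
      (\<Sum>sg\<in>?S. cst (\<beta> ^ card (skew_diagram mu sg)) * skew_Groth_det r m la sg)" .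
  have "(\<Sum>sg | rook_strip mu sg \<and> sg \<noteq> mu. cst (\<beta> ^ card (skew_diagram mu sg)) * hat_restrict m (G_skew la sg)) =
      (\<Sum>sg | rook_strip mu sg \<and> sg \<noteq> mu. cst (\<beta> ^ card (skew_diagram mu sg)) * skew_Groth_det r m la sg)"
    by (rule sum.cong) (simp_all add: IH)
  with eq show ?case
    unfolding sum_rook_strip_split[of _ mu] card_skew_diagram_refl by simp
qed

theorem proposition4p9:
  fixes la mu :: ptn and r m :: nat
  assumes "contained mu la" and "r \<ge> 1" and "r \<ge> len la" and "m \<le> r - len mu"
  shows "hat_restrict m (G_skew la mu) =
    det (mat r r (\<lambda>(i, j).
      \<Sum>k = 0..part mu j + r - Suc j.
        cst ((of_int (- int (Suc j)) gchoose k) * \<beta> ^ k) *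
        H_fun m i (int (part la i) - int (part mu j) - int (Suc i) + int (Suc j) + int k)))"
proof -
  \<comment> \<open>The subtraction in the hypothesis is truncated; containment gives len mu <= len
    la <= r and makes the additive form available.\<close>
  have "len mu + m \<le> r" using contained_len[OF assms(1)] assms(3,4) by linarith
  then have "hat_restrict m (G_skew la mu) = skew_Groth_det r m la mu"
    by (rule hat_restrict_G_skew[OF assms(1,3)])
  also have "\<dots> = fdet r (\<lambda>i j. \<Sum>k = 0..part mu j + r - Suc j.
        cst ((of_int (- int (Suc j)) gchoose k) * \<beta> ^ k) *
        H_fun m i (int (part la i) - int (part mu j) - int (Suc i) + int (Suc j) + int k))"
    unfolding skew_Groth_det_def
  proof (rule fdet_cong)
    fix i j assume ij: "i < r" "j < r"
    have "int (shifted r la i) - int (shifted r mu j) = int (part la i) - int (part mu j) - int (Suc i) + int (Suc j)"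
      using ij by (simp add: shifted_def)
    then show "(\<Sum>k=0..shifted r mu j. cst (fps_nth (neg_binom_ser j) k) * H_fun m i (int (shifted r la i) - int (shifted r mu j) + int k)) =
      (\<Sum>k = 0..part mu j + r - Suc j. cst ((of_int (- int (Suc j)) gchoose k) * \<beta> ^ k) *
        H_fun m i (int (part la i) - int (part mu j) - int (Suc i) + int (Suc j) + int k))"
      by (simp only: neg_binom_ser_def fps_nth_Abs_fps shifted_def)
  qed
  finally show ?thesis unfolding fdet_def .
qed

end
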